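(* Let $G_1,H,H_1,\ldots,H_r$ be connected graphs on $[m],[t],[n_1],\ldots,[n_r]$, respectively, where $r\geq 2$ and $2\leq m\leq t+\sum_{i=1}^r n_i$. Let $G_2:=H*(\bigsqcup_{i=1}^r H_i)$, and suppose that $n_i=1$ or $n_i\geq m$ for each $i=1,\ldots,r$. Then $J_{G_1,G_2}$ is unmixed if and only if the following conditions hold: (a) $J_{G_1,H_i}$ is unmixed for all $i=1,\ldots,r$, (b) $G_1$ is complete, (c) $t=(r-1)(m-1)$, and (d) for every $\emptyset\neq T\in\mathcal{C}(H)$, $(c_H(T)-1)(m-1)=|T|+\sum_{i=1}^r n_i$.
   Context: Graphs are finite simple graphs, $K$ is a field; $[n]$ denotes a vertex set with $n$ elements, and $\bigsqcup_{i=1}^r H_i$ is the graph with connected components $H_1,\ldots,H_r$ (on pairwise disjoint vertex sets). The join $G*H$ of graphs $G$ and $H$ on disjoint vertex sets is the graph with vertex set $V(G)\cup V(H)$ and edge set $E(G)\cup E(H)\cup\{\{v,w\}: v\in V(G), w\in V(H)\}$. For graphs $G_1$ on $[m]$ and $G_2$ on $[n]$, let $X=(x_{ij})$ be an $m\times n$ matrix of indeterminates and $S=K[X]$. For edges $e=\{i,j\}$ of $G_1$ ($i<j$) and $f=\{t,l\}$ of $G_2$ ($t<l$) put $p_{e,f}=x_{it}x_{jl}-x_{il}x_{jt}$. The binomial edge ideal of the pair $(G_1,G_2)$ is $J_{G_1,G_2}=(p_{e,f}: e\in E(G_1), f\in E(G_2))\subset S$. It is the zero ideal if one of the graphs has no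 edges. For a graph $G$ and $T\subseteq V(G)$, $c_G(T)$ is the number of connected components of the induced subgraph $G_{V(G)\setminus T}$. A cut point of a graph is a vertex whose deletion increases the number of connected components. $T\subset V(G)$ has cut point property for $G$ if each $i\in T$ is a cut point of the induced subgraph $G_{(V(G)\setminus T)\cup\{i\}}$. $\mathcal{C}(G)=\{\emptyset\}\cup\{T\subset V(G): T \text{ has cut point property for } G\}$. *)

theory Defs
  imports
    "Graph_Theory.Graph_Theory"
    "HOL-Algebra.Ideal"
    "HOL-Library.Poly_Mapping"
    "HOL-Library.Extended_Nat"
begin

section \<open>Graphs\<close>

text \<open>
  Finite simple graphs are the loopfree symmetric finite digraphs \<^locale>\<open>pair_graph\<close>:
  an undirected edge \<open>{v, w}\<close> is represented by the two pairs \<open>(v, w)\<close> and \<open>(w, v)\<close>.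
\<close>

definition graph_join :: "'a pair_pre_digraph \<Rightarrow> 'a pair_pre_digraph \<Rightarrow> 'a pair_pre_digraph" where
  "graph_join G H =
    \<lparr> pverts = pverts G \<union> pverts H,
      parcs = parcs G \<union> parcs H \<union> pverts G \<times> pverts H \<union> pverts H \<times> pverts G \<rparr>"

text \<open>Meant for families with pairwise disjoint vertex sets.\<close>

definition graph_disjoint_union :: "('i \<Rightarrow> 'a pair_pre_digraph) \<Rightarrow> 'i set \<Rightarrow> 'a pair_pre_digraph" where
  "graph_disjoint_union H I =
    \<lparr> pverts = (\<Union>i\<in>I. pverts (H i)), parcs = (\<Union>i\<in>I. parcs (H i)) \<rparr>"

text \<open>In a symmetric digraph the strongly connected components are the connected components.\<close>

definition num_components :: "('a, 'b) pre_digraph \<Rightarrow> nat" where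
  "num_components G = card (pre_digraph.sccs_verts G)"

text \<open>The number \<open>c\<^sub>G(T)\<close>.\<close>

definition num_components_without :: "('a, 'b) pre_digraph \<Rightarrow> 'a set \<Rightarrow> nat" where
  "num_components_without G T = num_components (G \<restriction> (verts G - T))"

definition cut_point :: "('a, 'b) pre_digraph \<Rightarrow> 'a \<Rightarrow> bool" where
  "cut_point G v \<longleftrightarrow>
    v \<in> verts G \<and> num_components G < num_components (pre_digraph.del_vert G v)"

definition cut_point_property :: "('a, 'b) pre_digraph \<Rightarrow> 'a set \<Rightarrow> bool" where
  "cut_point_property G T \<longleftrightarrow> (\<forall>i\<in>T. cut_point (G \<restriction> ((verts G - T) \<union> {i})) i)"

text \<open>The family \<open>\<C>(G)\<close>.\<close>

definition cut_sets :: "('a, 'b) pre_digraph \<Rightarrow> 'a set set" where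
  "cut_sets G = {{}} \<union> {T. T \<subseteq> verts G \<and> cut_point_property G T}"

section \<open>Polynomial rings\<close>

text \<open>
  Monomials with variables in \<open>'x\<close> are exponent functions of finite support, and polynomials
  with coefficients in \<open>'k\<close> are finitely supported functions on monomials, with the convolution
  product.  Restricting the variables to \<open>A\<close> gives \<open>K[x\<^sub>a : a \<in> A]\<close>.
\<close>

type_synonym ('x, 'k) mpoly = "('x \<Rightarrow>\<^sub>0 nat) \<Rightarrow>\<^sub>0 'k"

definition pvar :: "'x \<Rightarrow> ('x, 'k::field) mpoly" where
  "pvar a = Poly_Mapping.single (Poly_Mapping.single a 1) 1"

definition poly_ring :: "'x set \<Rightarrow> ('x, 'k::field) mpoly ring" where
  "poly_ring A =
    \<lparr> carrier = {p. \<forall>\<mu>\<in>Poly_Mapping.keys p. Poly_Mapping.keys \<mu> \<subseteq> A},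
      mult = (*), one = 1, zero = 0, add = (+) \<rparr>"

lemma cring_poly_ring: "cring (poly_ring A :: ('x, 'k::field) mpoly ring)"
proof (rule cringI)
  let ?C = "{p :: ('x, 'k) mpoly. \<forall>\<mu>\<in>Poly_Mapping.keys p. Poly_Mapping.keys \<mu> \<subseteq> A}"
  have add: "p + q \<in> ?C" if "p \<in> ?C" "q \<in> ?C" for p q
    using that Poly_Mapping.keys_add[of p q] by blast
  have uminus: "- p \<in> ?C" if "p \<in> ?C" for p
    using that by (auto simp: in_keys_iff)
  have mult: "p * q \<in> ?C" if pq: "p \<in> ?C" "q \<in> ?C" for p q
  proof (safe)
    fix \<mu> x assume "\<mu> \<in> Poly_Mapping.keys (p * q)" and x: "x \<in> Poly_Mapping.keys \<mu>"
    then obtain a b where ab: "a \<in> Poly_Mapping.keys p" "b \<in> Poly_Mapping.keys q" "\<mu> = a + b"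
      using Poly_Mapping.keys_mult[of p q] by blast
    with x have "x \<in> Poly_Mapping.keys a \<union> Poly_Mapping.keys b"
      using Poly_Mapping.keys_add[of a b] by blast
    with ab pq show "x \<in> A" by blast
  qed
  have C: "carrier (poly_ring A) = ?C" and ops: "mult (poly_ring A :: ('x, 'k) mpoly ring) = (*)"
      "one (poly_ring A :: ('x, 'k) mpoly ring) = 1"
      "zero (poly_ring A :: ('x, 'k) mpoly ring) = 0" "add (poly_ring A :: ('x, 'k) mpoly ring) = (+)"
    by (simp_all add: poly_ring_def)
  show "abelian_group (poly_ring A :: ('x, 'k) mpoly ring)"
  proof (rule abelian_groupI, unfold C ops)
    show "\<exists>q\<in>?C. q + p = 0" if "p \<in> ?C" for p
      using uminus[OF that] by (intro bexI[of _ "- p"]) simp_all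
  qed (erule (1) add | simp only: ac_simps | simp)+
  show "Group.comm_monoid (poly_ring A :: ('x, 'k) mpoly ring)"
    by (rule comm_monoidI, unfold C ops) (erule (1) mult | simp only: ac_simps | simp)+
qed (simp add: poly_ring_def distrib_right)

section \<open>Height, associated primes, unmixed ideals\<close>

definition prime_height :: "('a, 'm) ring_scheme \<Rightarrow> 'a set \<Rightarrow> enat" where
  "prime_height R P =
    Sup {enat n | n. \<exists>Q :: nat \<Rightarrow> 'a set.
      (\<forall>i\<le>n. primeideal (Q i) R) \<and> (\<forall>i<n. Q i \<subset> Q (Suc i)) \<and> Q n = P}"

text \<open>The associated primes of \<open>R / I\<close>: the prime ideals of the form \<open>I : f\<close>.\<close>

definition associated_primes :: "('a, 'm) ring_scheme \<Rightarrow> 'a set \<Rightarrow> 'a set set" where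
  "associated_primes R I =
    {P. primeideal P R \<and> (\<exists>f\<in>carrier R. P = {g \<in> carrier R. g \<otimes>\<^bsub>R\<^esub> f \<in> I})}"

definition unmixed_ideal :: "('a, 'm) ring_scheme \<Rightarrow> 'a set \<Rightarrow> bool" where
  "unmixed_ideal R I \<longleftrightarrow>
    (\<forall>P\<in>associated_primes R I. \<forall>Q\<in>associated_primes R I. prime_height R P = prime_height R Q)"

section \<open>Binomial edge ideals of pairs of graphs\<close>

definition edge_binomial :: "'a \<times> 'a \<Rightarrow> 'b \<times> 'b \<Rightarrow> ('a \<times> 'b, 'k::field) mpoly" where
  "edge_binomial e f =
    (case e of (i, j) \<Rightarrow> case f of (t, l) \<Rightarrow>
      pvar (i, t) * pvar (j, l) - pvar (i, l) * pvar (j, t))"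

definition pair_ring ::
  "'a pair_pre_digraph \<Rightarrow> 'b pair_pre_digraph \<Rightarrow> ('a \<times> 'b, 'k::field) mpoly ring" where
  "pair_ring G\<^sub>1 G\<^sub>2 = poly_ring (pverts G\<^sub>1 \<times> pverts G\<^sub>2)"

definition binomial_edge_ideal ::
  "'a::linorder pair_pre_digraph \<Rightarrow> 'b::linorder pair_pre_digraph \<Rightarrow>
    ('a \<times> 'b, 'k::field) mpoly set" where
  "binomial_edge_ideal G\<^sub>1 G\<^sub>2 =
    Idl\<^bsub>pair_ring G\<^sub>1 G\<^sub>2\<^esub>
      {edge_binomial (i, j) (t, l) | i j t l.
        (i, j) \<in> parcs G\<^sub>1 \<and> i < j \<and> (t, l) \<in> parcs G\<^sub>2 \<and> t < l}"

text \<open>The ideal \<open>J\<^bsub>G\<^sub>1,G\<^sub>2\<^esub>\<close> over the field \<open>'k\<close> is unmixed in \<open>K[x\<^sub>i\<^sub>j : i \<in> V(G\<^sub>1), j \<in> V(G\<^sub>2)]\<close>.\<close>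

definition J_unmixed ::
  "'k::field itself \<Rightarrow> 'a::linorder pair_pre_digraph \<Rightarrow> 'b::linorder pair_pre_digraph \<Rightarrow> bool" where
  "J_unmixed K G\<^sub>1 G\<^sub>2 \<longleftrightarrow>
    unmixed_ideal (pair_ring G\<^sub>1 G\<^sub>2 :: ('a \<times> 'b, 'k) mpoly ring) (binomial_edge_ideal G\<^sub>1 G\<^sub>2)"

end

theory Submission
  imports Defs "HOL-Library.Product_Lexorder"
begin

text \<open>
  For \<open>T \<subseteq> V(G)\<close> let \<open>P\<^sub>T\<close> be generated by the variables in the columns of \<open>T\<close> and the 2-minors of the
  column blocks given by the components of \<open>G - T\<close>; it is the kernel of a monomial map and has height
  \<open>|T| + (m - 1)(|V(G)| - c(T))\<close>.  For every connected \<open>G\<^sub>1\<close> with at least two vertices and every cut set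
  \<open>T\<close> of \<open>G\<^sub>2\<close>, \<open>P\<^sub>T\<close> is an associated prime of \<open>J\<close>, and the same holds with the roles of \<open>G\<^sub>1\<close> and \<open>G\<^sub>2\<close>
  exchanged.  A minimal separator \<open>T\<close> of a non-complete \<open>G\<^sub>1\<close> therefore forces \<open>|T| = (n - 1)(c(T) - 1)\<close>
  with \<open>n = |V(G\<^sub>2)|\<close>, which is impossible for \<open>m \<le> n\<close>.  If \<open>G\<^sub>1\<close> is complete, \<open>J\<close> is the intersection of
  all \<open>P\<^sub>T\<close>, so its associated primes are exactly the \<open>P\<^sub>T\<close> with \<open>T\<close> a cut set, and \<open>J\<close> is unmixed iff
  \<open>(c(T) - 1)(m - 1) = |T|\<close> for all of them.  The nonempty cut sets of a join \<open>H * (H\<^sub>1 \<squnion> \<dots> \<squnion> H\<^sub>r)\<close> are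
  \<open>V(H)\<close> together with cut sets of the \<open>H\<^sub>i\<close>, or all vertices of the \<open>H\<^sub>i\<close> together with a nonempty
  cut set of \<open>H\<close>.
\<close>

section \<open>Polynomials and substitutions\<close>

text \<open>All the algebra is done with substitutions. A kernel of a substitution is prime because
  its target is a domain, and heights are bounded from both sides by elementary means: from above by
  counting algebraically independent elements, from below by an explicit chain of kernels. For a G_1
  that is not complete, no decomposition of J is used: an f outside P_T with J : f = P_T is built by
  clearing denominators in the localization of J at P_T. That argument needs only connectedness of
  the graph on the rows, and it is stated for a matrix whose entries are named abstractly, so that
  rows and columns can be exchanged. For the contradiction in the non-complete case the equation for
  T gives |T| >= n - 1 >= m - 1, whereas T leaves at least two components and hence at least two
  vertices of G_1, so |T| <= m - 2. The join is tractable because a vertex set that meets both of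
  its sides is always connected.\<close>

abbreviation lookup where "lookup \<equiv> Poly_Mapping.lookup"
abbreviation keys where "keys \<equiv> Poly_Mapping.keys"
abbreviation msingle where "msingle \<equiv> Poly_Mapping.single"

abbreviation const :: "'k \<Rightarrow> ('x, 'k::field) mpoly" where
  "const c \<equiv> msingle 0 c"

abbreviation monom :: "('x \<Rightarrow>\<^sub>0 nat) \<Rightarrow> ('x, 'k::field) mpoly" where
  "monom \<mu> \<equiv> msingle \<mu> 1"

definition mono_subst :: "('x \<Rightarrow> ('y, 'k::field) mpoly) \<Rightarrow> ('x \<Rightarrow>\<^sub>0 nat) \<Rightarrow> ('y, 'k) mpoly" where
  "mono_subst \<sigma> \<mu> = (\<Prod>a\<in>keys \<mu>. \<sigma> a ^ lookup \<mu> a)"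

definition psubst :: "('x \<Rightarrow> ('y, 'k::field) mpoly) \<Rightarrow> ('x, 'k) mpoly \<Rightarrow> ('y, 'k) mpoly" where
  "psubst \<sigma> p = (\<Sum>\<mu>\<in>keys p. const (lookup p \<mu>) * mono_subst \<sigma> \<mu>)"

lemma mono_subst_superset:
  assumes "finite A" "keys \<mu> \<subseteq> A"
  shows "mono_subst \<sigma> \<mu> = (\<Prod>a\<in>A. \<sigma> a ^ lookup \<mu> a)"
  unfolding mono_subst_def
  by (rule prod.mono_neutral_left) (use assms in \<open>auto simp: in_keys_iff\<close>)

lemma mono_subst_add: "mono_subst \<sigma> (\<mu> + \<nu>) = mono_subst \<sigma> \<mu> * mono_subst \<sigma> \<nu>"
proof -
  let ?A = "keys \<mu> \<union> keys \<nu>"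
  have "keys (\<mu> + \<nu>) \<subseteq> ?A" by (rule Poly_Mapping.keys_add)
  then show ?thesis
    by (simp add: mono_subst_superset[where A = ?A] lookup_add power_add prod.distrib)
qed

lemma mono_subst_0 [simp]: "mono_subst \<sigma> 0 = 1"
  by (simp add: mono_subst_def)

lemma mono_subst_single [simp]: "mono_subst \<sigma> (msingle a n) = \<sigma> a ^ n"
  by (cases "n = 0") (auto simp: mono_subst_def)

lemma psubst_superset:
  assumes "finite M" "keys p \<subseteq> M"
  shows "psubst \<sigma> p = (\<Sum>\<mu>\<in>M. const (lookup p \<mu>) * mono_subst \<sigma> \<mu>)"
  unfolding psubst_def
  by (rule sum.mono_neutral_left) (use assms in \<open>auto simp: in_keys_iff\<close>)

lemma psubst_0 [simp]: "psubst \<sigma> 0 = 0"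
  by (simp add: psubst_def)

lemma psubst_single: "psubst \<sigma> (msingle \<mu> c) = const c * mono_subst \<sigma> \<mu>"
  by (cases "c = 0") (auto simp: psubst_def)

lemma psubst_1 [simp]: "psubst \<sigma> 1 = 1"
  using psubst_single[of \<sigma> 0 1] by simp

lemma psubst_pvar [simp]: "psubst \<sigma> (pvar a) = \<sigma> a"
  by (simp add: pvar_def psubst_single)

lemma psubst_add: "psubst \<sigma> (p + q) = psubst \<sigma> p + psubst \<sigma> q"
proof -
  let ?M = "keys p \<union> keys q"
  have "keys (p + q) \<subseteq> ?M" by (rule Poly_Mapping.keys_add)
  then show ?thesis
    by (simp add: psubst_superset[where M = ?M] lookup_add single_add distrib_right sum.distrib)
qed

lemma psubst_uminus: "psubst \<sigma> (- p) = - psubst \<sigma> p"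
  using psubst_add[of \<sigma> p "- p"] by (simp add: eq_neg_iff_add_eq_0 add.commute)

lemma psubst_diff: "psubst \<sigma> (p - q) = psubst \<sigma> p - psubst \<sigma> q"
  using psubst_add[of \<sigma> p "- q"] by (simp add: psubst_uminus)

lemma psubst_sum: "psubst \<sigma> (\<Sum>i\<in>I. f i) = (\<Sum>i\<in>I. psubst \<sigma> (f i))"
  by (induction I rule: infinite_finite_induct) (auto simp: psubst_add)

lemma poly_eq_sum: "p = (\<Sum>\<mu>\<in>keys p. msingle \<mu> (lookup p \<mu>))"
proof (rule poly_mapping_eqI)
  fix \<nu>
  show "lookup p \<nu> = lookup (\<Sum>\<mu>\<in>keys p. msingle \<mu> (lookup p \<mu>)) \<nu>"
    by (simp add: lookup_sum lookup_single when_def in_keys_iff)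
qed

lemma psubst_mult: "psubst \<sigma> (p * q) = psubst \<sigma> p * psubst \<sigma> q"
proof -
  have single: "psubst \<sigma> (msingle \<mu> c * msingle \<nu> d) = psubst \<sigma> (msingle \<mu> c) * psubst \<sigma> (msingle \<nu> d)"
    for \<mu> \<nu> c d
  proof -
    have "psubst \<sigma> (msingle \<mu> c * msingle \<nu> d) =
        (const c * const d) * (mono_subst \<sigma> \<mu> * mono_subst \<sigma> \<nu>)"
      by (simp add: mult_single psubst_single mono_subst_add)
    then show ?thesis by (simp only: psubst_single ac_simps)
  qed
  have "psubst \<sigma> (p * q) = psubst \<sigma> ((\<Sum>\<mu>\<in>keys p. msingle \<mu> (lookup p \<mu>)) * (\<Sum>\<nu>\<in>keys q. msingle \<nu> (lookup q \<nu>)))"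
    using poly_eq_sum[of p] poly_eq_sum[of q] by simp
  also have "\<dots> = psubst \<sigma> (\<Sum>\<mu>\<in>keys p. msingle \<mu> (lookup p \<mu>)) * psubst \<sigma> (\<Sum>\<nu>\<in>keys q. msingle \<nu> (lookup q \<nu>))"
    by (simp only: sum_product psubst_sum single)
  also have "\<dots> = psubst \<sigma> p * psubst \<sigma> q"
    using poly_eq_sum[of p] poly_eq_sum[of q] by simp
  finally show ?thesis .
qed

lemma psubst_power: "psubst \<sigma> (p ^ n) = psubst \<sigma> p ^ n"
  by (induction n) (auto simp: psubst_mult)

lemma psubst_prod: "psubst \<sigma> (\<Prod>i\<in>I. f i) = (\<Prod>i\<in>I. psubst \<sigma> (f i))"
  by (induction I rule: infinite_finite_induct) (auto simp: psubst_mult)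

lemma psubst_psubst: "psubst \<tau> (psubst \<sigma> p) = psubst (\<lambda>a. psubst \<tau> (\<sigma> a)) p"
proof -
  have "psubst \<tau> (const c * mono_subst \<sigma> \<mu>) = const c * mono_subst (\<lambda>a. psubst \<tau> (\<sigma> a)) \<mu>" for c \<mu>
    by (simp add: psubst_mult psubst_single mono_subst_def psubst_prod psubst_power)
  then show ?thesis by (simp add: psubst_def[of \<sigma>] psubst_sum psubst_def[of "\<lambda>a. psubst \<tau> (\<sigma> a)"])
qed

lemma psubst_cong:
  assumes "\<And>\<mu> a. \<mu> \<in> keys p \<Longrightarrow> a \<in> keys \<mu> \<Longrightarrow> \<sigma> a = \<tau> a"
  shows "psubst \<sigma> p = psubst \<tau> p"
  unfolding psubst_def mono_subst_def using assms by (intro sum.cong prod.cong arg_cong2[where f = "(*)"] refl) auto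

lemma pvar_power: "pvar a ^ n = (monom (msingle a n) :: ('x, 'k::field) mpoly)"
  by (induction n) (auto simp: pvar_def mult_single single_add[symmetric])

lemma monom_add: "monom (\<mu> + \<nu>) = (monom \<mu> * monom \<nu> :: ('x, 'k::field) mpoly)"
  by (simp add: mult_single)

lemma monom_sum: "monom (\<Sum>i\<in>I. f i) = (\<Prod>i\<in>I. monom (f i) :: ('x, 'k::field) mpoly)"
  by (induction I rule: infinite_finite_induct) (simp_all add: monom_add)

lemma mono_subst_pvar: "mono_subst pvar \<mu> = (monom \<mu> :: ('x, 'k::field) mpoly)"
proof -
  have "(\<Sum>a\<in>keys \<mu>. msingle a (lookup \<mu> a)) = \<mu>"
    by (rule poly_mapping_eqI) (simp add: lookup_sum lookup_single when_def in_keys_iff)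
  then show ?thesis by (simp add: mono_subst_def pvar_power monom_sum[symmetric])
qed

lemma psubst_id: "psubst pvar p = p"
  using poly_eq_sum[of p] by (simp add: psubst_def mono_subst_pvar mult_single)

section \<open>Ideals, prime ideals and kernels in polynomial rings with restricted
  variables\<close>

definition poly_carrier :: "'x set \<Rightarrow> ('x, 'k::field) mpoly set" where
  "poly_carrier A = {p. \<forall>\<mu>\<in>keys p. keys \<mu> \<subseteq> A}"

lemma poly_ring_simps [simp]:
  "carrier (poly_ring A) = poly_carrier A" "mult (poly_ring A) = (*)" "one (poly_ring A) = 1"
  "zero (poly_ring A) = 0" "add (poly_ring A) = (+)"
  by (simp_all add: poly_ring_def poly_carrier_def)

lemma poly_carrier_mono: "A \<subseteq> B \<Longrightarrow> poly_carrier A \<subseteq> poly_carrier B"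
  by (auto simp: poly_carrier_def)

lemma carrier_single: "keys \<mu> \<subseteq> A \<Longrightarrow> msingle \<mu> c \<in> poly_carrier A"
  by (auto simp: poly_carrier_def)

lemma carrier_0 [simp]: "0 \<in> poly_carrier A" by (simp add: poly_carrier_def)
lemma carrier_1 [simp]: "1 \<in> poly_carrier A" by (simp add: poly_carrier_def)
lemma carrier_const [simp]: "const c \<in> poly_carrier A" by (simp add: carrier_single)

lemma carrier_pvar [simp]: "(pvar a :: ('x, 'k::field) mpoly) \<in> poly_carrier A \<longleftrightarrow> a \<in> A"
  by (auto simp: poly_carrier_def pvar_def)

lemma carrier_add [intro]: "p \<in> poly_carrier A \<Longrightarrow> q \<in> poly_carrier A \<Longrightarrow> p + q \<in> poly_carrier A"
  using Poly_Mapping.keys_add[of p q] by (auto simp: poly_carrier_def)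

lemma carrier_uminus [intro]: "p \<in> poly_carrier A \<Longrightarrow> - p \<in> poly_carrier A"
  by (auto simp: poly_carrier_def in_keys_iff)

lemma carrier_diff [intro]: "p \<in> poly_carrier A \<Longrightarrow> q \<in> poly_carrier A \<Longrightarrow> p - q \<in> poly_carrier A"
  using carrier_add[of p A "- q"] carrier_uminus[of q A] by simp

lemma carrier_mult [intro]: "p \<in> poly_carrier A \<Longrightarrow> q \<in> poly_carrier A \<Longrightarrow> p * q \<in> poly_carrier A"
  for p :: "('x, 'k::field) mpoly"
  using cring.cring_simprules(5)[OF cring_poly_ring[of A], of p q] by simp

lemma carrier_sum: "(\<And>i. i \<in> I \<Longrightarrow> f i \<in> poly_carrier A) \<Longrightarrow> (\<Sum>i\<in>I. f i) \<in> poly_carrier A"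
  by (induction I rule: infinite_finite_induct) auto

lemma carrier_prod: "(\<And>i. i \<in> I \<Longrightarrow> f i \<in> poly_carrier A) \<Longrightarrow> (\<Prod>i\<in>I. f i) \<in> poly_carrier A"
  by (induction I rule: infinite_finite_induct) auto

lemma carrier_power: "p \<in> poly_carrier A \<Longrightarrow> p ^ n \<in> poly_carrier A"
  by (induction n) auto

lemma carrier_psubst:
  assumes "p \<in> poly_carrier B" "\<And>b. b \<in> B \<Longrightarrow> \<sigma> b \<in> poly_carrier A"
  shows "psubst \<sigma> p \<in> poly_carrier A"
  unfolding psubst_def mono_subst_def using assms
  by (intro carrier_sum carrier_mult carrier_prod carrier_power carrier_const)
    (auto simp: poly_carrier_def[of B])

lemma poly_a_inv: "p \<in> poly_carrier A \<Longrightarrow> a_inv (poly_ring A) p = - p"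
  for p :: "('x, 'k::field) mpoly"
proof -
  assume p: "p \<in> poly_carrier A"
  interpret cring "poly_ring A :: ('x, 'k) mpoly ring" by (rule cring_poly_ring)
  show ?thesis using p by (intro minus_equality) auto
qed

lemma ideal_poly_iff:
  "ideal I (poly_ring A :: ('x, 'k::field) mpoly ring) \<longleftrightarrow>
    I \<subseteq> poly_carrier A \<and> 0 \<in> I \<and> (\<forall>p\<in>I. \<forall>q\<in>I. p + q \<in> I) \<and>
    (\<forall>p\<in>I. \<forall>q\<in>poly_carrier A. q * p \<in> I)" (is "_ \<longleftrightarrow> ?R")
proof
  assume "ideal I (poly_ring A :: ('x, 'k) mpoly ring)"
  then interpret ideal I "poly_ring A :: ('x, 'k) mpoly ring" .
  show ?R using a_subset additive_subgroup.zero_closed[OF is_additive_subgroup]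
      additive_subgroup.a_closed[OF is_additive_subgroup] I_l_closed by auto
next
  assume R: ?R
  interpret cring "poly_ring A :: ('x, 'k) mpoly ring" by (rule cring_poly_ring)
  show "ideal I (poly_ring A :: ('x, 'k) mpoly ring)"
  proof (rule idealI)
    show "ring (poly_ring A :: ('x, 'k) mpoly ring)" by (rule ring_axioms)
    show "subgroup I (add_monoid (poly_ring A))"
    proof (rule group.subgroupI)
      show "Group.group (add_monoid (poly_ring A :: ('x, 'k) mpoly ring))" by (rule a_group)
      fix p assume p: "p \<in> I"
      then have "- 1 * p \<in> I" using R carrier_uminus[OF carrier_1] by blast
      then show "inv\<^bsub>add_monoid (poly_ring A)\<^esub> p \<in> I"
        using p R poly_a_inv[of p A] by (auto simp: a_inv_def)
    qed (use R in auto)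
  qed (use R in \<open>auto simp: mult.commute\<close>)
qed

lemma
  assumes "ideal I (poly_ring A :: ('x, 'k::field) mpoly ring)"
  shows ideal_subset: "p \<in> I \<Longrightarrow> p \<in> poly_carrier A"
    and ideal_0: "0 \<in> I"
    and ideal_add: "p \<in> I \<Longrightarrow> q \<in> I \<Longrightarrow> p + q \<in> I"
    and ideal_mult: "p \<in> I \<Longrightarrow> q \<in> poly_carrier A \<Longrightarrow> q * p \<in> I"
  using assms unfolding ideal_poly_iff by auto

lemma ideal_uminus:
  assumes "ideal I (poly_ring A :: ('x, 'k::field) mpoly ring)" "p \<in> I"
  shows "- p \<in> I"
  using ideal_mult[OF assms carrier_uminus[OF carrier_1]] by simp

lemma ideal_diff:
  assumes "ideal I (poly_ring A :: ('x, 'k::field) mpoly ring)" "p \<in> I" "q \<in> I"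
  shows "p - q \<in> I"
  using ideal_add[OF assms(1,2) ideal_uminus[OF assms(1,3)]] by simp

lemma ideal_sum:
  assumes "ideal I (poly_ring A :: ('x, 'k::field) mpoly ring)" "\<And>s. s \<in> S \<Longrightarrow> f s \<in> I"
  shows "(\<Sum>s\<in>S. f s) \<in> I"
  using assms(2) by (induction S rule: infinite_finite_induct)
    (auto intro: ideal_0[OF assms(1)] ideal_add[OF assms(1)])

lemma primeideal_poly_iff:
  "primeideal P (poly_ring A :: ('x, 'k::field) mpoly ring) \<longleftrightarrow>
    ideal P (poly_ring A :: ('x, 'k) mpoly ring) \<and> 1 \<notin> P \<and>
    (\<forall>p\<in>poly_carrier A. \<forall>q\<in>poly_carrier A. p * q \<in> P \<longrightarrow> p \<in> P \<or> q \<in> P)" (is "_ \<longleftrightarrow> ?R")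
proof
  assume "primeideal P (poly_ring A :: ('x, 'k) mpoly ring)"
  then interpret primeideal P "poly_ring A :: ('x, 'k) mpoly ring" .
  show ?R using is_ideal I_prime I_notcarr one_imp_carrier by auto
next
  assume R: ?R
  show "primeideal P (poly_ring A :: ('x, 'k) mpoly ring)"
    by (rule primeidealI) (use R in \<open>auto simp: cring_poly_ring\<close>)
qed

definition subst_ker :: "'x set \<Rightarrow> ('x \<Rightarrow> ('y, 'k::field) mpoly) \<Rightarrow> ('x, 'k) mpoly set" where
  "subst_ker A \<sigma> = {p \<in> poly_carrier A. psubst \<sigma> p = 0}"

text \<open>The linear order on the target variables is what makes the target polynomials an
  integral domain; the kernel of a ring homomorphism into a domain is prime.\<close>

lemma primeideal_subst_ker:
  fixes \<sigma> :: "'x \<Rightarrow> ('y::linorder, 'k::field) mpoly"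
  shows "primeideal (subst_ker A \<sigma>) (poly_ring A :: ('x, 'k) mpoly ring)"
  unfolding primeideal_poly_iff ideal_poly_iff subst_ker_def
  by (auto simp: psubst_add psubst_mult)

section \<open>Algebraic independence and height\<close>

text \<open>Each exponent is bounded separately, rather than the total degree, so that the number of
  such monomials is an exact power.\<close>

definition bounded_monomials :: "'x set \<Rightarrow> nat \<Rightarrow> ('x \<Rightarrow>\<^sub>0 nat) set" where
  "bounded_monomials A e = {\<mu>. keys \<mu> \<subseteq> A \<and> (\<forall>a. lookup \<mu> a \<le> e)}"

lemma bij_betw_bounded_monomials:
  assumes "finite A"
  shows "bij_betw (\<lambda>\<mu>. restrict (lookup \<mu>) A) (bounded_monomials A e) (A \<rightarrow>\<^sub>E {..e})"
proof (rule bij_betw_byWitness[where f' = "\<lambda>g. Abs_poly_mapping (\<lambda>a. if a \<in> A then g a else 0)"])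
  have lk: "lookup (Abs_poly_mapping (\<lambda>a. if a \<in> A then g a else 0)) = (\<lambda>a. if a \<in> A then g a else 0)"
    for g :: "'a \<Rightarrow> nat"
    by (rule lookup_Abs_poly_mapping) (rule finite_subset[OF _ assms], auto)
  show "\<forall>\<mu>\<in>bounded_monomials A e. Abs_poly_mapping (\<lambda>a. if a \<in> A then restrict (lookup \<mu>) A a else 0) = \<mu>"
    by (auto simp: bounded_monomials_def lk in_keys_iff intro!: poly_mapping_eqI)
  show "\<forall>g\<in>A \<rightarrow>\<^sub>E {..e}. restrict (lookup (Abs_poly_mapping (\<lambda>a. if a \<in> A then g a else 0))) A = g"
    by (auto simp: lk fun_eq_iff PiE_iff extensional_def)
  show "(\<lambda>g. Abs_poly_mapping (\<lambda>a. if a \<in> A then g a else 0)) ` (A \<rightarrow>\<^sub>E {..e}) \<subseteq> bounded_monomials A e"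
    by (auto simp: bounded_monomials_def lk in_keys_iff split: if_splits)
qed (auto simp: bounded_monomials_def)

lemma
  assumes "finite A"
  shows finite_bounded_monomials: "finite (bounded_monomials A e)"
    and card_bounded_monomials: "card (bounded_monomials A e) = Suc e ^ card A"
proof -
  note b = bij_betw_bounded_monomials[OF assms, of e]
  show "finite (bounded_monomials A e)"
    using bij_betw_finite[OF b] assms by (simp add: finite_PiE)
  show "card (bounded_monomials A e) = Suc e ^ card A"
    using bij_betw_same_card[OF b] assms by (simp add: card_PiE)
qed

definition bounded_polys :: "'x set \<Rightarrow> nat \<Rightarrow> ('x, 'k::field) mpoly set" where
  "bounded_polys A e = {p. keys p \<subseteq> bounded_monomials A e}"

lemma bounded_polys_mono: "e \<le> e' \<Longrightarrow> bounded_polys A e \<subseteq> bounded_polys A e'"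
  by (auto simp: bounded_polys_def bounded_monomials_def intro: order_trans)

lemma bounded_polys_mult:
  assumes "p \<in> bounded_polys A d" "q \<in> bounded_polys A e"
  shows "p * q \<in> bounded_polys A (d + e)"
proof -
  have "\<mu> + \<nu> \<in> bounded_monomials A (d + e)"
    if "\<mu> \<in> bounded_monomials A d" "\<nu> \<in> bounded_monomials A e" for \<mu> \<nu>
    using that Poly_Mapping.keys_add[of \<mu> \<nu>] by (auto simp: bounded_monomials_def lookup_add intro: add_mono)
  then show ?thesis
    using Poly_Mapping.keys_mult[of p q] assms by (force simp: bounded_polys_def)
qed

lemma bounded_polys_1: "1 \<in> bounded_polys A e"
  by (auto simp: bounded_polys_def bounded_monomials_def)

lemma bounded_polys_power: "p \<in> bounded_polys A e \<Longrightarrow> p ^ n \<in> bounded_polys A (n * e)"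
  by (induction n) (auto simp: bounded_polys_1 intro: bounded_polys_mult)

lemma bounded_polys_prod:
  "(\<And>i. i \<in> I \<Longrightarrow> f i \<in> bounded_polys A (e i)) \<Longrightarrow> (\<Prod>i\<in>I. f i) \<in> bounded_polys A (\<Sum>i\<in>I. e i)"
  by (induction I rule: infinite_finite_induct) (auto simp: bounded_polys_1 intro: bounded_polys_mult)

lemma poly_carrier_bounded:
  assumes "p \<in> poly_carrier A"
  shows "\<exists>e. p \<in> bounded_polys A e"
proof -
  have "finite (\<Union>\<mu>\<in>keys p. lookup \<mu> ` keys \<mu>)" by simp
  then obtain e where e: "\<forall>x\<in>(\<Union>\<mu>\<in>keys p. lookup \<mu> ` keys \<mu>). x \<le> e"
    using finite_nat_set_iff_bounded_le by blast
  have "lookup \<mu> a \<le> e" if "\<mu> \<in> keys p" for \<mu> a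
    using e that by (cases "a \<in> keys \<mu>") (auto simp: in_keys_iff)
  then have "p \<in> bounded_polys A e"
    using assms by (auto simp: bounded_polys_def bounded_monomials_def poly_carrier_def)
  then show ?thesis ..
qed

text \<open>
  Count monomials: the \<open>(D + 1)\<^sup>k\<close> products of the \<open>y i\<close> with exponents at most \<open>D\<close> are linearly
  independent, and they live in a space whose dimension grows like \<open>D\<close> to the number of variables.
\<close>

lemma alg_independent_le_card:
  fixes y :: "nat \<Rightarrow> ('x, 'k::field) mpoly"
  assumes A: "finite A" and y: "\<And>i. i < k \<Longrightarrow> y i \<in> poly_carrier A"
    and inj: "\<And>F. F \<in> poly_carrier {..<k} \<Longrightarrow> psubst y F = 0 \<Longrightarrow> F = 0"
  shows "k \<le> card A"
proof (rule ccontr)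
  assume "\<not> k \<le> card A"
  then have less: "card A < k" by simp
  interpret vs: vector_space "\<lambda>(c::'k) (p::('x, 'k) mpoly). const c * p"
    by unfold_locales (simp_all add: single_add distrib_left distrib_right mult_single mult.assoc[symmetric])
  have "\<exists>e. \<forall>i<k. y i \<in> bounded_polys A e"
  proof -
    obtain e where "\<And>i. i < k \<Longrightarrow> y i \<in> bounded_polys A (e i)"
      using poly_carrier_bounded[OF y] by metis
    then have "\<forall>i<k. y i \<in> bounded_polys A (\<Sum>i<k. e i)"
      using bounded_polys_mono member_le_sum[of _ "{..<k}" e] by (metis finite_lessThan lessThan_iff subsetD zero_le)
    then show ?thesis ..
  qed
  then obtain e where e: "\<And>i. i < k \<Longrightarrow> y i \<in> bounded_polys A e" by blast
  \<comment> \<open>With this \<open>c\<close>, \<open>D * e * k + 1\<close> is at most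
    \<open>(D + 1) * c\<close>. Comparing dimensions then gives \<open>D + 1\<close> at most
    \<open>c ^ card A\<close>, and \<open>D\<close> is chosen to be exactly that power, a
    contradiction.\<close>
  define c where "c = e * k + 1"
  define D where "D = c ^ card A"
  let ?M = "bounded_monomials {..<k} D" and ?E = "D * e * k"
  let ?S = "mono_subst y ` ?M" and ?T = "monom ` bounded_monomials A ?E :: ('x, 'k) mpoly set"
  have M: "finite ?M" by (simp add: finite_bounded_monomials)
  have inj_M: "inj_on (mono_subst y) ?M"
  proof (rule inj_onI)
    fix \<mu> \<nu> assume \<mu>\<nu>: "\<mu> \<in> ?M" "\<nu> \<in> ?M" "mono_subst y \<mu> = mono_subst y \<nu>"
    then have "psubst y (monom \<mu> - monom \<nu>) = 0" by (simp add: psubst_diff psubst_single)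
    moreover have "monom \<mu> - monom \<nu> \<in> (poly_carrier {..<k} :: (nat, 'k) mpoly set)"
      using \<mu>\<nu> by (intro carrier_diff carrier_single) (auto simp: bounded_monomials_def)
    ultimately have "monom \<mu> - (monom \<nu> :: (nat, 'k) mpoly) = 0" by (intro inj)
    then have "lookup (monom \<mu> :: (nat, 'k) mpoly) \<mu> = lookup (monom \<nu> :: (nat, 'k) mpoly) \<mu>" by simp
    then show "\<mu> = \<nu>" by (simp add: lookup_single when_def split: if_splits)
  qed
  have "vs.independent ?S"
  proof (rule vs.independent_if_scalars_zero)
    show "finite ?S" using M by simp
    fix f p assume f: "(\<Sum>p\<in>?S. const (f p) * p) = 0" and p: "p \<in> ?S"
    let ?F = "\<Sum>\<mu>\<in>?M. msingle \<mu> (f (mono_subst y \<mu>)) :: (nat, 'k) mpoly"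
    have "psubst y ?F = (\<Sum>\<mu>\<in>?M. const (f (mono_subst y \<mu>)) * mono_subst y \<mu>)"
      by (simp add: psubst_sum psubst_single)
    also have "\<dots> = 0" using f by (simp add: sum.reindex[OF inj_M])
    finally have "?F = 0"
      by (intro inj carrier_sum carrier_single) (auto simp: bounded_monomials_def)
    moreover obtain \<mu> where \<mu>: "\<mu> \<in> ?M" "p = mono_subst y \<mu>" using p by blast
    have "lookup ?F \<mu> = f p" using \<mu> M by (simp add: lookup_sum lookup_single when_def)
    ultimately show "f p = 0" by simp
  qed
  moreover have "?S \<subseteq> vs.span ?T"
  proof
    fix p assume "p \<in> ?S"
    then obtain \<mu> where \<mu>: "\<mu> \<in> ?M" and p: "p = mono_subst y \<mu>" by blast
    have "p = (\<Prod>i<k. y i ^ lookup \<mu> i)"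
      using \<mu> unfolding p by (intro mono_subst_superset) (auto simp: bounded_monomials_def)
    also have "\<dots> \<in> bounded_polys A (\<Sum>i<k. lookup \<mu> i * e)"
      using e by (intro bounded_polys_prod bounded_polys_power) auto
    finally have "p \<in> bounded_polys A (\<Sum>i<k. lookup \<mu> i * e)" .
    moreover have "(\<Sum>i<k. lookup \<mu> i * e) \<le> (\<Sum>i<k. D * e)"
      using \<mu> by (intro sum_mono mult_right_mono) (auto simp: bounded_monomials_def)
    ultimately have "p \<in> bounded_polys A ?E"
      using bounded_polys_mono by (fastforce simp: ac_simps)
    then have "keys p \<subseteq> bounded_monomials A ?E" by (simp add: bounded_polys_def)
    then have "(\<Sum>\<nu>\<in>keys p. const (lookup p \<nu>) * monom \<nu>) \<in> vs.span ?T"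
      by (intro vs.span_sum vs.span_scale vs.span_base) auto
    moreover have "(\<Sum>\<nu>\<in>keys p. const (lookup p \<nu>) * monom \<nu>) = p"
      using poly_eq_sum[of p] by (simp add: mult_single)
    ultimately show "p \<in> vs.span ?T" by simp
  qed
  ultimately have "card ?S \<le> card ?T"
    using vs.independent_span_bound[of ?T ?S] finite_bounded_monomials[OF A] by blast
  also have "\<dots> \<le> Suc ?E ^ card A"
    using card_image_le[OF finite_bounded_monomials[OF A]] card_bounded_monomials[OF A] by metis
  also have "\<dots> \<le> (Suc D * c) ^ card A"
    by (intro power_mono) (auto simp: c_def algebra_simps)
  finally have *: "Suc D ^ k \<le> Suc D ^ card A * c ^ card A"
    using card_image[OF inj_M] card_bounded_monomials[of "{..<k}" D]
    by (simp del: mult_Suc add: power_mult_distrib)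
  have "Suc D ^ card A * Suc D \<le> Suc D ^ k"
    using less power_increasing[of "Suc (card A)" k "Suc D"] by (simp add: mult.commute)
  with * have "Suc D ^ card A * Suc D \<le> Suc D ^ card A * D" unfolding D_def by (rule order_trans[rotated])
  then show False by (simp only: mult_le_cancel1) simp
qed

section \<open>Bounds on heights of primes\<close>

definition alg_independent_mod ::
  "('x, 'k::field) mpoly set \<Rightarrow> nat \<Rightarrow> (nat \<Rightarrow> ('x, 'k) mpoly) \<Rightarrow> bool" where
  "alg_independent_mod Q k y \<longleftrightarrow> (\<forall>F\<in>poly_carrier {..<k}. psubst y F \<in> Q \<longrightarrow> F = 0)"

text \<open>Collect the monomials free of the variable \<open>k\<close> and divide the others by it.
  The degree in \<open>k\<close> drops, which drives the induction in
  \<open>alg_independent_mod_extend\<close>.\<close>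

lemma split_variable:
  fixes F :: "('v, 'k::field) mpoly"
  assumes "F \<in> poly_carrier (insert k B)" "k \<notin> B" "\<And>\<mu>. \<mu> \<in> keys F \<Longrightarrow> lookup \<mu> k < Suc n"
  obtains F\<^sub>0 F\<^sub>1 where "F = F\<^sub>0 + pvar k * F\<^sub>1" "F\<^sub>0 \<in> poly_carrier B" "F\<^sub>1 \<in> poly_carrier (insert k B)"
    "\<And>\<mu>. \<mu> \<in> keys F\<^sub>1 \<Longrightarrow> lookup \<mu> k < n"
proof
  let ?Z = "{\<mu> \<in> keys F. lookup \<mu> k = 0}" and ?P = "{\<mu> \<in> keys F. lookup \<mu> k \<noteq> 0}"
  let ?s = "msingle k (1::nat)"
  let ?F0 = "\<Sum>\<mu>\<in>?Z. msingle \<mu> (lookup F \<mu>)" and ?F1 = "\<Sum>\<mu>\<in>?P. msingle (\<mu> - ?s) (lookup F \<mu>)"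
  have split: "msingle k (Suc 0) + (\<mu> - msingle k (Suc 0)) = \<mu>" if "\<mu> \<in> ?P" for \<mu>
    using that by (intro poly_mapping_eqI) (auto simp: lookup_add lookup_minus lookup_single when_def)
  have "pvar k * ?F1 = (\<Sum>\<mu>\<in>?P. msingle \<mu> (lookup F \<mu>))"
    unfolding sum_distrib_left by (intro sum.cong refl) (simp add: pvar_def mult_single split[simplified])
  then have "?F0 + pvar k * ?F1 = (\<Sum>\<mu>\<in>?Z \<union> ?P. msingle \<mu> (lookup F \<mu>))"
    by (subst sum.union_disjoint) auto
  also have "?Z \<union> ?P = keys F" by auto
  finally show "F = ?F0 + pvar k * ?F1" using poly_eq_sum[of F] by simp
  show "?F0 \<in> poly_carrier B"
  proof (intro carrier_sum carrier_single)
    fix \<mu> assume "\<mu> \<in> ?Z"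
    then have "keys \<mu> \<subseteq> insert k B" "k \<notin> keys \<mu>"
      using assms(1) by (auto simp: poly_carrier_def in_keys_iff)
    then show "keys \<mu> \<subseteq> B" by blast
  qed
  have "keys (\<mu> - ?s) \<subseteq> keys \<mu>" for \<mu>
    by (auto simp: in_keys_iff lookup_minus)
  then show "?F1 \<in> poly_carrier (insert k B)"
    using assms(1) by (intro carrier_sum carrier_single) (fastforce simp: poly_carrier_def)
  fix \<mu> assume "\<mu> \<in> keys ?F1"
  then obtain \<nu> where "\<nu> \<in> ?P" "\<mu> \<in> keys (msingle (\<nu> - ?s) (lookup F \<nu>))"
    using keys_sum[of "\<lambda>\<mu>. msingle (\<mu> - ?s) (lookup F \<mu>)" ?P] by blast
  then have "\<nu> \<in> ?P" "\<mu> = \<nu> - ?s" by (auto split: if_splits)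
  then show "lookup \<mu> k < n" using assms(3)[of \<nu>] by (auto simp: lookup_minus)
qed

text \<open>Passing to a strictly smaller prime gains one independent element, namely any
  \<open>f\<close> in the difference. Write a relation as \<open>F0 + x_k * F1\<close>. Modulo
  \<open>Q'\<close> the element \<open>f\<close> vanishes, so \<open>F0\<close> is a relation of the
  old elements and is zero; then \<open>f\<close> can be cancelled modulo the prime
  \<open>Q\<close>, leaving a relation of smaller degree in \<open>f\<close>.\<close>

lemma alg_independent_mod_extend:
  fixes Q :: "('x, 'k::field) mpoly set"
  assumes Q: "primeideal Q (poly_ring A :: ('x, 'k) mpoly ring)"
    and Q': "ideal Q' (poly_ring A :: ('x, 'k) mpoly ring)"
    and sub: "Q \<subseteq> Q'" and f: "f \<in> Q'" "f \<notin> Q"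
    and ind: "alg_independent_mod Q' k y" and y: "\<And>i. i < k \<Longrightarrow> y i \<in> poly_carrier A"
  shows "alg_independent_mod Q (Suc k) (y(k := f))"
proof -
  let ?y = "y(k := f)"
  have y': "?y i \<in> poly_carrier A" if "i < Suc k" for i
    using that y ideal_subset[OF Q' f(1)] by (auto simp: less_Suc_eq)
  have carr: "psubst ?y F \<in> poly_carrier A" if "F \<in> poly_carrier {..<Suc k}" for F
    using y' by (intro carrier_psubst[OF that]) auto
  have "F = 0" if "F \<in> poly_carrier {..<Suc k}" "psubst ?y F \<in> Q" "\<forall>\<mu>\<in>keys F. lookup \<mu> k < n" for F n
    using that
  proof (induction n arbitrary: F)
    case 0
    then have "keys F = {}" by auto
    then show ?case by simp
  next
    case (Suc n)
    obtain F0 F1 where F: "F = F0 + pvar k * F1" and F0: "F0 \<in> poly_carrier {..<k}"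
      and F1: "F1 \<in> poly_carrier (insert k {..<k})" "\<And>\<mu>. \<mu> \<in> keys F1 \<Longrightarrow> lookup \<mu> k < n"
      by (rule split_variable[of F k "{..<k}" n]) (use Suc.prems in \<open>auto simp: lessThan_Suc\<close>)
    have F1': "F1 \<in> poly_carrier {..<Suc k}" using F1(1) by (simp add: lessThan_Suc)
    have eq: "psubst ?y F = psubst ?y F0 + f * psubst ?y F1"
      by (simp add: F psubst_add psubst_mult)
    have "psubst y F0 = psubst ?y F0"
      using F0 by (intro psubst_cong) (auto simp: poly_carrier_def)
    also have "\<dots> = psubst ?y F - psubst ?y F1 * f" by (simp add: eq mult.commute)
    also have "\<dots> \<in> Q'"
      using Suc.prems(2) sub by (intro ideal_diff[OF Q'] ideal_mult[OF Q'] f(1) carr F1') (rule subsetD)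
    finally have 0: "F0 = 0" using ind F0 by (auto simp: alg_independent_mod_def)
    then have "f * psubst ?y F1 \<in> Q" using Suc.prems(2) by (simp only: eq psubst_0 add_0)
    then have "psubst ?y F1 \<in> Q"
      using Q f ideal_subset[OF Q' f(1)] carr[OF F1'] by (auto simp: primeideal_poly_iff)
    then have "F1 = 0" using Suc.IH[of F1] F1' F1(2) by blast
    with 0 F show ?case by simp
  qed
  moreover have "\<exists>n. \<forall>\<mu>\<in>keys F. lookup \<mu> k < n" for F :: "(nat, 'k) mpoly"
    using finite_nat_set_iff_bounded[of "(\<lambda>\<mu>. lookup \<mu> k) ` keys F"] by auto
  ultimately show ?thesis unfolding alg_independent_mod_def by blast
qed

text \<open>Going down a chain of length \<open>n\<close> that ends in \<open>P\<close> extends the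
  \<open>d\<close> given elements to \<open>d + n\<close> independent ones, and there are at most
  \<open>card A\<close> of those.\<close>

lemma prime_height_le:
  fixes P :: "('x, 'k::field) mpoly set"
  assumes A: "finite A" and ind: "alg_independent_mod P d y" and y: "\<And>i. i < d \<Longrightarrow> y i \<in> poly_carrier A"
  shows "prime_height (poly_ring A) P \<le> enat (card A - d)"
  unfolding prime_height_def
proof (rule Sup_least, clarify)
  fix n Q
  assume Q: "\<forall>i\<le>n. primeideal (Q i) (poly_ring A :: ('x, 'k) mpoly ring)"
    "\<forall>i<n. Q i \<subset> Q (Suc i)" and P: "P = Q n"
  have "\<exists>y. alg_independent_mod (Q (n - i)) (d + i) y \<and> (\<forall>j<d + i. y j \<in> poly_carrier A)" if "i \<le> n" for i
    using that
  proof (induction i)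
    case 0
    then show ?case using ind y P by auto
  next
    case (Suc i)
    then obtain y where y: "alg_independent_mod (Q (n - i)) (d + i) y" "\<forall>j<d + i. y j \<in> poly_carrier A"
      by auto
    have "n - i = Suc (n - Suc i)" using Suc.prems by simp
    then have lt: "Q (n - Suc i) \<subset> Q (n - i)" using Q(2) Suc.prems by simp
    then obtain f where f: "f \<in> Q (n - i)" "f \<notin> Q (n - Suc i)" by blast
    have id: "ideal (Q (n - i)) (poly_ring A :: ('x, 'k) mpoly ring)"
      using Q(1) by (simp add: primeideal_poly_iff)
    have "alg_independent_mod (Q (n - Suc i)) (Suc (d + i)) (y(d + i := f))"
      by (rule alg_independent_mod_extend[OF _ id]) (use Q y lt f in auto)
    moreover have "\<forall>j<Suc (d + i). (y(d + i := f)) j \<in> poly_carrier A"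
      using y(2) ideal_subset[OF id f(1)] by (auto simp: less_Suc_eq)
    ultimately show ?case by auto
  qed
  from this[of n] obtain y where y: "alg_independent_mod (Q 0) (d + n) y" "\<forall>j<d + n. y j \<in> poly_carrier A"
    by auto
  have "0 \<in> Q 0"
    using Q(1) ideal_0[of "Q 0" A] by (auto simp: primeideal_poly_iff)
  then have "d + n \<le> card A"
    using y by (intro alg_independent_le_card[OF A, of _ y]) (auto simp: alg_independent_mod_def)
  then show "enat n \<le> enat (card A - d)" by simp
qed

lemma prime_height_ge:
  assumes "\<And>i. i \<le> n \<Longrightarrow> primeideal (Q i) R" "\<And>i. i < n \<Longrightarrow> Q i \<subset> Q (Suc i)"
  shows "enat n \<le> prime_height R (Q n)"
  unfolding prime_height_def by (rule Sup_upper) (use assms in blast)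

text \<open>
  Replacing the values of \<open>\<sigma>\<close> on \<open>D\<close> by fresh variables, and reinstating them one at a time, gives a
  chain of primes of length \<open>card D\<close> below the kernel of \<open>\<sigma>\<close>.
\<close>

lemma prime_height_subst_ker_ge:
  fixes \<sigma> :: "'x \<Rightarrow> ('y::linorder, 'k::field) mpoly"
  assumes D: "finite D" "D \<subseteq> A" and \<sigma>: "\<And>a. a \<in> A \<Longrightarrow> \<sigma> a \<in> poly_carrier Y"
    and z: "inj_on z D" "z ` D \<inter> Y = {}"
    and rel: "\<And>a. a \<in> D \<Longrightarrow> \<exists>g\<in>poly_carrier (insert a (A - D)).
      psubst \<sigma> g = 0 \<and> psubst (\<sigma>(a := pvar (z a))) g \<noteq> 0"
  shows "enat (card D) \<le> prime_height (poly_ring A) (subst_ker A \<sigma>)"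
proof -
  define \<rho> where "\<rho> E a = (if a \<in> E then pvar (z a) else \<sigma> a)" for E a
  obtain as where as: "set as = D" "distinct as" using finite_distinct_list[OF D(1)] by blast
  have anti: "subst_ker A (\<rho> E') \<subseteq> subst_ker A (\<rho> E)" if "E \<subseteq> E'" "E' \<subseteq> D" for E E'
  proof -
    \<comment> \<open>\<open>\<tau>\<close> puts the original values back for the fresh variables
      belonging to \<open>E' - E\<close>. It fixes all other values because the fresh variables lie
      outside \<open>Y\<close>.\<close>
    define \<tau> where "\<tau> v = (if v \<in> z ` (E' - E) then \<sigma> (the_inv_into D z v) else pvar v)" for v
    have "psubst \<tau> (\<rho> E' a) = \<rho> E a" if a: "a \<in> A" for a
    proof (cases "a \<in> E'")
      case True
      then have aD: "a \<in> D" using \<open>E' \<subseteq> D\<close> by blast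
      have "z a \<in> z ` (E' - E) \<longleftrightarrow> a \<in> E' - E"
        using inj_on_image_mem_iff[OF z(1) aD, of "E' - E"] \<open>E' \<subseteq> D\<close> by blast
      then show ?thesis
        using True aD the_inv_into_f_f[OF z(1)] by (simp add: \<rho>_def \<tau>_def)
    next
      case False
      have "psubst \<tau> (\<sigma> a) = psubst pvar (\<sigma> a)"
      proof (rule psubst_cong)
        fix \<mu> v assume "\<mu> \<in> keys (\<sigma> a)" "v \<in> keys \<mu>"
        then have "v \<in> Y" using \<sigma>[OF a] by (auto simp: poly_carrier_def)
        then show "\<tau> v = pvar v" using z(2) \<open>E' \<subseteq> D\<close> by (auto simp: \<tau>_def)
      qed
      also have "\<dots> = \<sigma> a"
        by (rule psubst_id)
      finally show ?thesis using False that \<open>E \<subseteq> E'\<close> by (auto simp: \<rho>_def)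
    qed
    then have "psubst \<tau> (psubst (\<rho> E') p) = psubst (\<rho> E) p" if "p \<in> poly_carrier A" for p
      unfolding psubst_psubst using that by (intro psubst_cong) (auto simp: poly_carrier_def)
    then show ?thesis by (auto simp: subst_ker_def) (metis psubst_0)
  qed
  \<comment> \<open>The relation \<open>g\<close> for \<open>a\<close> involves no element of
    \<open>D\<close> other than \<open>a\<close>. Its image therefore depends on \<open>E\<close>
    only through whether \<open>a\<close> belongs to it, and \<open>g\<close> separates the two
    kernels.\<close>
  have strict: "subst_ker A (\<rho> (insert a E)) \<subset> subst_ker A (\<rho> E)" if aE: "insert a E \<subseteq> D" "a \<notin> E" for a E
  proof -
    obtain g where g: "g \<in> poly_carrier (insert a (A - D))" "psubst \<sigma> g = 0"
      "psubst (\<sigma>(a := pvar (z a))) g \<noteq> 0" using rel aE by blast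
    have gA: "g \<in> poly_carrier A" using g(1) poly_carrier_mono[of "insert a (A - D)" A] aE D by blast
    have "psubst (\<rho> E) g = psubst \<sigma> g"
      using g(1) aE by (intro psubst_cong) (auto simp: poly_carrier_def \<rho>_def)
    moreover have "psubst (\<rho> (insert a E)) g = psubst (\<sigma>(a := pvar (z a))) g"
      using g(1) aE by (intro psubst_cong) (auto simp: poly_carrier_def \<rho>_def)
    ultimately have "g \<in> subst_ker A (\<rho> E)" "g \<notin> subst_ker A (\<rho> (insert a E))"
      using g gA by (auto simp: subst_ker_def)
    then show ?thesis using anti[of E "insert a E"] aE by blast
  qed
  let ?Q = "\<lambda>i. subst_ker A (\<rho> (set (drop i as)))"
  have "enat (length as) \<le> prime_height (poly_ring A) (?Q (length as))"
  proof (rule prime_height_ge)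
    fix i assume i: "i < length as"
    have "distinct (drop i as)" using as by simp
    then have "as ! i \<notin> set (drop (Suc i) as)" using i by (metis Cons_nth_drop_Suc distinct.simps(2))
    moreover have "insert (as ! i) (set (drop (Suc i) as)) \<subseteq> D"
      using i as by (auto dest: in_set_dropD)
    ultimately show "?Q i \<subset> ?Q (Suc i)"
      using strict i by (metis Cons_nth_drop_Suc list.simps(15))
  qed (rule primeideal_subst_ker)
  moreover have "length as = card D" using as distinct_card by fastforce
  moreover have "\<rho> {} = \<sigma>" by (auto simp: \<rho>_def)
  ultimately show ?thesis by simp
qed

section \<open>Kernels of the block parametrizations\<close>

text \<open>Modulo \<open>I\<close> all monomials of a class agree, so a class contributes its
  coefficient sum times any one of its monomials. This contribution is in \<open>I\<close> as soon
  as the sum vanishes or the monomial itself is in \<open>I\<close>.\<close>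

lemma coefficient_class_sums_imp_mem:
  fixes p :: "('x, 'k::field) mpoly"
  assumes I: "ideal I (poly_ring A :: ('x, 'k) mpoly ring)"
    and diff: "\<And>\<mu> \<nu>. \<mu> \<in> keys p \<Longrightarrow> \<nu> \<in> keys p \<Longrightarrow> \<kappa> \<mu> = \<kappa> \<nu> \<Longrightarrow> monom \<mu> - monom \<nu> \<in> I"
    and sum: "\<And>\<mu>. \<mu> \<in> keys p \<Longrightarrow> monom \<mu> \<in> I \<or> (\<Sum>\<nu> | \<nu> \<in> keys p \<and> \<kappa> \<nu> = \<kappa> \<mu>. lookup p \<nu>) = 0"
  shows "p \<in> I"
proof -
  have scale: "const c * q \<in> I" if "q \<in> I" for c q
    using that by (intro ideal_mult[OF I]) auto
  have "(\<Sum>\<nu> | \<nu> \<in> keys p \<and> \<kappa> \<nu> = k. msingle \<nu> (lookup p \<nu>)) \<in> I" if "k \<in> \<kappa> ` keys p" for k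
  proof -
    from that obtain \<mu> where \<mu>: "\<mu> \<in> keys p" "k = \<kappa> \<mu>" by blast
    let ?C = "{\<nu> \<in> keys p. \<kappa> \<nu> = k}"
    have "const (\<Sum>\<nu>\<in>?C. lookup p \<nu>) * monom \<mu> \<in> I"
      using sum[OF \<mu>(1)] scale \<mu>(2) ideal_0[OF I] by auto
    moreover have "(\<Sum>\<nu>\<in>?C. const (lookup p \<nu>) * (monom \<nu> - monom \<mu>)) \<in> I"
      using \<mu> by (intro ideal_sum[OF I] scale diff) auto
    moreover have "const (\<Sum>\<nu>\<in>?C. lookup p \<nu>) = (\<Sum>\<nu>\<in>?C. const (lookup p \<nu>) :: ('x, 'k) mpoly)"
    proof -
      have "const (\<Sum>\<nu>\<in>S. lookup p \<nu>) = (\<Sum>\<nu>\<in>S. const (lookup p \<nu>) :: ('x, 'k) mpoly)" for S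
        by (induction S rule: infinite_finite_induct) (auto simp: single_add)
      then show ?thesis .
    qed
    then have "(\<Sum>\<nu>\<in>?C. msingle \<nu> (lookup p \<nu>)) =
        (\<Sum>\<nu>\<in>?C. const (lookup p \<nu>) * (monom \<nu> - monom \<mu>)) + const (\<Sum>\<nu>\<in>?C. lookup p \<nu>) * monom \<mu>"
      by (simp add: sum_distrib_right sum.distrib[symmetric] right_diff_distrib mult_single)
    ultimately show ?thesis using ideal_add[OF I] by simp
  qed
  then have "(\<Sum>k\<in>\<kappa> ` keys p. \<Sum>\<nu> | \<nu> \<in> keys p \<and> \<kappa> \<nu> = k. msingle \<nu> (lookup p \<nu>)) \<in> I"
    by (rule ideal_sum[OF I])
  then show ?thesis
    using sum.image_gen[of "keys p" "\<lambda>\<nu>. msingle \<nu> (lookup p \<nu>)" \<kappa>] poly_eq_sum[of p] by simp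
qed

lemma sum_eq_imp_ex_less:
  fixes f g :: "'i \<Rightarrow> nat"
  assumes "finite S" "sum f S = sum g S" "x \<in> S" "f x < g x"
  shows "\<exists>y\<in>S. g y < f y"
proof (rule ccontr)
  assume "\<not> ?thesis"
  then have "sum f S < sum g S" using assms by (intro sum_strict_mono_ex1) (auto simp: not_less)
  then show False using assms(2) by simp
qed

lemma ideal_sub_sub:
  assumes "ideal I (poly_ring A :: ('x, 'k::field) mpoly ring)" "p - q \<in> I" "q - r \<in> I"
  shows "p - r \<in> I"
  using ideal_add[OF assms] by simp

text \<open>The entries are named by an abstract \<open>X\<close> so that the same results apply to
  the matrix with entries \<open>(i, j)\<close> and to its transpose. The first reading yields
  primes from cut sets of the second graph, the second reading primes from cut sets of the
  first.\<close>

locale variable_matrix =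
  fixes X :: "'r::linorder \<Rightarrow> 'c::linorder \<Rightarrow> 'x" and row :: "'x \<Rightarrow> 'r" and col :: "'x \<Rightarrow> 'c"
    and R :: "'r set" and C :: "'c set"
  assumes row [simp]: "row (X i j) = i" and col [simp]: "col (X i j) = j"
    and finite_R: "finite R" and finite_C: "finite C"
begin

definition vars :: "'x set" where
  "vars = {X i j | i j. i \<in> R \<and> j \<in> C}"

definition minor :: "'r \<Rightarrow> 'r \<Rightarrow> 'c \<Rightarrow> 'c \<Rightarrow> ('x, 'k::field) mpoly" where
  "minor i i' j j' = pvar (X i j) * pvar (X i' j') - pvar (X i j') * pvar (X i' j)"

text \<open>
  The prime \<open>P\<^sub>T\<close> is the kernel of \<open>x\<^sub>i\<^sub>j \<mapsto> s\<^bsub>i,\<rho>(j)\<^esub> u\<^sub>j\<close> for \<open>j \<notin> T\<close> and \<open>x\<^sub>i\<^sub>j \<mapsto> 0\<close> for \<open>j \<in> T\<close>, where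
  \<open>\<rho>(j)\<close> represents the component of \<open>j\<close>.  The first entry of a target variable distinguishes the
  \<open>s\<close> (0), the \<open>u\<close> (1), and the fresh variables (2) of the height computation.
\<close>

definition param :: "'c set \<Rightarrow> ('c \<Rightarrow> 'c) \<Rightarrow> 'x \<Rightarrow> (nat \<times> 'r \<times> 'c, 'k::field) mpoly" where
  "param T \<rho> x = (if col x \<in> T then 0 else pvar (0, row x, \<rho> (col x)) * pvar (1, undefined, col x))"

definition block_prime :: "'c set \<Rightarrow> ('c \<Rightarrow> 'c) \<Rightarrow> ('x, 'k::field) mpoly set" where
  "block_prime T \<rho> = subst_ker vars (param T \<rho>)"

text \<open>The exponent vector of the image of a monomial under \<open>param\<close>, provided the
  monomial avoids the columns of \<open>T\<close>. Its coordinates are the row counts inside each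
  block and the column degrees.\<close>

definition weight :: "('c \<Rightarrow> 'c) \<Rightarrow> ('x \<Rightarrow>\<^sub>0 nat) \<Rightarrow> (nat \<times> 'r \<times> 'c \<Rightarrow>\<^sub>0 nat)" where
  "weight \<rho> \<mu> = (\<Sum>x\<in>keys \<mu>. msingle (0, row x, \<rho> (col x)) (lookup \<mu> x) + msingle (1, undefined, col x) (lookup \<mu> x))"

lemma X_eq_iff [simp]: "X i j = X i' j' \<longleftrightarrow> i = i' \<and> j = j'"
  using row col by metis

lemma vars_eq_image: "vars = (\<lambda>(i, j). X i j) ` (R \<times> C)"
  by (auto simp: vars_def)

lemma finite_vars [simp]: "finite vars"
  by (simp add: vars_eq_image finite_R finite_C)

lemma X_in_vars [simp]: "X i j \<in> vars \<longleftrightarrow> i \<in> R \<and> j \<in> C"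
  by (auto simp: vars_def)

lemma in_vars_iff: "x \<in> vars \<longleftrightarrow> x = X (row x) (col x) \<and> row x \<in> R \<and> col x \<in> C"
  by (auto simp: vars_def)

lemma col_keys: "keys \<mu> \<subseteq> vars \<Longrightarrow> col ` keys \<mu> \<subseteq> C"
  using in_vars_iff by blast

lemma minor_carrier: "i \<in> R \<Longrightarrow> i' \<in> R \<Longrightarrow> j \<in> C \<Longrightarrow> j' \<in> C \<Longrightarrow> minor i i' j j' \<in> poly_carrier vars"
  unfolding minor_def by (intro carrier_diff carrier_mult) simp_all

lemma primeideal_block_prime:
  "primeideal (block_prime T \<rho> :: ('x, 'k::field) mpoly set) (poly_ring vars :: ('x, 'k) mpoly ring)"
  unfolding block_prime_def by (rule primeideal_subst_ker)

lemma ideal_block_prime: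
  "ideal (block_prime T \<rho> :: ('x, 'k::field) mpoly set) (poly_ring vars :: ('x, 'k) mpoly ring)"
  by (rule primeideal.axioms(1)[OF primeideal_block_prime])

lemma pvar_in_block_prime:
  "(pvar (X i j) :: ('x, 'k::field) mpoly) \<in> block_prime T \<rho> \<longleftrightarrow> i \<in> R \<and> j \<in> C \<and> j \<in> T"
proof -
  have "param T \<rho> (X i j) \<noteq> (0 :: (nat \<times> 'r \<times> 'c, 'k) mpoly)" if "j \<notin> T"
  proof
    assume "param T \<rho> (X i j) = (0 :: (nat \<times> 'r \<times> 'c, 'k) mpoly)"
    then have "psubst (\<lambda>_. 1 :: ('x, 'k) mpoly) (param T \<rho> (X i j) :: (nat \<times> 'r \<times> 'c, 'k) mpoly) = 0" by simp
    then show False using that by (simp add: param_def psubst_mult)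
  qed
  then show ?thesis by (auto simp: block_prime_def subst_ker_def param_def)
qed

lemma minor_in_block_prime:
  assumes "i \<in> R" "i' \<in> R" "j \<in> C" "j' \<in> C" "j \<in> T \<or> j' \<in> T \<or> \<rho> j = \<rho> j'"
  shows "minor i i' j j' \<in> block_prime T \<rho>"
  using assms minor_carrier[OF assms(1-4)]
  by (auto simp: block_prime_def subst_ker_def param_def minor_def psubst_diff psubst_mult)

text \<open>Set the variable for row \<open>i\<close> and the block of \<open>j\<close> to 0 and all
  other target variables to 1. Only the first product of the minor contains that variable, so the
  minor becomes -1.\<close>

lemma minor_notin_block_prime:
  assumes "i \<noteq> i'" "j \<notin> T" "j' \<notin> T" "\<rho> j \<noteq> \<rho> j'"
  shows "(minor i i' j j' :: ('x, 'k::field) mpoly) \<notin> block_prime T \<rho>"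
proof
  assume "(minor i i' j j' :: ('x, 'k) mpoly) \<in> block_prime T \<rho>"
  then have "psubst (\<lambda>v. if v = (0, i, \<rho> j) then 0 else 1 :: ('x, 'k) mpoly)
      (psubst (param T \<rho>) (minor i i' j j' :: ('x, 'k) mpoly)) = 0"
    by (simp add: block_prime_def subst_ker_def)
  then show False using assms by (simp add: minor_def param_def psubst_diff psubst_mult)
qed

lemma weight_superset:
  assumes "finite B" "keys \<mu> \<subseteq> B"
  shows "weight \<rho> \<mu> = (\<Sum>x\<in>B. msingle (0, row x, \<rho> (col x)) (lookup \<mu> x) + msingle (1, undefined, col x) (lookup \<mu> x))"
  unfolding weight_def
  by (rule sum.mono_neutral_left) (use assms in \<open>auto simp: in_keys_iff\<close>)

lemma weight_add: "weight \<rho> (\<mu> + \<nu>) = weight \<rho> \<mu> + weight \<rho> \<nu>"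
proof -
  let ?B = "keys \<mu> \<union> keys \<nu>"
  have "keys (\<mu> + \<nu>) \<subseteq> ?B" by (rule Poly_Mapping.keys_add)
  then show ?thesis
    by (simp add: weight_superset[where B = ?B] lookup_add single_add sum.distrib ac_simps)
qed

lemma weight_X: "weight \<rho> (msingle (X i j) 1) = msingle (0, i, \<rho> j) 1 + msingle (1, undefined, j) 1"
  by (simp add: weight_def)

lemma lookup_weight:
  assumes "finite B" "keys \<mu> \<subseteq> B"
  shows lookup_weight_block: "lookup (weight \<rho> \<mu>) (0, i, r) = (\<Sum>x | x \<in> B \<and> row x = i \<and> \<rho> (col x) = r. lookup \<mu> x)"
    and lookup_weight_col: "lookup (weight \<rho> \<mu>) (1, undefined, j) = (\<Sum>x | x \<in> B \<and> col x = j. lookup \<mu> x)"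
  unfolding weight_superset[OF assms]
  using assms(1) by (auto simp: lookup_sum lookup_add lookup_single when_def sum.inter_filter[symmetric] intro!: sum.cong)

lemma col_keys_eq: "col ` keys \<mu> = {j. lookup (weight \<rho> \<mu>) (1, undefined, j) \<noteq> 0}"
  by (subst lookup_weight_col[of "keys \<mu>"]) (auto simp: in_keys_iff)

text \<open>The occupied columns are read off from the column degrees, which do not involve the
  block map, so the two block maps may differ. \<open>Inter_block_primes_subset\<close> relies on
  this, since there the block map varies with the monomial.\<close>

lemma weight_eq_imp_col_keys: "weight \<rho> \<mu> = weight \<rho>' \<nu> \<Longrightarrow> col ` keys \<mu> = col ` keys \<nu>"
  using col_keys_eq[of \<mu> \<rho>] col_keys_eq[of \<nu> \<rho>'] by simp

lemma mono_subst_param: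
  "mono_subst (param T \<rho>) \<mu> = (if col ` keys \<mu> \<inter> T = {} then monom (weight \<rho> \<mu>) else 0 :: (nat \<times> 'r \<times> 'c, 'k::field) mpoly)"
proof (cases "col ` keys \<mu> \<inter> T = {}")
  case True
  then have "mono_subst (param T \<rho>) \<mu> =
      (\<Prod>x\<in>keys \<mu>. (pvar (0, row x, \<rho> (col x)) * pvar (1, undefined, col x)) ^ lookup \<mu> x :: (nat \<times> 'r \<times> 'c, 'k) mpoly)"
    unfolding mono_subst_def by (intro prod.cong) (auto simp: param_def)
  then show ?thesis
    using True by (simp add: weight_def monom_sum monom_add power_mult_distrib pvar_power)
next
  case False
  then obtain x where x: "x \<in> keys \<mu>" "col x \<in> T" by blast
  then have "param T \<rho> x ^ lookup \<mu> x = (0 :: (nat \<times> 'r \<times> 'c, 'k) mpoly)"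
    by (auto simp: param_def in_keys_iff)
  then have "(\<Prod>x\<in>keys \<mu>. param T \<rho> x ^ lookup \<mu> x) = (0 :: (nat \<times> 'r \<times> 'c, 'k) mpoly)"
    using x(1) by (intro prod_zero) auto
  then show ?thesis using False by (simp add: mono_subst_def)
qed

text \<open>Monomials are sent to monomials or to 0, so this sum is the coefficient at
  \<open>g\<close> of the image of \<open>p\<close>.\<close>

lemma block_prime_coefficient_sum:
  assumes "p \<in> block_prime T \<rho>"
  shows "(\<Sum>\<nu> | \<nu> \<in> keys p \<and> col ` keys \<nu> \<inter> T = {} \<and> weight \<rho> \<nu> = g. lookup p \<nu>) = 0"
proof -
  have "0 = lookup (psubst (param T \<rho>) p) g"
    using assms by (simp add: block_prime_def subst_ker_def)
  also have "\<dots> = (\<Sum>\<nu>\<in>keys p. if col ` keys \<nu> \<inter> T = {} \<and> weight \<rho> \<nu> = g then lookup p \<nu> else 0)"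
    unfolding psubst_def mono_subst_param lookup_sum
    by (intro sum.cong refl) (auto simp: mult_single lookup_single when_def)
  also have "\<dots> = (\<Sum>\<nu> | \<nu> \<in> keys p \<and> col ` keys \<nu> \<inter> T = {} \<and> weight \<rho> \<nu> = g. lookup p \<nu>)"
    by (simp add: sum.inter_filter)
  finally show ?thesis by simp
qed

text \<open>
  Monomials with the same column degrees and the same row counts in each block are connected by
  swaps of two entries of a block.  Each swap brings the second monomial closer to the first.
\<close>

lemma monom_diff_in_ideal:
  fixes I :: "('x, 'k::field) mpoly set"
  assumes I: "ideal I (poly_ring vars :: ('x, 'k) mpoly ring)"
    and swap: "\<And>\<mu> i i' j j'. keys \<mu> \<subseteq> vars \<Longrightarrow> i \<in> R \<Longrightarrow> i' \<in> R \<Longrightarrow> j \<in> S \<Longrightarrow> j' \<in> S \<Longrightarrow> \<rho> j = \<rho> j' \<Longrightarrow>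
      col ` keys \<mu> \<union> {j, j'} = S \<Longrightarrow> monom \<mu> * minor i i' j j' \<in> I"
    and \<mu>: "keys \<mu> \<subseteq> vars" "col ` keys \<mu> = S" and \<nu>: "keys \<nu> \<subseteq> vars" and eq: "weight \<rho> \<mu> = weight \<rho> \<nu>"
  shows "monom \<mu> - monom \<nu> \<in> I"
  using \<nu> eq
\<comment> \<open>Truncated subtraction makes the measure count only the excess of
  \<open>\<mu>\<close> over \<open>\<nu>\<close>.\<close>
proof (induction "\<Sum>x\<in>vars. lookup \<mu> x - lookup \<nu> x" arbitrary: \<nu> rule: less_induct)
  case less
  show ?case
  proof (cases "\<mu> = \<nu>")
    case True
    then show ?thesis using ideal_0[OF I] by simp
  next
    case False
    have cols: "(\<Sum>x | x \<in> vars \<and> col x = j. lookup \<mu> x) = (\<Sum>x | x \<in> vars \<and> col x = j. lookup \<nu> x)" for j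
      unfolding lookup_weight_col[OF finite_vars \<mu>(1), of \<rho>, symmetric]
        lookup_weight_col[OF finite_vars less.prems(1), of \<rho>, symmetric] less.prems(2) ..
    have blocks: "(\<Sum>x | x \<in> vars \<and> row x = i \<and> \<rho> (col x) = r. lookup \<mu> x) =
        (\<Sum>x | x \<in> vars \<and> row x = i \<and> \<rho> (col x) = r. lookup \<nu> x)" for i r
      unfolding lookup_weight_block[OF finite_vars \<mu>(1), symmetric]
        lookup_weight_block[OF finite_vars less.prems(1), symmetric] less.prems(2) ..
    \<comment> \<open>If \<open>\<mu>\<close> is smaller than \<open>\<nu>\<close> at some entry,
      equal column degrees make it larger at another entry of the same column.\<close>
    have "\<exists>x\<in>vars. lookup \<nu> x < lookup \<mu> x"
    proof -
      obtain x where x: "lookup \<mu> x \<noteq> lookup \<nu> x" using False by (metis poly_mapping_eqI)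
      then have "x \<in> vars" using \<mu>(1) less.prems(1) by (metis in_keys_iff subsetD)
      moreover have "\<exists>y\<in>{y \<in> vars. col y = col x}. lookup \<nu> y < lookup \<mu> y" if "lookup \<mu> x < lookup \<nu> x"
        using that \<open>x \<in> vars\<close> cols by (intro sum_eq_imp_ex_less[of _ _ _ x]) auto
      ultimately show ?thesis using x by (cases "lookup \<mu> x < lookup \<nu> x") (auto intro: bexI[of _ x])
    qed
    then obtain i a where ia: "i \<in> R" "a \<in> C" "lookup \<nu> (X i a) < lookup \<mu> (X i a)"
      by (auto simp: vars_def)
    have "\<exists>y\<in>{y \<in> vars. col y = a}. lookup \<mu> y < lookup \<nu> y"
      using ia cols by (intro sum_eq_imp_ex_less[of _ _ _ "X i a"]) auto
    then obtain i' where i': "i' \<in> R" "lookup \<mu> (X i' a) < lookup \<nu> (X i' a)"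
      by (auto simp: vars_def)
    have "\<exists>y\<in>{y \<in> vars. row y = i \<and> \<rho> (col y) = \<rho> a}. lookup \<mu> y < lookup \<nu> y"
      using ia blocks by (intro sum_eq_imp_ex_less[of _ _ _ "X i a"]) auto
    then obtain b where b: "b \<in> C" "\<rho> b = \<rho> a" "lookup \<mu> (X i b) < lookup \<nu> (X i b)"
      by (auto simp: vars_def)
    have ne: "i \<noteq> i'" "a \<noteq> b" using ia i' b by auto
    define e where "e x = msingle x (1::nat)" for x :: 'x
    \<comment> \<open>\<open>\<nu>\<close> has too little at row \<open>i\<close>, column
      \<open>a\<close>, and too much at \<open>X i' a\<close> and at \<open>X i b\<close>. The swap
      trades the latter two for \<open>X i a\<close> and \<open>X i' b\<close>;
      \<open>\<eta>\<close> is the part that it leaves alone.\<close>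
    define \<eta> where "\<eta> = \<nu> - e (X i' a) - e (X i b)"
    define \<nu>' where "\<nu>' = \<eta> + e (X i a) + e (X i' b)"
    have \<nu>_eq: "\<nu> = \<eta> + e (X i' a) + e (X i b)"
      using i' b ne by (intro poly_mapping_eqI) (auto simp: \<eta>_def e_def lookup_add lookup_minus lookup_single when_def)
    have \<eta>: "keys \<eta> \<subseteq> vars"
      using less.prems(1) by (auto simp: \<eta>_def in_keys_iff lookup_minus subset_iff)
    have \<nu>': "keys \<nu>' \<subseteq> vars"
      using \<eta> ia i' b by (auto simp: \<nu>'_def e_def in_keys_iff lookup_add lookup_single when_def subset_iff split: if_splits)
    have "weight \<rho> \<nu>' = weight \<rho> \<nu>"
      unfolding \<nu>_eq \<nu>'_def e_def weight_add weight_X using b(2) by (simp add: ac_simps)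
    then have w: "weight \<rho> \<mu> = weight \<rho> \<nu>'" using less.prems(2) by simp
    have "(\<Sum>x\<in>vars. lookup \<mu> x - lookup \<nu>' x) < (\<Sum>x\<in>vars. lookup \<mu> x - lookup \<nu> x)"
    proof (rule sum_strict_mono_ex1)
      have lk: "lookup \<nu>' x = lookup \<eta> x + (if x = X i a then 1 else 0) + (if x = X i' b then 1 else 0)"
        "lookup \<nu> x = lookup \<eta> x + (if x = X i' a then 1 else 0) + (if x = X i b then 1 else 0)" for x
        by (auto simp: \<nu>'_def \<nu>_eq e_def lookup_add lookup_single when_def)
      show "\<forall>x\<in>vars. lookup \<mu> x - lookup \<nu>' x \<le> lookup \<mu> x - lookup \<nu> x"
        using i' b ne by (auto simp: lk)
      show "\<exists>x\<in>vars. lookup \<mu> x - lookup \<nu>' x < lookup \<mu> x - lookup \<nu> x"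
        using ia ne by (intro bexI[of _ "X i a"]) (auto simp: lk)
    qed simp
    then have "monom \<mu> - monom \<nu>' \<in> I" using less.hyps \<nu>' w by blast
    moreover have "monom \<nu>' - monom \<nu> \<in> I"
    proof -
      have S: "col ` keys \<nu> = S" using weight_eq_imp_col_keys[OF less.prems(2)] \<mu>(2) by simp
      have "X i' a \<in> keys \<nu>" "X i b \<in> keys \<nu>" using i' b by (auto simp: in_keys_iff)
      then have ab: "a \<in> S" "b \<in> S" using S by (metis col imageI)+
      have "keys \<nu> = keys \<eta> \<union> {X i' a, X i b}"
        by (auto simp: \<nu>_eq e_def in_keys_iff lookup_add lookup_single when_def split: if_splits)
      then have "col ` keys \<eta> \<union> {a, b} = S" using S by (auto simp: image_Un)
      then have "monom \<eta> * minor i i' a b \<in> I" using swap[OF \<eta> ia(1) i'(1) ab] b(2) by simp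
      moreover have "monom \<eta> * minor i i' a b = (monom \<nu>' - monom \<nu> :: ('x, 'k) mpoly)"
        by (simp add: \<nu>_eq \<nu>'_def e_def minor_def pvar_def monom_add algebra_simps)
      ultimately show ?thesis by simp
    qed
    ultimately show ?thesis by (rule ideal_sub_sub[OF I])
  qed
qed

text \<open>This says that the variables in the columns of \<open>T\<close> and the minors inside
  the blocks generate the prime. A monomial that meets \<open>T\<close> is a multiple of such a
  variable; the remaining ones are compared by swaps, and in each class of equal weight the
  coefficients sum to zero.\<close>

lemma block_prime_subset:
  fixes I :: "('x, 'k::field) mpoly set"
  assumes I: "ideal I (poly_ring vars :: ('x, 'k) mpoly ring)"
    and v: "\<And>i j. i \<in> R \<Longrightarrow> j \<in> C \<inter> T \<Longrightarrow> pvar (X i j) \<in> I"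
    and m: "\<And>i i' j j'. i \<in> R \<Longrightarrow> i' \<in> R \<Longrightarrow> j \<in> C - T \<Longrightarrow> j' \<in> C - T \<Longrightarrow> \<rho> j = \<rho> j' \<Longrightarrow> minor i i' j j' \<in> I"
  shows "block_prime T \<rho> \<subseteq> I"
proof
  fix p :: "('x, 'k) mpoly" assume p: "p \<in> block_prime T \<rho>"
  then have pk: "keys \<mu> \<subseteq> vars" if "\<mu> \<in> keys p" for \<mu>
    using that by (auto simp: block_prime_def subst_ker_def poly_carrier_def)
  have T: "monom \<mu> \<in> I" if \<mu>: "\<mu> \<in> keys p" "col ` keys \<mu> \<inter> T \<noteq> {}" for \<mu>
  proof -
    from \<mu>(2) obtain x where x: "x \<in> keys \<mu>" "col x \<in> T" by blast
    then have x': "x = X (row x) (col x)" "row x \<in> R" "col x \<in> C" using pk[OF \<mu>(1)] in_vars_iff by auto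
    let ?\<eta> = "\<mu> - msingle x 1"
    have "\<mu> = ?\<eta> + msingle x 1"
      using x(1) by (intro poly_mapping_eqI) (auto simp: lookup_add lookup_minus lookup_single when_def in_keys_iff)
    then have "monom \<mu> = monom ?\<eta> * (pvar x :: ('x, 'k) mpoly)" by (simp add: pvar_def mult_single)
    moreover have "keys ?\<eta> \<subseteq> vars" using pk[OF \<mu>(1)] by (auto simp: in_keys_iff lookup_minus subset_iff)
    then have "monom ?\<eta> * pvar (X (row x) (col x)) \<in> I"
      using x(2) x'(2,3) by (intro ideal_mult[OF I] carrier_single v) auto
    ultimately show ?thesis using x'(1) by simp
  qed
  \<comment> \<open>All monomials that meet \<open>T\<close> share the class \<open>None\<close>,
    which needs no condition on coefficients.\<close>
  let ?\<kappa> = "\<lambda>\<mu>. if col ` keys \<mu> \<inter> T = {} then Some (weight \<rho> \<mu>) else None"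
  show "p \<in> I"
  proof (rule coefficient_class_sums_imp_mem[OF I, where \<kappa> = ?\<kappa>])
    fix \<mu> \<nu> assume \<mu>\<nu>: "\<mu> \<in> keys p" "\<nu> \<in> keys p" "?\<kappa> \<mu> = ?\<kappa> \<nu>"
    show "monom \<mu> - monom \<nu> \<in> I"
    proof (cases "col ` keys \<mu> \<inter> T = {}")
      case True
      then have w: "weight \<rho> \<mu> = weight \<rho> \<nu>" using \<mu>\<nu> by (auto split: if_splits)
      have S: "col ` keys \<mu> \<subseteq> C - T" using True col_keys[OF pk[OF \<mu>\<nu>(1)]] by blast
      show ?thesis
      proof (rule monom_diff_in_ideal[OF I _ pk[OF \<mu>\<nu>(1)] refl pk[OF \<mu>\<nu>(2)] w])
        fix \<eta> :: "'x \<Rightarrow>\<^sub>0 nat" and i i' j j'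
        assume "keys \<eta> \<subseteq> vars" "i \<in> R" "i' \<in> R" "j \<in> col ` keys \<mu>" "j' \<in> col ` keys \<mu>" "\<rho> j = \<rho> j'"
        then show "monom \<eta> * minor i i' j j' \<in> I"
          using S by (intro ideal_mult[OF I] m carrier_single) auto
      qed
    next
      case False
      then have "col ` keys \<nu> \<inter> T \<noteq> {}" using \<mu>\<nu>(3) by (auto split: if_splits)
      then show ?thesis using T \<mu>\<nu> False by (intro ideal_diff[OF I]) auto
    qed
  next
    fix \<mu> assume \<mu>: "\<mu> \<in> keys p"
    show "monom \<mu> \<in> I \<or> (\<Sum>\<nu> | \<nu> \<in> keys p \<and> ?\<kappa> \<nu> = ?\<kappa> \<mu>. lookup p \<nu>) = 0"
    proof (cases "col ` keys \<mu> \<inter> T = {}")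
      case True
      then have "{\<nu>. \<nu> \<in> keys p \<and> ?\<kappa> \<nu> = ?\<kappa> \<mu>} =
          {\<nu>. \<nu> \<in> keys p \<and> col ` keys \<nu> \<inter> T = {} \<and> weight \<rho> \<nu> = weight \<rho> \<mu>}"
        by (auto split: if_splits)
      then show ?thesis using block_prime_coefficient_sum[OF p] by simp
    next
      case False
      then show ?thesis using T \<mu> by blast
    qed
  qed
qed

text \<open>Outside the columns of \<open>T\<close>, row \<open>i0\<close> and the representative
  columns form a set \<open>B\<close> that is independent modulo the prime; this bounds the height
  from above. Every entry of the complement \<open>D\<close> either lies in a column of
  \<open>T\<close> or completes a block minor whose other three entries are in \<open>B\<close>;
  these relations give the chain from below.\<close>

lemma block_prime_height:
  assumes T: "T \<subseteq> C" and R: "R \<noteq> {}"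
    and \<rho>: "\<And>j. j \<in> C - T \<Longrightarrow> \<rho> j \<in> C - T" "\<And>j. j \<in> C - T \<Longrightarrow> \<rho> (\<rho> j) = \<rho> j"
  shows "prime_height (poly_ring vars) (block_prime T \<rho> :: ('x, 'k::field) mpoly set) =
    enat (card T + (card R - 1) * (card C - card (\<rho> ` (C - T))))"
proof -
  obtain i0 where i0: "i0 \<in> R" using R by blast
  define D where "D = {x \<in> vars. col x \<in> T \<or> (row x \<noteq> i0 \<and> \<rho> (col x) \<noteq> col x)}"
  define B where "B = {x \<in> vars. col x \<notin> T \<and> (row x = i0 \<or> \<rho> (col x) = col x)}"
  have fin: "finite D" "finite B" by (simp_all add: D_def B_def)
  have BD: "B = vars - D" "B \<subseteq> vars" "D \<subseteq> vars" by (auto simp: D_def B_def)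
  have card_D: "card D = card T + (card R - 1) * (card C - card (\<rho> ` (C - T)))"
  proof -
    let ?N = "(C - T) - \<rho> ` (C - T)"
    have ran: "\<rho> ` (C - T) \<subseteq> C - T" using \<rho>(1) by blast
    have N: "j \<in> ?N \<longleftrightarrow> j \<in> C - T \<and> \<rho> j \<noteq> j" for j using \<rho> by (metis DiffE DiffI imageE imageI)
    have D_eq: "D = (\<lambda>(i, j). X i j) ` (R \<times> T \<union> (R - {i0}) \<times> ?N)"
    proof (rule subset_antisym; rule subsetI)
      fix x assume "x \<in> D"
      then obtain i j where x: "x = X i j" "i \<in> R" "j \<in> C" "j \<in> T \<or> (i \<noteq> i0 \<and> \<rho> j \<noteq> j)"
        by (auto simp: D_def vars_def)
      then have "(i, j) \<in> R \<times> T \<union> (R - {i0}) \<times> ?N" using N[of j] by blast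
      then show "x \<in> (\<lambda>(i, j). X i j) ` (R \<times> T \<union> (R - {i0}) \<times> ?N)" using x(1) by force
    next
      fix x assume "x \<in> (\<lambda>(i, j). X i j) ` (R \<times> T \<union> (R - {i0}) \<times> ?N)"
      then obtain i j where x: "x = X i j" "(i, j) \<in> R \<times> T \<union> (R - {i0}) \<times> ?N" by auto
      then show "x \<in> D" using N[of j] T by (auto simp: D_def)
    qed
    have "inj_on (\<lambda>(i, j). X i j) S" for S by (auto simp: inj_on_def)
    then have "card D = card (R \<times> T \<union> (R - {i0}) \<times> ?N)" unfolding D_eq by (rule card_image)
    also have "\<dots> = card (R \<times> T) + card ((R - {i0}) \<times> ?N)"
      using finite_R finite_C finite_subset[OF T finite_C] by (intro card_Un_disjoint) auto
    also have "\<dots> = card R * card T + (card R - 1) * card ?N"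
      using i0 finite_R by (simp add: card_cartesian_product)
    also have "card ?N = card C - card T - card (\<rho> ` (C - T))"
      using ran T finite_C by (simp add: card_Diff_subset finite_subset card_mono)
    finally have 1: "card D = card R * card T + (card R - 1) * (card C - card T - card (\<rho> ` (C - T)))" .
    have "card (\<rho> ` (C - T)) \<le> card (C - T)" using finite_C by (intro card_image_le) auto
    then have "card (\<rho> ` (C - T)) + card T \<le> card C"
      using T finite_C card_mono[OF finite_C T] by (simp add: card_Diff_subset finite_subset)
    \<comment> \<open>Writing both cardinalities as sums removes the truncated subtractions before
      the two formulas are compared.\<close>
    then obtain k where k: "card C = card (\<rho> ` (C - T)) + card T + k" using le_Suc_ex by blast
    have "card R = Suc (card R - 1)" using R finite_R by (simp add: card_gt_0_iff)
    then obtain m where m: "card R = Suc m" by blast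
    show ?thesis unfolding 1 unfolding k m by (simp add: algebra_simps)
  qed
  have "prime_height (poly_ring vars) (block_prime T \<rho> :: ('x, 'k) mpoly set) \<le> enat (card vars - card B)"
  proof -
    obtain h where h: "bij_betw h {..<card B} B" using ex_bij_betw_nat_finite[OF fin(2)] by (auto simp: atLeast0LessThan)
    define h' where "h' = the_inv_into {..<card B} h"
    have h': "h' (h i) = i" if "i < card B" for i
      using that h the_inv_into_f_f[of h "{..<card B}" i] by (auto simp: h'_def bij_betw_def)
    have hB: "h i \<in> B" if "i < card B" for i using that h by (auto simp: bij_betw_def)
    \<comment> \<open>Off row \<open>i0\<close> an entry of \<open>B\<close> is alone in its row and
      block, so its exponent is a row count. The exponents in row \<open>i0\<close> then follow from
      the column degrees.\<close>
    have inj: "\<mu> = \<nu>" if \<mu>: "keys \<mu> \<subseteq> B" and \<nu>: "keys \<nu> \<subseteq> B" and w: "weight \<rho> \<mu> = weight \<rho> \<nu>" for \<mu> \<nu>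
    proof -
      have cols: "(\<Sum>x | x \<in> B \<and> col x = j. lookup \<mu> x) = (\<Sum>x | x \<in> B \<and> col x = j. lookup \<nu> x)" for j
        unfolding lookup_weight_col[OF fin(2) \<mu>, of \<rho>, symmetric]
          lookup_weight_col[OF fin(2) \<nu>, of \<rho>, symmetric] w ..
      have blocks: "(\<Sum>x | x \<in> B \<and> row x = i \<and> \<rho> (col x) = r. lookup \<mu> x) =
          (\<Sum>x | x \<in> B \<and> row x = i \<and> \<rho> (col x) = r. lookup \<nu> x)" for i r
        unfolding lookup_weight_block[OF fin(2) \<mu>, symmetric]
          lookup_weight_block[OF fin(2) \<nu>, symmetric] w ..
      have 1: "lookup \<mu> x = lookup \<nu> x" if "x \<in> B" "row x \<noteq> i0" for x
      proof -
        have "{y. y \<in> B \<and> row y = row x \<and> \<rho> (col y) = col x} = {x}"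
          using that by (auto simp: B_def in_vars_iff)
        then show ?thesis using blocks[of "row x" "col x"] by simp
      qed
      have "lookup \<mu> x = lookup \<nu> x" if x: "x \<in> B" "row x = i0" for x
      proof -
        let ?S = "{y. y \<in> B \<and> col y = col x}"
        have S: "finite ?S" "x \<in> ?S" using x fin by auto
        have "row y \<noteq> i0" if "y \<in> ?S - {x}" for y
          using that x by (auto simp: B_def in_vars_iff)
        then have "(\<Sum>y\<in>?S - {x}. lookup \<mu> y) = (\<Sum>y\<in>?S - {x}. lookup \<nu> y)"
          using 1 by (intro sum.cong) auto
        then show ?thesis
          using cols[of "col x"] sum.remove[OF S, of "lookup \<mu>"] sum.remove[OF S, of "lookup \<nu>"] by simp
      qed
      with 1 have "lookup \<mu> x = lookup \<nu> x" if "x \<in> B" for x using that by blast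
      moreover have "lookup \<mu> x = lookup \<nu> x" if "x \<notin> B" for x using that \<mu> \<nu> by (metis in_keys_iff subsetD)
      ultimately show ?thesis by (intro poly_mapping_eqI) blast
    qed
    have ker: "p = 0" if p: "p \<in> poly_carrier B" "p \<in> block_prime T \<rho>" for p :: "('x, 'k) mpoly"
    proof (rule poly_mapping_eqI)
      fix \<mu>
      have "lookup p \<mu> = 0" if \<mu>: "\<mu> \<in> keys p"
      proof -
        have kB: "keys \<nu> \<subseteq> B" if "\<nu> \<in> keys p" for \<nu> using p(1) that by (auto simp: poly_carrier_def)
        then have "{\<nu>. \<nu> \<in> keys p \<and> col ` keys \<nu> \<inter> T = {} \<and> weight \<rho> \<nu> = weight \<rho> \<mu>} = {\<mu>}"
          using \<mu> inj by (auto simp: B_def)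
        then show ?thesis using block_prime_coefficient_sum[OF p(2), of "weight \<rho> \<mu>"] by simp
      qed
      then show "lookup p \<mu> = lookup 0 \<mu>" by (cases "\<mu> \<in> keys p") (auto simp: in_keys_iff)
    qed
    show ?thesis
    proof (rule prime_height_le[where y = "\<lambda>i. pvar (h i)"])
      show "alg_independent_mod (block_prime T \<rho> :: ('x, 'k) mpoly set) (card B) (\<lambda>i. pvar (h i))"
        unfolding alg_independent_mod_def
      proof (intro ballI impI)
        fix F :: "(nat, 'k) mpoly"
        assume F: "F \<in> poly_carrier {..<card B}" "psubst (\<lambda>i. pvar (h i)) F \<in> (block_prime T \<rho> :: ('x, 'k) mpoly set)"
        have "(psubst (\<lambda>i. pvar (h i)) F :: ('x, 'k) mpoly) = 0"
          by (rule ker[OF carrier_psubst[OF F(1)] F(2)]) (simp add: hB)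
        then have "0 = psubst (\<lambda>x. pvar (h' x)) (psubst (\<lambda>i. pvar (h i)) F :: ('x, 'k) mpoly)" by simp
        also have "\<dots> = psubst pvar F"
          unfolding psubst_psubst using F(1) h' by (intro psubst_cong) (auto simp: poly_carrier_def subset_iff)
        finally show "F = 0" by (simp add: psubst_id)
      qed
    qed (use hB BD in auto)
  qed
  also have "card vars - card B = card D"
    using BD(1,3) fin card_mono[OF finite_vars BD(3)] by (simp add: card_Diff_subset)
  finally have le: "prime_height (poly_ring vars) (block_prime T \<rho> :: ('x, 'k) mpoly set) \<le> enat (card D)" .
  have "enat (card D) \<le> prime_height (poly_ring vars) (block_prime T \<rho> :: ('x, 'k) mpoly set)"
    unfolding block_prime_def
  proof (rule prime_height_subst_ker_ge[where Y = "{v. fst v \<noteq> 2}" and z = "\<lambda>x. (2, row x, col x)"])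
    show "finite D" "D \<subseteq> vars" by fact+
    show "param T \<rho> a \<in> poly_carrier {v. fst v \<noteq> 2}" for a
      unfolding param_def by (auto intro!: carrier_mult)
    show "inj_on (\<lambda>x. (2::nat, row x, col x)) D"
      using BD(3) in_vars_iff by (intro inj_onI) (metis prod.inject subsetD)
    show "(\<lambda>x. (2, row x, col x)) ` D \<inter> {v. fst v \<noteq> 2} = {}" by auto
    fix a assume a: "a \<in> D"
    let ?z = "(2, row a, col a)"
    show "\<exists>g\<in>poly_carrier (insert a (vars - D)). psubst (param T \<rho>) g = (0 :: (nat \<times> 'r \<times> 'c, 'k) mpoly) \<and>
        psubst ((param T \<rho>)(a := pvar ?z)) g \<noteq> 0"
    proof (cases "col a \<in> T")
      case True
      have "psubst (\<lambda>_. 1 :: ('x, 'k) mpoly) (pvar ?z) \<noteq> 0" by simp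
      then have "(pvar ?z :: (nat \<times> 'r \<times> 'c, 'k) mpoly) \<noteq> 0" by (metis psubst_0)
      then show ?thesis using True by (intro bexI[of _ "pvar a"]) (auto simp: param_def)
    next
      case False
      then have aa: "a = X (row a) (col a)" "row a \<in> R" "col a \<in> C - T" "row a \<noteq> i0" "\<rho> (col a) \<noteq> col a"
        using a in_vars_iff by (auto simp: D_def)
      \<comment> \<open>Once the value at \<open>a\<close> is a fresh variable, setting that
        variable to 0 and all others to 1 turns the minor into -1.\<close>
      let ?g = "minor (row a) i0 (col a) (\<rho> (col a)) :: ('x, 'k) mpoly"
      note r = \<rho>[OF aa(3)]
      have ne: "X i0 (\<rho> (col a)) \<noteq> a" "X (row a) (\<rho> (col a)) \<noteq> a" "X i0 (col a) \<noteq> a"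
        using aa by (metis row col)+
      have "psubst (param T \<rho>) ?g = (0 :: (nat \<times> 'r \<times> 'c, 'k) mpoly)"
        using minor_in_block_prime[of "row a" i0 "col a" "\<rho> (col a)" T \<rho>] aa r i0
        by (auto simp: block_prime_def subst_ker_def)
      moreover have "psubst ((param T \<rho>)(a := pvar ?z)) ?g \<noteq> (0 :: (nat \<times> 'r \<times> 'c, 'k) mpoly)"
      proof
        assume "psubst ((param T \<rho>)(a := pvar ?z)) ?g = (0 :: (nat \<times> 'r \<times> 'c, 'k) mpoly)"
        then have "psubst (\<lambda>v. if v = ?z then 0 else 1 :: ('x, 'k) mpoly)
            (psubst ((param T \<rho>)(a := pvar ?z)) ?g :: (nat \<times> 'r \<times> 'c, 'k) mpoly) = 0" by simp
        then show False
          using aa(1)[symmetric] ne r aa(3) by (simp add: minor_def psubst_diff psubst_mult param_def)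
      qed
      moreover have "?g \<in> poly_carrier (insert a (vars - D))"
        unfolding minor_def using aa(1)[symmetric] aa r i0
        by (intro carrier_diff carrier_mult) (auto simp: D_def)
      ultimately show ?thesis by blast
    qed
  qed
  with le card_D show ?thesis by (simp add: antisym)
qed

end

section \<open>Associated primes\<close>

text \<open>Reachability in the induced subgraph on \<open>W\<close>. It is reflexive also at points
  outside \<open>W\<close>, so membership in \<open>W\<close> has to be carried along
  separately.\<close>

abbreviation conn :: "('v \<times> 'v) set \<Rightarrow> 'v set \<Rightarrow> ('v \<times> 'v) set" where
  "conn F W \<equiv> (F \<inter> W \<times> W)\<^sup>*"

text \<open>A visit to \<open>v\<close> can be bypassed, because the neighbours used before and
  after it are already connected without \<open>v\<close>. The same argument serves for comparing
  primes, for counting components and for minimal separators.\<close>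

lemma conn_insert_restrict:
  assumes F: "sym F" and v: "v \<notin> W"
    and nb: "\<And>a b. a \<in> W \<Longrightarrow> b \<in> W \<Longrightarrow> (v, a) \<in> F \<Longrightarrow> (v, b) \<in> F \<Longrightarrow> (a, b) \<in> conn F W"
    and j: "(j, j') \<in> conn F (insert v W)" "j \<in> W" "j' \<in> W"
  shows "(j, j') \<in> conn F W"
proof -
  \<comment> \<open>The invariant for a path that currently stands at \<open>v\<close> records a
    neighbour in \<open>W\<close> that is reachable without \<open>v\<close>.\<close>
  have "(k \<noteq> v \<longrightarrow> (j, k) \<in> conn F W) \<and> (k = v \<longrightarrow> (\<exists>a\<in>W. (a, v) \<in> F \<and> (j, a) \<in> conn F W))"
    if "(j, k) \<in> conn F (insert v W)" for k
    using that
  proof (induction rule: rtrancl_induct)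
    case base
    then show ?case using j(2) v by blast
  next
    case (step k l)
    have kl: "(k, l) \<in> F" "k \<in> insert v W" "l \<in> insert v W" using step.hyps(2) by auto
    show ?case
    proof (intro conjI impI)
      assume l: "l \<noteq> v"
      show "(j, l) \<in> conn F W"
      proof (cases "k = v")
        case True
        then obtain a where a: "a \<in> W" "(a, v) \<in> F" "(j, a) \<in> conn F W" using step.IH by blast
        have "(v, a) \<in> F" "(v, l) \<in> F" "l \<in> W" using a F kl True l by (auto dest: symD)
        then have "(a, l) \<in> conn F W" using nb a(1) by blast
        then show ?thesis using a(3) by (rule rtrancl_trans[rotated])
      next
        case False
        then have "(j, k) \<in> conn F W" "(k, l) \<in> F \<inter> W \<times> W" using step.IH kl l by auto
        then show ?thesis by (rule rtrancl_into_rtrancl)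
      qed
    next
      assume l: "l = v"
      show "\<exists>a\<in>W. (a, v) \<in> F \<and> (j, a) \<in> conn F W"
        using step.IH kl l by (cases "k = v") blast+
    qed
  qed
  from this[OF j(1)] show ?thesis using j(3) v by blast
qed

section \<open>Colon ideals, localization and finite intersections\<close>

lemma genideal_poly:
  assumes "S \<subseteq> poly_carrier A"
  shows "ideal (Idl\<^bsub>poly_ring A\<^esub> S) (poly_ring A :: ('x, 'k::field) mpoly ring)"
    and "S \<subseteq> Idl\<^bsub>poly_ring A\<^esub> S"
    and "ideal I (poly_ring A :: ('x, 'k) mpoly ring) \<Longrightarrow> S \<subseteq> I \<Longrightarrow> Idl\<^bsub>poly_ring A\<^esub> S \<subseteq> I"
proof -
  interpret cring "poly_ring A :: ('x, 'k) mpoly ring" by (rule cring_poly_ring)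
  show "ideal (Idl\<^bsub>poly_ring A\<^esub> S) (poly_ring A :: ('x, 'k) mpoly ring)"
    "S \<subseteq> Idl\<^bsub>poly_ring A\<^esub> S"
    "ideal I (poly_ring A :: ('x, 'k) mpoly ring) \<Longrightarrow> S \<subseteq> I \<Longrightarrow> Idl\<^bsub>poly_ring A\<^esub> S \<subseteq> I"
    using assms genideal_ideal genideal_self genideal_minimal by simp_all
qed

lemma ideal_colon:
  assumes J: "ideal J (poly_ring A :: ('x, 'k::field) mpoly ring)" and f: "f \<in> poly_carrier A"
  shows "ideal {g \<in> poly_carrier A. g * f \<in> J} (poly_ring A :: ('x, 'k) mpoly ring)"
  unfolding ideal_poly_iff
  using ideal_0[OF J] ideal_add[OF J] ideal_mult[OF J] by (auto simp: distrib_right mult.assoc)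

text \<open>The contraction of the localization of \<open>J\<close> at \<open>P\<close>.\<close>

definition local_part :: "'x set \<Rightarrow> ('x, 'k::field) mpoly set \<Rightarrow> ('x, 'k) mpoly set \<Rightarrow> ('x, 'k) mpoly set" where
  "local_part A P J = {g \<in> poly_carrier A. \<exists>f\<in>poly_carrier A - P. f * g \<in> J}"

lemma ideal_local_part:
  assumes P: "primeideal P (poly_ring A :: ('x, 'k::field) mpoly ring)"
    and J: "ideal J (poly_ring A :: ('x, 'k) mpoly ring)"
  shows "ideal (local_part A P J) (poly_ring A :: ('x, 'k) mpoly ring)"
  unfolding ideal_poly_iff
proof (intro conjI ballI)
  show "local_part A P J \<subseteq> poly_carrier A" by (auto simp: local_part_def)
  have "1 \<in> poly_carrier A - P" using P by (auto simp: primeideal_poly_iff)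
  then show "0 \<in> local_part A P J" using ideal_0[OF J] unfolding local_part_def
    by (intro CollectI conjI bexI[of _ 1]) auto
next
  fix g h assume "g \<in> local_part A P J" "h \<in> local_part A P J"
  then obtain u v where g: "g \<in> poly_carrier A" "u \<in> poly_carrier A - P" "u * g \<in> J"
    and h: "h \<in> poly_carrier A" "v \<in> poly_carrier A - P" "v * h \<in> J" by (auto simp: local_part_def)
  have "u * v \<in> poly_carrier A - P" using g h P by (auto simp: primeideal_poly_iff)
  moreover have "v * (u * g) + u * (v * h) \<in> J"
    using g h by (simp add: ideal_add[OF J] ideal_mult[OF J])
  then have "u * v * (g + h) \<in> J" by (simp add: algebra_simps)
  ultimately show "g + h \<in> local_part A P J" using g h by (auto simp: local_part_def)
next
  fix g q :: "('x, 'k) mpoly" assume "g \<in> local_part A P J" and q: "q \<in> poly_carrier A"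
  then obtain u where g: "g \<in> poly_carrier A" "u \<in> poly_carrier A - P" "u * g \<in> J"
    by (auto simp: local_part_def)
  have "q * (u * g) \<in> J" using g q by (simp add: ideal_mult[OF J])
  then have "u * (q * g) \<in> J" by (simp only: mult.left_commute)
  then show "q * g \<in> local_part A P J" using g q by (auto simp: local_part_def)
qed

lemma local_part_cancel:
  assumes P: "primeideal P (poly_ring A :: ('x, 'k::field) mpoly ring)"
    and h: "h \<in> poly_carrier A" "h \<notin> P" and g: "g \<in> poly_carrier A" and hg: "h * g \<in> local_part A P J"
  shows "g \<in> local_part A P J"
proof -
  from hg obtain u where u: "u \<in> poly_carrier A - P" "u * (h * g) \<in> J" by (auto simp: local_part_def)
  then have "u * h \<in> poly_carrier A - P" using h P by (auto simp: primeideal_poly_iff)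
  then show ?thesis using u g unfolding local_part_def mult.assoc[symmetric] by blast
qed

lemma subset_local_part:
  assumes "primeideal P (poly_ring A :: ('x, 'k::field) mpoly ring)" "J \<subseteq> poly_carrier A"
  shows "J \<subseteq> local_part A P J"
proof -
  have "1 \<in> poly_carrier A - P" using assms(1) by (auto simp: primeideal_poly_iff)
  then show ?thesis using assms(2) unfolding local_part_def by (intro subsetI CollectI conjI bexI[of _ 1]) auto
qed

text \<open>The product of the individual denominators is a common one, and stays outside the prime.
  Applied to generators of a block prime it provides the \<open>f\<close> that exhibits this prime
  as a colon ideal.\<close>

lemma finite_local_part_denominator:
  assumes P: "primeideal P (poly_ring A :: ('x, 'k::field) mpoly ring)"
    and J: "ideal J (poly_ring A :: ('x, 'k) mpoly ring)"
    and S: "finite S" "S \<subseteq> local_part A P J"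
  shows "\<exists>f\<in>poly_carrier A - P. \<forall>g\<in>S. g * f \<in> J"
  using S
proof (induction S)
  case empty
  have "1 \<in> poly_carrier A - P" using P by (auto simp: primeideal_poly_iff)
  then show ?case by (intro bexI[of _ 1]) auto
next
  case (insert g S)
  then obtain f where f: "f \<in> poly_carrier A - P" "\<forall>g\<in>S. g * f \<in> J" by auto
  from insert obtain u where u: "u \<in> poly_carrier A - P" "u * g \<in> J" by (auto simp: local_part_def)
  have "f * u \<in> poly_carrier A - P" using f u P by (auto simp: primeideal_poly_iff)
  moreover have "h * (f * u) \<in> J" if h: "h \<in> insert g S" for h
  proof (cases "h = g")
    case True
    have "f * (u * g) \<in> J" using f u by (simp add: ideal_mult[OF J])
    then show ?thesis using True by (simp add: ac_simps)
  next
    case False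
    then have "u * (h * f) \<in> J" using f u h by (simp add: ideal_mult[OF J])
    then show ?thesis by (simp add: ac_simps)
  qed
  ultimately show ?case by blast
qed

text \<open>If every \<open>Q\<close> were strictly larger than \<open>P\<close>, a product of
  elements \<open>g Q\<close> of \<open>Q\<close> outside \<open>P\<close> would lie in the
  intersection but not in \<open>P\<close>. The factor \<open>poly_carrier A\<close> gives the
  intersection of the empty family its proper meaning as the whole ring.\<close>

lemma primeideal_eq_of_finite_Inter:
  assumes P: "primeideal P (poly_ring A :: ('x, 'k::field) mpoly ring)"
    and S: "finite S" "\<And>Q. Q \<in> S \<Longrightarrow> P \<subseteq> Q \<and> Q \<subseteq> poly_carrier A"
      and Q: "\<And>Q. Q \<in> S \<Longrightarrow> ideal Q (poly_ring A :: ('x, 'k) mpoly ring)"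
    and inter: "poly_carrier A \<inter> \<Inter>S \<subseteq> P"
  shows "P \<in> S"
proof (rule ccontr)
  assume "P \<notin> S"
  then have "\<exists>g. g \<in> Q \<and> g \<notin> P" if "Q \<in> S" for Q using S(2)[OF that] that by (metis subset_antisym subsetI)
  then obtain g where g: "\<And>Q. Q \<in> S \<Longrightarrow> g Q \<in> Q \<and> g Q \<notin> P" by metis
  then have gA: "g Q \<in> poly_carrier A" if "Q \<in> S" for Q using S(2) that by blast
  have nP: "(\<Prod>Q\<in>S'. g Q) \<notin> P" if "S' \<subseteq> S" for S'
    using finite_subset[OF that S(1)] that
  proof (induction S')
    case empty
    then show ?case using P by (simp add: primeideal_poly_iff)
  next
    case (insert Q S')
    moreover have "(\<Prod>Q\<in>S'. g Q) \<in> poly_carrier A" using insert.prems gA by (intro carrier_prod) auto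
    ultimately show ?case using P g[of Q] gA[of Q] by (auto simp: primeideal_poly_iff)
  qed
  have "(\<Prod>Q\<in>S. g Q) \<in> Q" if "Q \<in> S" for Q
  proof -
    have "(\<Prod>Q\<in>S - {Q}. g Q) * g Q \<in> Q"
      using g[OF that] gA by (intro ideal_mult[OF Q[OF that]] carrier_prod) auto
    then show ?thesis using prod.remove[OF S(1) that, of g] by (simp add: mult.commute)
  qed
  then have "(\<Prod>Q\<in>S. g Q) \<in> poly_carrier A \<inter> \<Inter>S" using gA by (auto intro: carrier_prod)
  then show False using inter nP[of S] by blast
qed

section \<open>Associated primes of ideals generated by edge minors\<close>

context variable_matrix
begin

definition edge_minors :: "('r \<times> 'r) set \<Rightarrow> ('c \<times> 'c) set \<Rightarrow> ('x, 'k::field) mpoly set" where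
  "edge_minors E F = {minor i i' j j' | i i' j j'. (i, i') \<in> E \<and> (j, j') \<in> F}"

text \<open>\<open>E\<close> and \<open>F\<close> contain both orientations of every edge while the
  binomial edge ideal is generated by one of them. Characterizing \<open>J\<close> as a smallest
  ideal covers this as well as the transposed reading.\<close>

definition generated_by_minors ::
  "('r \<times> 'r) set \<Rightarrow> ('c \<times> 'c) set \<Rightarrow> ('x, 'k::field) mpoly set \<Rightarrow> bool" where
  "generated_by_minors E F J \<longleftrightarrow> E \<subseteq> R \<times> R \<and> F \<subseteq> C \<times> C \<and>
    ideal J (poly_ring vars :: ('x, 'k) mpoly ring) \<and> edge_minors E F \<subseteq> J \<and>
    (\<forall>I. ideal I (poly_ring vars :: ('x, 'k) mpoly ring) \<longrightarrow> edge_minors E F \<subseteq> I \<longrightarrow> J \<subseteq> I)"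

definition separates :: "('c \<times> 'c) set \<Rightarrow> 'c set \<Rightarrow> ('c \<Rightarrow> 'c) \<Rightarrow> bool" where
  "separates F T \<rho> \<longleftrightarrow> (\<forall>j\<in>C - T. \<forall>j'\<in>C - T. \<rho> j = \<rho> j' \<longleftrightarrow> (j, j') \<in> conn F (C - T))"

lemma generated_by_minors_subset_block_prime:
  assumes J: "generated_by_minors E F (J :: ('x, 'k::field) mpoly set)" and \<rho>: "separates F T \<rho>"
  shows "J \<subseteq> block_prime T \<rho>"
proof -
  have "minor i i' j j' \<in> (block_prime T \<rho> :: ('x, 'k) mpoly set)" if "(i, i') \<in> E" "(j, j') \<in> F" for i i' j j'
  proof -
    have ij: "i \<in> R" "i' \<in> R" "j \<in> C" "j' \<in> C" using J that by (auto simp: generated_by_minors_def)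
    moreover have "\<rho> j = \<rho> j'" if "j \<notin> T" "j' \<notin> T"
      using \<rho> ij that \<open>(j, j') \<in> F\<close> unfolding separates_def by (metis DiffI IntI SigmaI r_into_rtrancl)
    ultimately show ?thesis by (intro minor_in_block_prime) auto
  qed
  then have "edge_minors E F \<subseteq> (block_prime T \<rho> :: ('x, 'k) mpoly set)" by (auto simp: edge_minors_def)
  then show ?thesis using J ideal_block_prime unfolding generated_by_minors_def by blast
qed

text \<open>
  Locally at \<open>P\<^sub>T\<close> the entries outside the columns of \<open>T\<close> are units, so that minors can be composed
  along paths; and an entry of a column \<open>v \<in> T\<close> lies in the ideal because \<open>v\<close> has neighbours in two
  components, whose minor is a unit as well.
\<close>

lemma block_prime_associated:
  fixes J :: "('x, 'k::field) mpoly set"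
  assumes J: "generated_by_minors E F J" and \<rho>: "separates F T \<rho>" and T: "T \<subseteq> C"
    and E: "\<And>i i'. i \<in> R \<Longrightarrow> i' \<in> R \<Longrightarrow> (i, i') \<in> E\<^sup>*" "\<And>i. i \<in> R \<Longrightarrow> \<exists>i'. (i, i') \<in> E \<and> i' \<noteq> i"
    and cut: "\<And>v. v \<in> T \<Longrightarrow> \<exists>a\<in>C - T. \<exists>b\<in>C - T. (v, a) \<in> F \<and> (v, b) \<in> F \<and> \<rho> a \<noteq> \<rho> b"
  shows "block_prime T \<rho> \<in> associated_primes (poly_ring vars) J"
proof -
  let ?P = "block_prime T \<rho> :: ('x, 'k) mpoly set"
  let ?L = "local_part vars ?P J"
  have J': "ideal J (poly_ring vars :: ('x, 'k) mpoly ring)" "edge_minors E F \<subseteq> J" "E \<subseteq> R \<times> R" "F \<subseteq> C \<times> C"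
    using J by (auto simp: generated_by_minors_def)
  have P: "primeideal ?P (poly_ring vars :: ('x, 'k) mpoly ring)" by (rule primeideal_block_prime)
  have L: "ideal ?L (poly_ring vars :: ('x, 'k) mpoly ring)" by (rule ideal_local_part[OF P J'(1)])
  have JL: "J \<subseteq> ?L" using ideal_subset[OF J'(1)] by (intro subset_local_part[OF P]) auto
  have unit: "pvar (X i j) \<notin> ?P" if "j \<notin> T" for i j using that by (simp add: pvar_in_block_prime)
  have edge: "minor i i' j j' \<in> ?L" if "(i, i') \<in> E" "(j, j') \<in> F" for i i' j j'
  proof -
    have "minor i i' j j' \<in> edge_minors E F" using that unfolding edge_minors_def by blast
    then show ?thesis using J'(2) JL by blast
  qed
  have edge_path: "minor i i' j j' \<in> ?L"
    if ii': "(i, i') \<in> E" and "(j, j') \<in> conn F (C - T)" and j: "j \<in> C - T" for i i' j j'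
    using that(2)
  proof (induction rule: rtrancl_induct)
    case base
    have "minor i i' j j = (0 :: ('x, 'k) mpoly)" by (simp add: minor_def mult.commute)
    then show ?case using ideal_0[OF L] by simp
  next
    case (step k l)
    have R: "i \<in> R" "i' \<in> R" using ii' J'(3) by auto
    have kl: "k \<in> C - T" "l \<in> C - T" "(k, l) \<in> F" using step.hyps(2) by auto
    \<comment> \<open>Expansion of the 3x3 determinant on columns \<open>j\<close>,
      \<open>k\<close>, \<open>l\<close> with row \<open>i\<close> taken twice, which is zero. The
      factor on the left is outside the prime because \<open>k\<close> is not in
      \<open>T\<close>.\<close>
    have "pvar (X i k) * minor i i' j l =
        pvar (X i j) * minor i i' k l + pvar (X i l) * (minor i i' j k :: ('x, 'k) mpoly)"
      by (simp add: minor_def algebra_simps)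
    also have "\<dots> \<in> ?L"
      using R kl j edge[OF ii' kl(3)] step.IH by (intro ideal_add[OF L] ideal_mult[OF L]) auto
    finally have m: "pvar (X i k) * minor i i' j l \<in> ?L" .
    show ?case
      by (rule local_part_cancel[OF P _ _ _ m]) (use R kl j unit[of k i] in \<open>auto intro!: minor_carrier\<close>)
  qed
  have path: "minor i i' j j' \<in> ?L"
    if "i \<in> R" "i' \<in> R" and j: "j \<in> C - T" and j': "j' \<in> C - T" and "\<rho> j = \<rho> j'" for i i' j j'
    using E(1)[OF that(1,2)]
  proof (induction rule: rtrancl_induct)
    case base
    have "minor i i j j' = (0 :: ('x, 'k) mpoly)" by (simp add: minor_def mult.commute)
    then show ?case using ideal_0[OF L] by simp
  next
    case (step k l)
    have kl: "k \<in> R" "l \<in> R" using step.hyps(2) J'(3) by auto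
    have "(j, j') \<in> conn F (C - T)" using \<rho> that by (auto simp: separates_def)
    then have m: "minor k l j j' \<in> ?L" using edge_path[OF step.hyps(2) _ j] by blast
    \<comment> \<open>The same expansion with the roles exchanged: rows \<open>i\<close>,
      \<open>k\<close>, \<open>l\<close>, and column \<open>j\<close> taken twice.\<close>
    have "pvar (X k j) * minor i l j j' =
        pvar (X i j) * minor k l j j' + pvar (X l j) * (minor i k j j' :: ('x, 'k) mpoly)"
      by (simp add: minor_def algebra_simps)
    also have "\<dots> \<in> ?L"
      using that(1) kl j j' m step.IH by (intro ideal_add[OF L] ideal_mult[OF L]) auto
    finally have m: "pvar (X k j) * minor i l j j' \<in> ?L" .
    show ?case
      by (rule local_part_cancel[OF P _ _ _ m]) (use that(1) kl j j' unit[of j k] in \<open>auto intro!: minor_carrier\<close>)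
  qed
  have killed: "pvar (X i v) \<in> ?L" if i: "i \<in> R" and v: "v \<in> C \<inter> T" for i v
  proof -
    obtain a b where ab: "a \<in> C - T" "b \<in> C - T" "(v, a) \<in> F" "(v, b) \<in> F" "\<rho> a \<noteq> \<rho> b"
      using cut v by blast
    obtain i' where i': "(i, i') \<in> E" "i' \<noteq> i" using E(2) i by blast
    then have i'R: "i' \<in> R" using J'(3) by auto
    \<comment> \<open>Again the determinant with row \<open>i\<close> repeated, now on columns
      \<open>v\<close>, \<open>a\<close>, \<open>b\<close>. Here the minor on \<open>a\<close> and
      \<open>b\<close> is the factor outside the prime.\<close>
    have "minor i i' a b * pvar (X i v) =
        pvar (X i a) * minor i i' v b - pvar (X i b) * (minor i i' v a :: ('x, 'k) mpoly)"
      by (simp add: minor_def algebra_simps)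
    also have "\<dots> \<in> ?L"
      using i ab edge[OF i'(1)] by (intro ideal_diff[OF L] ideal_mult[OF L]) auto
    finally have m: "minor i i' a b * pvar (X i v) \<in> ?L" .
    show ?thesis
      by (rule local_part_cancel[OF P _ _ _ m])
        (use i i'R v ab i'(2) minor_notin_block_prime[of i i' a T b \<rho>] in \<open>auto intro!: minor_carrier\<close>)
  qed
  let ?G = "(\<lambda>(i, j). pvar (X i j)) ` (R \<times> (C \<inter> T)) \<union>
    (\<lambda>(i, i', j, j'). minor i i' j j') ` {(i, i', j, j'). (i, i', j, j') \<in> R \<times> R \<times> (C - T) \<times> (C - T) \<and> \<rho> j = \<rho> j'}"
  have "finite {(i, i', j, j'). (i, i', j, j') \<in> R \<times> R \<times> (C - T) \<times> (C - T) \<and> \<rho> j = \<rho> j'}"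
    by (rule finite_subset[of _ "R \<times> R \<times> (C - T) \<times> (C - T)"]) (auto simp: finite_R finite_C)
  then have "finite ?G" by (simp add: finite_R finite_C)
  moreover have "?G \<subseteq> ?L" using killed path by auto
  ultimately have "\<exists>f\<in>poly_carrier vars - ?P. \<forall>g\<in>?G. g * f \<in> J"
    by (rule finite_local_part_denominator[OF P J'(1)])
  then obtain f where f: "f \<in> poly_carrier vars" "f \<notin> ?P" "\<And>g. g \<in> ?G \<Longrightarrow> g * f \<in> J" by blast
  \<comment> \<open>The colon ideal contains the generators of the prime by the choice of
    \<open>f\<close>. Conversely, \<open>g * f\<close> in \<open>J\<close> lies in the prime, and
    \<open>f\<close> does not, so \<open>g\<close> does.\<close>
  let ?I = "{g \<in> poly_carrier vars. g * f \<in> J}"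
  have "?P \<subseteq> ?I"
  proof (rule block_prime_subset[OF ideal_colon[OF J'(1) f(1)]])
    fix i j assume "i \<in> R" "j \<in> C \<inter> T"
    then show "pvar (X i j) \<in> ?I" by (auto intro!: f(3))
  next
    fix i i' j j' assume a: "i \<in> R" "i' \<in> R" "j \<in> C - T" "j' \<in> C - T" "\<rho> j = \<rho> j'"
    then have "minor i i' j j' \<in> ?G" by (intro UnI2 image_eqI[of _ _ "(i, i', j, j')"]) auto
    then show "minor i i' j j' \<in> ?I" using f(3) a by (simp add: minor_carrier)
  qed
  moreover have "?I \<subseteq> ?P"
    using generated_by_minors_subset_block_prime[OF J \<rho>] P f(1,2) by (auto simp: primeideal_poly_iff)
  ultimately have "?P = ?I" by blast
  then show ?thesis using P f(1) unfolding associated_primes_def by auto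
qed

text \<open>
  The part of \<open>J\<close> of a fixed column degree is determined by the primes \<open>P\<^sub>T\<close> with \<open>T\<close> the set of
  columns of degree zero: in the remaining columns every vertex carries an entry, so that swaps
  along a path can be carried out by swaps along its edges.
\<close>

lemma Inter_block_primes_subset:
  fixes J :: "('x, 'k::field) mpoly set"
  assumes J: "generated_by_minors E F J" and E: "\<And>i i'. i \<in> R \<Longrightarrow> i' \<in> R \<Longrightarrow> i \<noteq> i' \<Longrightarrow> (i, i') \<in> E"
    and \<rho>: "\<And>T. T \<subseteq> C \<Longrightarrow> separates F T (\<rho> T)"
    and p: "\<And>T. T \<subseteq> C \<Longrightarrow> p \<in> block_prime T (\<rho> T)"
  shows "p \<in> J"
proof -
  have J': "ideal J (poly_ring vars :: ('x, 'k) mpoly ring)" "edge_minors E F \<subseteq> J" "F \<subseteq> C \<times> C"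
    using J by (auto simp: generated_by_minors_def)
  have edge: "minor i i' j j' \<in> J" if "i \<in> R" "i' \<in> R" "(j, j') \<in> F" for i i' j j'
  proof (cases "i = i'")
    case True
    then have "minor i i' j j' = (0 :: ('x, 'k) mpoly)" by (simp add: minor_def mult.commute)
    then show ?thesis using ideal_0[OF J'(1)] by simp
  next
    case False
    then have "minor i i' j j' \<in> edge_minors E F" using that E unfolding edge_minors_def by blast
    then show ?thesis using J'(2) by blast
  qed
  \<comment> \<open>The last condition says that every column of \<open>S\<close> is occupied by
    \<open>\<mu>\<close> or by the minor; it supplies an entry at each inner vertex of the
    path.\<close>
  have path: "monom \<mu> * minor i i' j j' \<in> J"
    if "(j, j') \<in> conn F S" "keys \<mu> \<subseteq> vars" "i \<in> R" "i' \<in> R" "j' \<in> C" "col ` keys \<mu> \<union> {j, j'} = S"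
    for \<mu> i i' j j' S
    using that
  proof (induction arbitrary: \<mu> i i' rule: converse_rtrancl_induct)
    case base
    have "minor i i' j' j' = (0 :: ('x, 'k) mpoly)" by (simp add: minor_def mult.commute)
    then show ?case using ideal_0[OF J'(1)] by simp
  next
    case (step j w)
    have jw: "(j, w) \<in> F" "j \<in> S" "w \<in> S" "j \<in> C" "w \<in> C" using step.hyps(1) J'(3) by auto
    consider "w = j'" | "w = j" | "w \<noteq> j" "w \<noteq> j'" by blast
    then show ?case
    proof cases
      case 1
      then show ?thesis using edge[OF step.prems(2,3) jw(1)] step.prems(1)
        by (auto intro!: ideal_mult[OF J'(1)] carrier_single)
    next
      case 2
      then show ?thesis using step by auto
    next
      case 3
      then have "w \<in> col ` keys \<mu>" using step.prems(5) jw(3) by blast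
      then obtain k where k: "X k w \<in> keys \<mu>" "k \<in> R" using step.prems(1) in_vars_iff by (metis imageE subsetD)
      define \<eta> where "\<eta> = \<mu> - msingle (X k w) 1"
      have \<mu>: "\<mu> = \<eta> + msingle (X k w) 1"
        using k(1) by (intro poly_mapping_eqI) (auto simp: \<eta>_def lookup_add lookup_minus lookup_single when_def in_keys_iff)
      have \<eta>: "keys \<eta> \<subseteq> vars"
        using step.prems(1) by (auto simp: \<eta>_def in_keys_iff lookup_minus subset_iff)
      let ?\<nu> = "\<eta> + msingle (X k j) 1"
      have "keys \<mu> = keys \<eta> \<union> {X k w}" "keys ?\<nu> = keys \<eta> \<union> {X k j}"
        by (auto simp: \<mu> in_keys_iff lookup_add lookup_single when_def split: if_splits)
      then have c: "col ` keys \<mu> = insert w (col ` keys \<eta>)" "col ` keys ?\<nu> = insert j (col ` keys \<eta>)"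
        and \<nu>: "keys ?\<nu> \<subseteq> vars" using \<eta> k jw by auto
      have "monom ?\<nu> * minor i i' w j' \<in> J"
        using c step.prems by (intro step.IH \<nu>) auto
      then have 2: "monom \<eta> * pvar (X k j) * minor i i' w j' \<in> J"
        by (simp add: monom_add pvar_def)
      have 1: "monom \<eta> * pvar (X i' j') * minor i k j w \<in> J"
        using \<eta> k step.prems jw by (intro ideal_mult[OF J'(1)] edge carrier_mult carrier_single) auto
      have 3: "monom \<eta> * pvar (X i j') * minor k i' j w \<in> J"
        using \<eta> k step.prems jw by (intro ideal_mult[OF J'(1)] edge carrier_mult carrier_single) auto
      \<comment> \<open>With \<open>\<mu> = \<eta> + X k w\<close>, the outer summands are multiples
        of minors on the edge \<open>(j, w)\<close>. The middle one is the induction hypothesis for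
        the path from \<open>w\<close>: column \<open>j\<close> is now occupied by
        \<open>X k j\<close>, so the set of columns is still \<open>S\<close>. Since
        \<open>k\<close> is arbitrary, minors for all pairs of rows are needed, which is where
        completeness of \<open>E\<close> enters.\<close>
      have "monom \<mu> * minor i i' j j' = monom \<eta> * pvar (X i' j') * minor i k j w +
          monom \<eta> * pvar (X k j) * minor i i' w j' + monom \<eta> * pvar (X i j') * (minor k i' j w :: ('x, 'k) mpoly)"
        unfolding \<mu> monom_add by (simp add: pvar_def minor_def algebra_simps)
      then show ?thesis using 1 2 3 by (simp add: ideal_add[OF J'(1)])
    qed
  qed
  have pk: "keys \<mu> \<subseteq> vars" if "\<mu> \<in> keys p" for \<mu>
    using p[of "{}"] that by (auto simp: block_prime_def subst_ker_def poly_carrier_def)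
  let ?T = "\<lambda>\<mu>. C - col ` keys \<mu>"
  \<comment> \<open>The block map is that of the columns missing from the monomial. Equal weights
    force equal sets of occupied columns, so within a class a single \<open>T\<close> is in
    use.\<close>
  let ?\<kappa> = "\<lambda>\<mu>. weight (\<rho> (?T \<mu>)) \<mu>"
  show ?thesis
  proof (rule coefficient_class_sums_imp_mem[OF J'(1), where \<kappa> = ?\<kappa>])
    fix \<mu> \<nu> assume \<mu>\<nu>: "\<mu> \<in> keys p" "\<nu> \<in> keys p" and eq: "?\<kappa> \<mu> = ?\<kappa> \<nu>"
    have T: "?T \<mu> = ?T \<nu>" using weight_eq_imp_col_keys[OF eq] by simp
    have S: "C - ?T \<mu> = col ` keys \<mu>" using col_keys[OF pk[OF \<mu>\<nu>(1)]] by blast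
    show "monom \<mu> - monom \<nu> \<in> J"
    proof (rule monom_diff_in_ideal[OF J'(1) _ pk[OF \<mu>\<nu>(1)] refl pk[OF \<mu>\<nu>(2)], where \<rho> = "\<rho> (?T \<mu>)"])
      show "weight (\<rho> (?T \<mu>)) \<mu> = weight (\<rho> (?T \<mu>)) \<nu>" using eq T by simp
      fix \<eta> :: "'x \<Rightarrow>\<^sub>0 nat" and i i' j j'
      assume a: "keys \<eta> \<subseteq> vars" "i \<in> R" "i' \<in> R" "j \<in> col ` keys \<mu>" "j' \<in> col ` keys \<mu>"
        "\<rho> (?T \<mu>) j = \<rho> (?T \<mu>) j'" "col ` keys \<eta> \<union> {j, j'} = col ` keys \<mu>"
      have "(j, j') \<in> conn F (C - ?T \<mu>)"
        using \<rho>[of "?T \<mu>"] a S unfolding separates_def by blast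
      then show "monom \<eta> * minor i i' j j' \<in> J"
        unfolding S using a col_keys[OF pk[OF \<mu>\<nu>(1)]] by (intro path) auto
    qed
  next
    fix \<mu> assume \<mu>: "\<mu> \<in> keys p"
    have "{\<nu>. \<nu> \<in> keys p \<and> ?\<kappa> \<nu> = ?\<kappa> \<mu>} =
        {\<nu>. \<nu> \<in> keys p \<and> col ` keys \<nu> \<inter> ?T \<mu> = {} \<and> weight (\<rho> (?T \<mu>)) \<nu> = weight (\<rho> (?T \<mu>)) \<mu>}"
      (is "?A = ?B")
    proof (rule subset_antisym; rule subsetI)
      fix \<nu> assume "\<nu> \<in> ?A"
      then have "\<nu> \<in> keys p" "?\<kappa> \<nu> = ?\<kappa> \<mu>" by auto
      moreover from this have "col ` keys \<nu> = col ` keys \<mu>" by (intro weight_eq_imp_col_keys)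
      ultimately show "\<nu> \<in> ?B" by auto
    next
      fix \<nu> assume "\<nu> \<in> ?B"
      then have "\<nu> \<in> keys p" "weight (\<rho> (?T \<mu>)) \<nu> = weight (\<rho> (?T \<mu>)) \<mu>" by auto
      moreover from this have "col ` keys \<nu> = col ` keys \<mu>" by (intro weight_eq_imp_col_keys)
      ultimately show "\<nu> \<in> ?A" by auto
    qed
    then show "monom \<mu> \<in> J \<or> (\<Sum>\<nu> | \<nu> \<in> keys p \<and> ?\<kappa> \<nu> = ?\<kappa> \<mu>. lookup p \<nu>) = 0"
      using block_prime_coefficient_sum[OF p[of "?T \<mu>"]] by simp
  qed
qed

text \<open>Removing from \<open>T\<close> a vertex with neighbours in at most one component yields a smaller prime.\<close>

lemma associated_prime_is_block_prime:
  fixes J :: "('x, 'k::field) mpoly set"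
  assumes J: "generated_by_minors E F J" and E: "\<And>i i'. i \<in> R \<Longrightarrow> i' \<in> R \<Longrightarrow> i \<noteq> i' \<Longrightarrow> (i, i') \<in> E"
    and R: "R \<noteq> {}" and \<rho>: "\<And>T. T \<subseteq> C \<Longrightarrow> separates F T (\<rho> T)" and sym: "sym F"
    and P: "P \<in> associated_primes (poly_ring vars) J"
  obtains T where "T \<subseteq> C" "P = block_prime T (\<rho> T)"
    "\<And>v. v \<in> T \<Longrightarrow> \<exists>a\<in>C - T. \<exists>b\<in>C - T. (v, a) \<in> F \<and> (v, b) \<in> F \<and> \<rho> T a \<noteq> \<rho> T b"
proof -
  from P obtain f where prime: "primeideal P (poly_ring vars :: ('x, 'k) mpoly ring)"
    and f: "f \<in> poly_carrier vars" and Pf: "P = {g \<in> poly_carrier vars. g * f \<in> J}"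
    by (auto simp: associated_primes_def)
  \<comment> \<open>\<open>J\<close> is the intersection of all block primes, so \<open>P\<close>,
    being the colon ideal of \<open>J\<close> by \<open>f\<close>, is the intersection of those that
    do not contain \<open>f\<close>. A prime that is such a finite intersection is one of its
    members.\<close>
  let ?S = "{block_prime T (\<rho> T) | T. T \<subseteq> C \<and> f \<notin> block_prime T (\<rho> T)} :: ('x, 'k) mpoly set set"
  have sub: "P \<subseteq> block_prime T (\<rho> T)" if T: "T \<subseteq> C" "f \<notin> block_prime T (\<rho> T)" for T
    using generated_by_minors_subset_block_prime[OF J \<rho>[OF T(1)]] T(2) f
      primeideal_block_prime[of T "\<rho> T", where 'k = 'k] unfolding Pf primeideal_poly_iff by blast
  have "P \<in> ?S"
  proof (rule primeideal_eq_of_finite_Inter[OF prime])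
    have "?S \<subseteq> (\<lambda>T. block_prime T (\<rho> T)) ` Pow C" by blast
    then show "finite ?S" using finite_C by (meson finite_Pow_iff finite_imageI finite_subset)
  next
    fix Q assume "Q \<in> ?S"
    then obtain T where T: "T \<subseteq> C" "f \<notin> block_prime T (\<rho> T)" "Q = block_prime T (\<rho> T)" by blast
    then show "P \<subseteq> Q \<and> Q \<subseteq> poly_carrier vars" using sub by (auto simp: block_prime_def subst_ker_def)
    show "ideal Q (poly_ring vars :: ('x, 'k) mpoly ring)" unfolding T(3) by (rule ideal_block_prime)
  next
    show "poly_carrier vars \<inter> \<Inter>?S \<subseteq> P"
    proof
      fix g assume g: "g \<in> poly_carrier vars \<inter> \<Inter>?S"
      have "g * f \<in> block_prime T (\<rho> T)" if T: "T \<subseteq> C" for T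
      proof (cases "f \<in> block_prime T (\<rho> T)")
        case True
        then show ?thesis using g by (intro ideal_mult[OF ideal_block_prime]) auto
      next
        case False
        then have "f * g \<in> block_prime T (\<rho> T)" using g f T by (intro ideal_mult[OF ideal_block_prime]) auto
        then show ?thesis by (simp add: mult.commute)
      qed
      then have "g * f \<in> J" using Inter_block_primes_subset[OF J, of \<rho> "g * f"] E \<rho> by blast
      then show "g \<in> P" using g by (simp add: Pf)
    qed
  qed
  then obtain T where T: "T \<subseteq> C" "f \<notin> block_prime T (\<rho> T)" "P = block_prime T (\<rho> T)" by blast
  have "\<exists>a\<in>C - T. \<exists>b\<in>C - T. (v, a) \<in> F \<and> (v, b) \<in> F \<and> \<rho> T a \<noteq> \<rho> T b" if v: "v \<in> T" for v
  proof (rule ccontr)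
    assume no: "\<not> ?thesis"
    let ?T' = "T - {v}"
    have T': "?T' \<subseteq> C" using T by blast
    have vC: "v \<in> C" using v T by blast
    have W: "C - ?T' = insert v (C - T)" using v vC by blast
    have reach: "(j, j') \<in> conn F (C - T)"
      if "(j, j') \<in> conn F (C - ?T')" "j \<in> C - T" "j' \<in> C - T" for j j'
    proof (rule conn_insert_restrict[OF sym _ _ that[unfolded W]])
      fix a b assume a: "a \<in> C - T" "b \<in> C - T" "(v, a) \<in> F" "(v, b) \<in> F"
      then have "\<rho> T a = \<rho> T b" using no by blast
      then show "(a, b) \<in> conn F (C - T)" using \<rho>[OF T(1)] a(1,2) by (auto simp: separates_def)
    qed (use v in auto)
    \<comment> \<open>The smaller prime does not contain \<open>f\<close> either, so
      \<open>P\<close> is contained in it. But \<open>P\<close> contains the variables of column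
      \<open>v\<close> and the smaller prime does not.\<close>
    have "block_prime ?T' (\<rho> ?T') \<subseteq> (block_prime T (\<rho> T) :: ('x, 'k) mpoly set)"
    proof (rule block_prime_subset[OF ideal_block_prime])
      fix i j assume "i \<in> R" "j \<in> C \<inter> ?T'"
      then show "(pvar (X i j) :: ('x, 'k) mpoly) \<in> block_prime T (\<rho> T)" by (simp add: pvar_in_block_prime)
    next
      fix i i' j j'
      assume a: "i \<in> R" "i' \<in> R" "j \<in> C - ?T'" "j' \<in> C - ?T'" "\<rho> ?T' j = \<rho> ?T' j'"
      then have r: "(j, j') \<in> conn F (C - ?T')"
        using \<rho>[OF T'] unfolding separates_def by blast
      have "\<rho> T j = \<rho> T j'" if "j \<notin> T" "j' \<notin> T"
        using reach[OF r] \<rho>[OF T(1)] a that unfolding separates_def by blast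
      then show "(minor i i' j j' :: ('x, 'k) mpoly) \<in> block_prime T (\<rho> T)"
        using a by (intro minor_in_block_prime) auto
    qed
    then have "f \<notin> block_prime ?T' (\<rho> ?T')" using T(2) by blast
    then have "P \<subseteq> block_prime ?T' (\<rho> ?T')" by (rule sub[OF T'])
    moreover obtain i where "i \<in> R" using R by blast
    then have "(pvar (X i v) :: ('x, 'k) mpoly) \<in> P" using v vC T(3) by (simp add: pvar_in_block_prime)
    ultimately have "(pvar (X i v) :: ('x, 'k) mpoly) \<in> block_prime ?T' (\<rho> ?T')" by blast
    then show False by (simp add: pvar_in_block_prime)
  qed
  then show thesis using that T by blast
qed

end

section \<open>Connected components and cut sets\<close>

definition ccs :: "('v \<times> 'v) set \<Rightarrow> 'v set \<Rightarrow> 'v set set" where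
  "ccs F W = (\<lambda>a. conn F W `` {a}) ` W"

text \<open>The cut point property without counting components, in the form that the ideal arguments
  use. \<open>cut_sets_iff\<close> relates it to \<open>cut_sets\<close>.\<close>

definition cutset :: "('v \<times> 'v) set \<Rightarrow> 'v set \<Rightarrow> 'v set \<Rightarrow> bool" where
  "cutset F V T \<longleftrightarrow> T \<subseteq> V \<and>
    (\<forall>v\<in>T. \<exists>a\<in>V - T. \<exists>b\<in>V - T. (v, a) \<in> F \<and> (v, b) \<in> F \<and> (a, b) \<notin> conn F (V - T))"

lemma conn_closed: "(a, b) \<in> conn F W \<Longrightarrow> a \<in> W \<Longrightarrow> b \<in> W"
  by (induction rule: rtrancl_induct) auto

lemma conn_sym: "sym F \<Longrightarrow> (a, b) \<in> conn F W \<Longrightarrow> (b, a) \<in> conn F W"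
proof -
  assume "sym F"
  then have "sym (F \<inter> W \<times> W)" by (auto simp: sym_def)
  then show "(a, b) \<in> conn F W \<Longrightarrow> (b, a) \<in> conn F W" by (auto dest: sym_rtrancl symD)
qed

lemma conn_trans: "(a, b) \<in> conn F W \<Longrightarrow> (b, c) \<in> conn F W \<Longrightarrow> (a, c) \<in> conn F W"
  by (rule rtrancl_trans)

lemma conn_mono: "W \<subseteq> W' \<Longrightarrow> F \<inter> W \<times> W \<subseteq> F' \<Longrightarrow> (a, b) \<in> conn F W \<Longrightarrow> (a, b) \<in> conn F' W'"
  by (erule rtrancl_mono[THEN subsetD, rotated]) auto

lemma conn_edge: "(a, b) \<in> F \<Longrightarrow> a \<in> W \<Longrightarrow> b \<in> W \<Longrightarrow> (a, b) \<in> conn F W"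
  by (intro r_into_rtrancl) auto

lemma conn_class_eq_iff:
  assumes "sym F"
  shows "conn F W `` {a} = conn F W `` {b} \<longleftrightarrow> (a, b) \<in> conn F W"
proof
  assume "conn F W `` {a} = conn F W `` {b}"
  then show "(a, b) \<in> conn F W" by auto
next
  assume ab: "(a, b) \<in> conn F W"
  note ba = conn_sym[OF assms ab]
  show "conn F W `` {a} = conn F W `` {b}"
    using conn_trans[OF ab] conn_trans[OF ba] by auto
qed

lemma finite_ccs [simp]: "finite W \<Longrightarrow> finite (ccs F W)"
  by (simp add: ccs_def)

lemma card_ccs_le: "finite W \<Longrightarrow> card (ccs F W) \<le> card W"
  unfolding ccs_def by (rule card_image_le)

text \<open>The choice is made from the class as a set, so connected vertices receive the same
  representative.\<close>

definition conn_rep :: "('v \<times> 'v) set \<Rightarrow> 'v set \<Rightarrow> 'v \<Rightarrow> 'v" where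
  "conn_rep F W a = (SOME b. b \<in> conn F W `` {a})"

lemma conn_rep: "(a, conn_rep F W a) \<in> conn F W"
proof -
  have "a \<in> conn F W `` {a}" by simp
  then have "conn_rep F W a \<in> conn F W `` {a}" unfolding conn_rep_def by (rule someI)
  then show ?thesis by simp
qed

lemma conn_rep_eq_iff: "sym F \<Longrightarrow> conn_rep F W a = conn_rep F W b \<longleftrightarrow> (a, b) \<in> conn F W"
  using conn_rep[of a F W] conn_rep[of b F W] conn_class_eq_iff[of F W a b] conn_sym[of F _ _ W]
    conn_trans[of _ _ F W] unfolding conn_rep_def by metis

lemma conn_rep_in: "a \<in> W \<Longrightarrow> conn_rep F W a \<in> W"
  using conn_closed[OF conn_rep] .

lemma conn_rep_idem: "sym F \<Longrightarrow> conn_rep F W (conn_rep F W a) = conn_rep F W a"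
  by (simp add: conn_rep_eq_iff conn_sym conn_rep)

lemma card_conn_rep_image:
  assumes "sym F"
  shows "card (conn_rep F W ` W) = card (ccs F W)"
proof -
  have "ccs F W = (\<lambda>a. conn F W `` {a}) ` conn_rep F W ` W"
    unfolding ccs_def image_image using conn_class_eq_iff[OF assms] conn_rep[of _ F W]
    by (intro image_cong refl) blast
  moreover have "inj_on (\<lambda>a. conn F W `` {a}) (conn_rep F W ` W)"
  proof (rule inj_onI, clarify)
    fix a b assume "conn F W `` {conn_rep F W a} = conn F W `` {conn_rep F W b}"
    then show "conn_rep F W a = conn_rep F W b"
      using conn_class_eq_iff[OF assms] conn_rep_eq_iff[OF assms] conn_rep_idem[OF assms] by metis
  qed
  ultimately show ?thesis by (simp add: card_image)
qed

text \<open>Send each component of \<open>W\<close> to the component of \<open>insert v W\<close>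
  that contains it. If the neighbours of \<open>v\<close> lie in at most one component, this map is
  injective and the count cannot drop. If they lie in two, the map is onto, because \<open>v\<close>
  joins an old component, but not injective.\<close>

lemma card_ccs_insert_less_iff:
  assumes F: "sym F" and W: "finite W" "v \<notin> W"
  shows "card (ccs F (insert v W)) < card (ccs F W) \<longleftrightarrow>
    (\<exists>a\<in>W. \<exists>b\<in>W. (v, a) \<in> F \<and> (v, b) \<in> F \<and> (a, b) \<notin> conn F W)" (is "?L \<longleftrightarrow> ?R")
proof -
  let ?W = "insert v W"
  define h where "h S = conn F ?W `` S" for S
  have mono: "(a, b) \<in> conn F ?W" if "(a, b) \<in> conn F W" for a b
    using that by (rule conn_mono[rotated 2]) auto
  have h: "h (conn F W `` {a}) = conn F ?W `` {a}" for a
    unfolding h_def using mono conn_trans[of _ _ F ?W] by blast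
  have hi: "h ` ccs F W = (\<lambda>a. conn F ?W `` {a}) ` W"
    unfolding ccs_def image_image h ..
  have sub: "h ` ccs F W \<subseteq> ccs F ?W" unfolding hi by (auto simp: ccs_def)
  show ?thesis
  proof
    assume ?L
    show ?R
    proof (rule ccontr)
      assume no: "\<not> ?R"
      have "inj_on h (ccs F W)"
      proof (rule inj_onI)
        fix S S' assume "S \<in> ccs F W" "S' \<in> ccs F W" and eq: "h S = h S'"
        then obtain a b where ab: "a \<in> W" "b \<in> W" "S = conn F W `` {a}" "S' = conn F W `` {b}"
          by (auto simp: ccs_def)
        with eq have c: "(a, b) \<in> conn F ?W" using h conn_class_eq_iff[OF F] by metis
        have "(a, b) \<in> conn F W"
          by (rule conn_insert_restrict[OF F W(2) _ c ab(1,2)]) (use no in blast)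
        then show "S = S'" using ab conn_class_eq_iff[OF F] by blast
      qed
      then have "card (ccs F W) \<le> card (ccs F ?W)"
        using sub W(1) by (intro card_inj_on_le) auto
      then show False using \<open>?L\<close> by simp
    qed
  next
    assume ?R
    then obtain a b where ab: "a \<in> W" "b \<in> W" "(v, a) \<in> F" "(v, b) \<in> F" "(a, b) \<notin> conn F W" by blast
    have va: "(v, a) \<in> conn F ?W" and vb: "(v, b) \<in> conn F ?W" using ab by (auto intro: conn_edge)
    then have "conn F ?W `` {v} = conn F ?W `` {a}" using conn_class_eq_iff[OF F] by blast
    then have surj: "ccs F ?W = h ` ccs F W" unfolding hi using ab(1) by (auto simp: ccs_def)
    have "\<not> inj_on h (ccs F W)"
    proof
      assume inj: "inj_on h (ccs F W)"
      have "(a, b) \<in> conn F ?W" using conn_trans[OF conn_sym[OF F va] vb] .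
      then have eq: "h (conn F W `` {a}) = h (conn F W `` {b})" unfolding h using conn_class_eq_iff[OF F] by blast
      have "conn F W `` {a} \<in> ccs F W" "conn F W `` {b} \<in> ccs F W" unfolding ccs_def using ab by blast+
      then have "conn F W `` {a} = conn F W `` {b}" by (rule inj_onD[OF inj eq])
      then show False using ab(5) conn_class_eq_iff[OF F] by blast
    qed
    then have "card (h ` ccs F W) \<noteq> card (ccs F W)" using eq_card_imp_inj_on[OF finite_ccs[OF W(1)]] by blast
    then show ?L unfolding surj using card_image_le[OF finite_ccs[OF W(1)], of h F] by simp
  qed
qed

section \<open>From pair graphs to edge relations\<close>

lemma pair_graphD:
  assumes "pair_graph G"
  shows "finite (pverts G)" "parcs G \<subseteq> pverts G \<times> pverts G" "sym (parcs G)" "(v, v) \<notin> parcs G"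
proof -
  interpret pair_graph G by fact
  show "finite (pverts G)" by (rule pair_finite_verts)
  show "parcs G \<subseteq> pverts G \<times> pverts G" using arc_fst_in_verts arc_snd_in_verts by force
  show "sym (parcs G)" using pair_sym_arcs by (simp add: symmetric_def)
  show "(v, v) \<notin> parcs G" using pair_no_loops by fastforce
qed

lemma pair_graphI:
  assumes "finite (pverts G)" "parcs G \<subseteq> pverts G \<times> pverts G" "sym (parcs G)" "\<And>v. (v, v) \<notin> parcs G"
  shows "pair_graph G"
proof unfold_locales
  show "finite (parcs G)" using assms(1,2) finite_subset by blast
  show "symmetric (with_proj G)" using assms(3) by (simp add: symmetric_def)
  show "fst e \<in> pverts G" "snd e \<in> pverts G" "fst e \<noteq> snd e" if "e \<in> parcs G" for e
    using that assms(2,4) by (cases e; auto)+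
qed (fact assms(1))

lemma sccs_verts_eq_ccs:
  assumes "verts D = W" "arcs_ends D = F \<inter> W \<times> W" "sym F"
  shows "pre_digraph.sccs_verts D = ccs F W"
proof -
  have "(a, b) \<in> rtrancl_on W (F \<inter> W \<times> W) \<longleftrightarrow> a \<in> W \<and> (a, b) \<in> conn F W" for a b
  proof
    assume "(a, b) \<in> rtrancl_on W (F \<inter> W \<times> W)"
    then show "a \<in> W \<and> (a, b) \<in> conn F W"
      by induction (auto intro: converse_rtrancl_into_rtrancl)
  next
    assume "a \<in> W \<and> (a, b) \<in> conn F W"
    then have "(a, b) \<in> conn F W" "a \<in> W" by auto
    then show "(a, b) \<in> rtrancl_on W (F \<inter> W \<times> W)"
      by (induction rule: rtrancl_induct) (auto intro: rtrancl_on_into_rtrancl_on)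
  qed
  then have reach: "reachable D a b \<longleftrightarrow> a \<in> W \<and> (a, b) \<in> conn F W" for a b
    by (simp add: reachable_def assms)
  note sym = conn_sym[OF assms(3)]
  show ?thesis
  proof (rule subset_antisym; rule subsetI)
    fix S assume "S \<in> pre_digraph.sccs_verts D"
    then have S: "S \<noteq> {}" "\<And>u v. u \<in> S \<Longrightarrow> v \<in> S \<Longrightarrow> u \<in> W \<and> (u, v) \<in> conn F W"
      "\<And>u v. u \<in> S \<Longrightarrow> v \<notin> S \<Longrightarrow> \<not> (u \<in> W \<and> (u, v) \<in> conn F W) \<or> \<not> (v \<in> W \<and> (v, u) \<in> conn F W)"
      unfolding pre_digraph.sccs_verts_def reach by auto
    then obtain u where u: "u \<in> S" by blast
    have "S = conn F W `` {u}"
      using S(2)[OF u] S(3)[OF u] sym conn_closed[of u _ F W] u by blast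
    then show "S \<in> ccs F W" using S(2)[OF u u] by (auto simp: ccs_def)
  next
    fix S assume "S \<in> ccs F W"
    then obtain u where u: "u \<in> W" "S = conn F W `` {u}" by (auto simp: ccs_def)
    show "S \<in> pre_digraph.sccs_verts D"
      unfolding pre_digraph.sccs_verts_def reach u(2)
      using u(1) conn_closed[of u _ F W] sym conn_trans[of _ _ F W] by blast
  qed
qed

lemma num_components_eq_card_ccs:
  assumes "verts D = W" "arcs_ends D = F \<inter> W \<times> W" "sym F"
  shows "num_components D = card (ccs F W)"
  using sccs_verts_eq_ccs[OF assms] by (simp add: num_components_def)

lemma arcs_ends_with_proj_induce: "arcs_ends (with_proj G \<restriction> W) = parcs G \<inter> W \<times> W"
  by (auto simp: arcs_ends_def arc_to_ends_def)

lemma num_components_without_eq: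
  "pair_graph G \<Longrightarrow> num_components_without (with_proj G) T = card (ccs (parcs G) (pverts G - T))"
  unfolding num_components_without_def
  by (rule num_components_eq_card_ccs) (auto simp: arcs_ends_with_proj_induce pair_graphD(3))

lemma cut_sets_iff:
  assumes G: "pair_graph G"
  shows "T \<in> cut_sets (with_proj G) \<longleftrightarrow> cutset (parcs G) (pverts G) T"
proof -
  let ?V = "pverts G" and ?F = "parcs G"
  have "cut_point (with_proj G \<restriction> ((?V - T) \<union> {v})) v \<longleftrightarrow>
      (\<exists>a\<in>?V - T. \<exists>b\<in>?V - T. (v, a) \<in> ?F \<and> (v, b) \<in> ?F \<and> (a, b) \<notin> conn ?F (?V - T))" if "v \<in> T" for v
  proof -
    let ?D = "with_proj G \<restriction> ((?V - T) \<union> {v})"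
    have "num_components ?D = card (ccs ?F (insert v (?V - T)))"
      by (rule num_components_eq_card_ccs) (auto simp: arcs_ends_with_proj_induce pair_graphD(3)[OF G])
    moreover have "num_components (pre_digraph.del_vert ?D v) = card (ccs ?F (?V - T))"
      using that by (intro num_components_eq_card_ccs)
        (auto simp: pre_digraph.del_vert_def arcs_ends_def arc_to_ends_def pair_graphD(3)[OF G])
    ultimately show ?thesis
      using that card_ccs_insert_less_iff[OF pair_graphD(3)[OF G], of "?V - T" v] pair_graphD(1)[OF G]
      by (simp add: cut_point_def)
  qed
  then show ?thesis by (auto simp: cut_sets_def cut_point_property_def cutset_def)
qed

lemma connected_imp_conn:
  assumes "pair_graph G" "Digraph_Component.connected (with_proj G)"
  shows "pverts G \<noteq> {}" "\<And>a b. a \<in> pverts G \<Longrightarrow> b \<in> pverts G \<Longrightarrow> (a, b) \<in> conn (parcs G) (pverts G)"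
proof -
  interpret pair_graph G by fact
  have "strongly_connected (with_proj G)"
    using symmetric_connected_imp_strongly_connected[OF pair_sym_arcs] assms(2) by simp
  then have V: "pverts G \<noteq> {}" and reach: "\<And>a b. a \<in> pverts G \<Longrightarrow> b \<in> pverts G \<Longrightarrow> reachable (with_proj G) a b"
    by (auto simp: strongly_connected_def)
  show "pverts G \<noteq> {}" by (rule V)
  fix a b assume "a \<in> pverts G" "b \<in> pverts G"
  then have "(a, b) \<in> rtrancl_on (pverts G) (parcs G)" using reach by (auto simp: reachable_def)
  then show "(a, b) \<in> conn (parcs G) (pverts G)"
    using pair_graphD(2)[OF assms(1)] by induction (auto intro: converse_rtrancl_into_rtrancl)
qed

lemma card_ccs_connected:
  assumes "W \<noteq> {}" "\<And>a b. a \<in> W \<Longrightarrow> b \<in> W \<Longrightarrow> (a, b) \<in> conn F W"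
  shows "card (ccs F W) = 1"
proof -
  obtain a where a: "a \<in> W" using assms(1) by blast
  have "conn F W `` {b} = W" if "b \<in> W" for b using assms(2) conn_closed[of b _ F W] that by blast
  then have "ccs F W = {W}" using a by (auto simp: ccs_def)
  then show ?thesis by simp
qed

lemma ex_neighbour:
  assumes "(a, b) \<in> conn F V" "a \<noteq> b"
  shows "\<exists>c. (a, c) \<in> F"
  using assms by (induction rule: converse_rtrancl_induct) auto

text \<open>A separating set of minimal size is a cut set.\<close>

lemma ex_cutset_of_nonadjacent:
  assumes V: "finite V" and F: "sym F" and conn: "\<And>a b. a \<in> V \<Longrightarrow> b \<in> V \<Longrightarrow> (a, b) \<in> conn F V"
    and ab: "a \<in> V" "b \<in> V" "a \<noteq> b" "(a, b) \<notin> F"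
  obtains T where "cutset F V T" "T \<noteq> {}" "card (ccs F (V - T)) \<ge> 2"
proof -
  \<comment> \<open>Requiring \<open>T\<close> to avoid \<open>a\<close> and \<open>b\<close> keeps
    both vertices in \<open>V - T\<close>. Such a \<open>T\<close> exists: \<open>V - {a, b}\<close>
    works because \<open>a\<close> and \<open>b\<close> are not adjacent.\<close>
  define Q where "Q T \<longleftrightarrow> T \<subseteq> V - {a, b} \<and> (a, b) \<notin> conn F (V - T)" for T
  have "k = a" if "(a, k) \<in> conn F {a, b}" for k
    using that by (induction rule: rtrancl_induct) (use ab in auto)
  then have "(a, b) \<notin> conn F {a, b}" using ab(3) by blast
  moreover have "V - (V - {a, b}) = {a, b}" using ab by blast
  ultimately have "Q (V - {a, b})" unfolding Q_def by simp
  then obtain T where T: "Q T" and min: "\<And>T'. Q T' \<Longrightarrow> card T \<le> card T'"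
    using exists_least_lemma[of "\<lambda>k. \<exists>T. Q T \<and> card T = k"] ex_has_least_nat[of Q _ card] by blast
  have abT: "a \<in> V - T" "b \<in> V - T" "(a, b) \<notin> conn F (V - T)" and TV: "T \<subseteq> V"
    using T ab by (auto simp: Q_def)
  have fT: "finite T" using TV V finite_subset by blast
  have "cutset F V T"
    unfolding cutset_def
  proof (intro conjI ballI)
    fix v assume v: "v \<in> T"
    show "\<exists>a\<in>V - T. \<exists>b\<in>V - T. (v, a) \<in> F \<and> (v, b) \<in> F \<and> (a, b) \<notin> conn F (V - T)"
    proof (rule ccontr)
      assume no: "\<not> ?thesis"
      have W: "V - (T - {v}) = insert v (V - T)" using v TV by blast
      \<comment> \<open>By minimality, returning \<open>v\<close> reconnects \<open>a\<close> and
        \<open>b\<close>. If \<open>v\<close> had neighbours in only one component, the connection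
        could bypass \<open>v\<close>.\<close>
      have "\<not> Q (T - {v})" using min[of "T - {v}"] card_Diff1_less[OF fT v] by linarith
      then have c: "(a, b) \<in> conn F (insert v (V - T))" using T unfolding Q_def W by blast
      have "(a, b) \<in> conn F (V - T)"
        by (rule conn_insert_restrict[OF F _ _ c abT(1,2)]) (use no v in blast)+
      then show False using abT(3) by blast
    qed
  qed (fact TV)
  moreover have "T \<noteq> {}" using abT conn[OF ab(1,2)] by auto
  moreover have "{conn F (V - T) `` {a}, conn F (V - T) `` {b}} \<subseteq> ccs F (V - T)"
    using abT by (auto simp: ccs_def)
  then have "card {conn F (V - T) `` {a}, conn F (V - T) `` {b}} \<le> card (ccs F (V - T))"
    using V by (intro card_mono) auto
  then have "card (ccs F (V - T)) \<ge> 2" using conn_class_eq_iff[OF F, of "V - T" a b] abT(3) by simp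
  ultimately show thesis using that by blast
qed

section \<open>Binomial edge ideals and joins\<close>

lemma edge_binomial_carrier:
  assumes "i \<in> A" "i' \<in> A" "j \<in> B" "j' \<in> B"
  shows "(edge_binomial (i, i') (j, j') :: ('a \<times> 'b, 'k::field) mpoly) \<in> poly_carrier (A \<times> B)"
  unfolding edge_binomial_def using assms by (auto intro!: carrier_diff carrier_mult)

text \<open>Reversing an edge of either graph only changes the sign of the binomial, so the
  orientation in the generators does not matter and the vertex orders disappear from here
  on.\<close>

lemma
  fixes G\<^sub>1 :: "'a::linorder pair_pre_digraph" and G\<^sub>2 :: "'b::linorder pair_pre_digraph"
  assumes G: "pair_graph G\<^sub>1" "pair_graph G\<^sub>2"
  defines "A \<equiv> pverts G\<^sub>1 \<times> pverts G\<^sub>2"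
    and "B \<equiv> {edge_binomial e f | e f. e \<in> parcs G\<^sub>1 \<and> f \<in> parcs G\<^sub>2} :: ('a \<times> 'b, 'k::field) mpoly set"
  defines "J \<equiv> binomial_edge_ideal G\<^sub>1 G\<^sub>2 :: ('a \<times> 'b, 'k) mpoly set"
  shows ideal_binomial_edge_ideal: "ideal J (poly_ring A :: ('a \<times> 'b, 'k) mpoly ring)"
    and edge_binomials_in_binomial_edge_ideal: "B \<subseteq> J"
    and binomial_edge_ideal_subset:
      "ideal I (poly_ring A :: ('a \<times> 'b, 'k) mpoly ring) \<Longrightarrow> B \<subseteq> I \<Longrightarrow> J \<subseteq> I"
proof -
  let ?S = "{edge_binomial (i, j) (t, l) | i j t l. (i, j) \<in> parcs G\<^sub>1 \<and> i < j \<and> (t, l) \<in> parcs G\<^sub>2 \<and> t < l}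
    :: ('a \<times> 'b, 'k) mpoly set"
  have J: "J = Idl\<^bsub>poly_ring A\<^esub> ?S"
    unfolding J_def binomial_edge_ideal_def pair_ring_def A_def ..
  have BA: "B \<subseteq> poly_carrier A"
    unfolding B_def A_def using pair_graphD(2)[OF G(1)] pair_graphD(2)[OF G(2)]
    by (auto intro!: edge_binomial_carrier)
  have SB: "?S \<subseteq> B" unfolding B_def by blast
  then have SA: "?S \<subseteq> poly_carrier A" using BA by blast
  note gen = genideal_poly[OF SA, folded J]
  show id: "ideal J (poly_ring A :: ('a \<times> 'b, 'k) mpoly ring)" by (rule gen(1))
  show "ideal I (poly_ring A :: ('a \<times> 'b, 'k) mpoly ring) \<Longrightarrow> B \<subseteq> I \<Longrightarrow> J \<subseteq> I"
    using gen(3) SB by blast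
  have "edge_binomial (i, j) (t, l) \<in> J" if e: "(i, j) \<in> parcs G\<^sub>1" "(t, l) \<in> parcs G\<^sub>2" for i j t l
  proof -
    have ne: "i \<noteq> j" "t \<noteq> l" using e pair_graphD(4)[OF G(1)] pair_graphD(4)[OF G(2)] by blast+
    have e': "(j, i) \<in> parcs G\<^sub>1" "(l, t) \<in> parcs G\<^sub>2"
      using e pair_graphD(3)[OF G(1)] pair_graphD(3)[OF G(2)] by (auto dest: symD)
    have S: "edge_binomial (i', j') (t', l') \<in> J"
      if "(i', j') \<in> parcs G\<^sub>1" "(t', l') \<in> parcs G\<^sub>2" "i' < j'" "t' < l'" for i' j' t' l'
      using gen(2) that by blast
    have swap1: "edge_binomial (i, j) (t, l) = - (edge_binomial (j, i) (t, l) :: ('a \<times> 'b, 'k) mpoly)"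
      and swap2: "edge_binomial (i, j) (t, l) = - (edge_binomial (i, j) (l, t) :: ('a \<times> 'b, 'k) mpoly)"
      and swap3: "edge_binomial (i, j) (t, l) = (edge_binomial (j, i) (l, t) :: ('a \<times> 'b, 'k) mpoly)"
      by (simp_all add: edge_binomial_def mult.commute)
    consider "i < j" "t < l" | "i < j" "l < t" | "j < i" "t < l" | "j < i" "l < t" using ne by fastforce
    then show ?thesis
    proof cases
      case 1 then show ?thesis using S e by blast
    next
      case 2 then show ?thesis unfolding swap2 using S e e' by (intro ideal_uminus[OF id]) blast
    next
      case 3 then show ?thesis unfolding swap1 using S e e' by (intro ideal_uminus[OF id]) blast
    next
      case 4 then show ?thesis unfolding swap3 using S e' by blast
    qed
  qed
  then show "B \<subseteq> J" unfolding B_def by auto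
qed

section \<open>The two readings of the matrix of variables\<close>

lemma variable_matrix_pair: "finite R \<Longrightarrow> finite C \<Longrightarrow> variable_matrix (\<lambda>i j. (i, j)) fst snd R C"
  by (simp add: variable_matrix_def)

lemma variable_matrix_transposed: "finite R \<Longrightarrow> finite C \<Longrightarrow> variable_matrix (\<lambda>j i. (i, j)) snd fst R C"
  by (simp add: variable_matrix_def)

lemma vars_pair: "finite R \<Longrightarrow> finite C \<Longrightarrow> variable_matrix.vars (\<lambda>i j. (i, j)) R C = R \<times> C"
  by (auto simp: variable_matrix.vars_def[OF variable_matrix_pair])

lemma vars_transposed: "finite R \<Longrightarrow> finite C \<Longrightarrow> variable_matrix.vars (\<lambda>j i. (i, j)) R C = C \<times> R"
  by (auto simp: variable_matrix.vars_def[OF variable_matrix_transposed])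

lemma generated_by_minors_pair:
  fixes G\<^sub>1 :: "'a::linorder pair_pre_digraph" and G\<^sub>2 :: "'b::linorder pair_pre_digraph"
  assumes G: "pair_graph G\<^sub>1" "pair_graph G\<^sub>2"
  shows "variable_matrix.generated_by_minors (\<lambda>i j. (i, j)) (pverts G\<^sub>1) (pverts G\<^sub>2) (parcs G\<^sub>1) (parcs G\<^sub>2)
    (binomial_edge_ideal G\<^sub>1 G\<^sub>2 :: ('a \<times> 'b, 'k::field) mpoly set)"
proof -
  note fin = pair_graphD(1)[OF G(1)] pair_graphD(1)[OF G(2)]
  note vm = variable_matrix_pair[OF fin]
  have minors: "variable_matrix.edge_minors (\<lambda>i j. (i, j)) (parcs G\<^sub>1) (parcs G\<^sub>2) =
      ({edge_binomial e f | e f. e \<in> parcs G\<^sub>1 \<and> f \<in> parcs G\<^sub>2} :: ('a \<times> 'b, 'k) mpoly set)"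
    unfolding variable_matrix.edge_minors_def[OF vm] variable_matrix.minor_def[OF vm] edge_binomial_def
    by (force split: prod.splits)
  show ?thesis
    unfolding variable_matrix.generated_by_minors_def[OF vm] vars_pair[OF fin]
      minors
    by (intro conjI allI impI pair_graphD(2)[OF G(1)] pair_graphD(2)[OF G(2)] ideal_binomial_edge_ideal[OF G]
      edge_binomials_in_binomial_edge_ideal[OF G] binomial_edge_ideal_subset[OF G])
qed

lemma generated_by_minors_transposed:
  fixes G\<^sub>1 :: "'a::linorder pair_pre_digraph" and G\<^sub>2 :: "'b::linorder pair_pre_digraph"
  assumes G: "pair_graph G\<^sub>1" "pair_graph G\<^sub>2"
  shows "variable_matrix.generated_by_minors (\<lambda>j i. (i, j)) (pverts G\<^sub>2) (pverts G\<^sub>1) (parcs G\<^sub>2) (parcs G\<^sub>1)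
    (binomial_edge_ideal G\<^sub>1 G\<^sub>2 :: ('a \<times> 'b, 'k::field) mpoly set)"
proof -
  note fin = pair_graphD(1)[OF G(2)] pair_graphD(1)[OF G(1)]
  note vm = variable_matrix_transposed[OF fin]
  have eq: "variable_matrix.minor (\<lambda>j i. (i, j)) j j' i i' = (edge_binomial (i, i') (j, j') :: ('a \<times> 'b, 'k) mpoly)"
    for i i' j j'
    unfolding variable_matrix.minor_def[OF vm] edge_binomial_def by (simp add: mult.commute)
  have minors: "variable_matrix.edge_minors (\<lambda>j i. (i, j)) (parcs G\<^sub>2) (parcs G\<^sub>1) =
      ({edge_binomial e f | e f. e \<in> parcs G\<^sub>1 \<and> f \<in> parcs G\<^sub>2} :: ('a \<times> 'b, 'k) mpoly set)"
    unfolding variable_matrix.edge_minors_def[OF vm] eq by force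
  show ?thesis
    unfolding variable_matrix.generated_by_minors_def[OF vm] vars_transposed[OF fin]
      minors
    by (intro conjI allI impI pair_graphD(2)[OF G(1)] pair_graphD(2)[OF G(2)] ideal_binomial_edge_ideal[OF G]
      edge_binomials_in_binomial_edge_ideal[OF G] binomial_edge_ideal_subset[OF G])
qed

context variable_matrix
begin

lemma height_conn_rep:
  assumes "sym F" "T \<subseteq> C" "R \<noteq> {}"
  shows "prime_height (poly_ring vars) (block_prime T (conn_rep F (C - T)) :: ('x, 'k::field) mpoly set) =
    enat (card T + (card R - 1) * (card C - card (ccs F (C - T))))"
  unfolding card_conn_rep_image[OF assms(1), symmetric]
  by (rule block_prime_height[OF assms(2,3)]) (simp_all only: conn_rep_in conn_rep_idem[OF assms(1)])

lemma associated_of_cutset: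
  fixes J :: "('x, 'k::field) mpoly set"
  assumes J: "generated_by_minors E F J" and F: "sym F" and T: "cutset F C T"
    and E: "\<And>i i'. i \<in> R \<Longrightarrow> i' \<in> R \<Longrightarrow> (i, i') \<in> conn E R" and R: "card R \<ge> 2"
    and irrefl: "\<And>i. (i, i) \<notin> E"
  shows "block_prime T (conn_rep F (C - T)) \<in> associated_primes (poly_ring vars) J"
proof (rule block_prime_associated[OF J])
  show "separates F T (conn_rep F (C - T))"
    by (simp add: separates_def conn_rep_eq_iff[OF F])
  show "T \<subseteq> C" using T by (simp add: cutset_def)
  show "(i, i') \<in> E\<^sup>*" if "i \<in> R" "i' \<in> R" for i i'
    using E[OF that] by (rule rtrancl_mono[THEN subsetD, rotated]) auto
  show "\<exists>i'. (i, i') \<in> E \<and> i' \<noteq> i" if i: "i \<in> R" for i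
  proof -
    have "R \<noteq> {i}" using R by auto
    then obtain k where "k \<in> R" "k \<noteq> i" using i by blast
    then show ?thesis using ex_neighbour[OF E[OF i]] irrefl by metis
  qed
  show "\<exists>a\<in>C - T. \<exists>b\<in>C - T. (v, a) \<in> F \<and> (v, b) \<in> F \<and> conn_rep F (C - T) a \<noteq> conn_rep F (C - T) b"
    if "v \<in> T" for v
    using T that by (simp add: cutset_def conn_rep_eq_iff[OF F])
qed

end

section \<open>Numerical criteria for unmixedness\<close>

lemma cutset_empty: "cutset F V {}"
  by (simp add: cutset_def)

text \<open>The empty set is a cut set, so it is enough to compare each height with that of its
  prime, which is (m - 1)(n - 1) for n vertices of \<open>G\<close>. Equality of |T| + (m - 1)(n -
  c(T)) with this number is the condition on \<open>T\<close>.\<close>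

lemma unmixed_complete_iff:
  fixes G\<^sub>1 :: "'a::linorder pair_pre_digraph" and G :: "'b::linorder pair_pre_digraph"
  assumes G\<^sub>1: "pair_graph G\<^sub>1" and complete: "\<And>i i'. i \<in> pverts G\<^sub>1 \<Longrightarrow> i' \<in> pverts G\<^sub>1 \<Longrightarrow> i \<noteq> i' \<Longrightarrow> (i, i') \<in> parcs G\<^sub>1"
    and m: "2 \<le> card (pverts G\<^sub>1)"
    and G: "pair_graph G" and c: "pverts G \<noteq> {}"
      "\<And>a b. a \<in> pverts G \<Longrightarrow> b \<in> pverts G \<Longrightarrow> (a, b) \<in> conn (parcs G) (pverts G)"
  shows "J_unmixed TYPE('k::field) G\<^sub>1 G \<longleftrightarrow>
    (\<forall>T. cutset (parcs G) (pverts G) T \<longrightarrow>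
      (int (card (ccs (parcs G) (pverts G - T))) - 1) * (int (card (pverts G\<^sub>1)) - 1) = int (card T))"
proof -
  let ?R = "pverts G\<^sub>1" and ?C = "pverts G" and ?F = "parcs G"
  let ?J = "binomial_edge_ideal G\<^sub>1 G :: ('a \<times> 'b, 'k) mpoly set"
  note fin = pair_graphD(1)[OF G\<^sub>1] pair_graphD(1)[OF G]
  interpret variable_matrix "\<lambda>(i::'a) (j::'b). (i, j)" fst snd ?R ?C
    by (rule variable_matrix_pair[OF fin])
  note F = pair_graphD(3)[OF G]
  have ring: "pair_ring G\<^sub>1 G = (poly_ring vars :: ('a \<times> 'b, 'k) mpoly ring)"
    by (simp add: pair_ring_def vars_pair[OF fin])
  have J: "generated_by_minors (parcs G\<^sub>1) ?F ?J" by (rule generated_by_minors_pair[OF G\<^sub>1 G])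
  have R: "?R \<noteq> {}" using m by auto
  let ?\<rho> = "\<lambda>T. conn_rep ?F (?C - T)"
  let ?P = "\<lambda>T. block_prime T (?\<rho> T) :: ('a \<times> 'b, 'k) mpoly set"
  let ?c = "\<lambda>T. card (ccs ?F (?C - T))"
  have conn: "(i, i') \<in> conn (parcs G\<^sub>1) ?R" if "i \<in> ?R" "i' \<in> ?R" for i i'
    using complete[OF that] that by (cases "i = i'") (auto intro: conn_edge)
  have "?P T \<in> associated_primes (poly_ring vars) ?J" if "cutset ?F ?C T" for T
    by (rule associated_of_cutset[OF J F that conn m pair_graphD(4)[OF G\<^sub>1]])
  moreover have "\<exists>T. cutset ?F ?C T \<and> P = ?P T" if P: "P \<in> associated_primes (poly_ring vars) ?J" for P
  proof -
    have sep: "separates ?F T (?\<rho> T)" for T by (simp add: separates_def conn_rep_eq_iff[OF F])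
    obtain T where T: "T \<subseteq> ?C" "P = ?P T"
      "\<And>v. v \<in> T \<Longrightarrow> \<exists>a\<in>?C - T. \<exists>b\<in>?C - T. (v, a) \<in> ?F \<and> (v, b) \<in> ?F \<and> ?\<rho> T a \<noteq> ?\<rho> T b"
      using associated_prime_is_block_prime[OF J complete R _ F P, of ?\<rho>] sep by blast
    then have "cutset ?F ?C T" by (simp add: cutset_def conn_rep_eq_iff[OF F])
    then show ?thesis using T by blast
  qed
  ultimately have "associated_primes (poly_ring vars) ?J = ?P ` {T. cutset ?F ?C T}" by blast
  then have "J_unmixed TYPE('k) G\<^sub>1 G \<longleftrightarrow> (\<forall>T\<in>{T. cutset ?F ?C T}. \<forall>T'\<in>{T. cutset ?F ?C T}.
      prime_height (poly_ring vars) (?P T) = prime_height (poly_ring vars) (?P T'))"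
    unfolding J_unmixed_def unmixed_ideal_def ring by (simp only: ball_simps)
  also have "\<dots> \<longleftrightarrow> (\<forall>T\<in>{T. cutset ?F ?C T}.
      prime_height (poly_ring vars) (?P T) = prime_height (poly_ring vars) (?P {}))"
    using cutset_empty[of ?F ?C] by (metis mem_Collect_eq)
  also have "\<dots> \<longleftrightarrow> (\<forall>T. cutset ?F ?C T \<longrightarrow> (int (?c T) - 1) * (int (card ?R) - 1) = int (card T))"
  proof -
    have "prime_height (poly_ring vars) (?P T) = prime_height (poly_ring vars) (?P {}) \<longleftrightarrow>
        (int (?c T) - 1) * (int (card ?R) - 1) = int (card T)" if T: "cutset ?F ?C T" for T
    proof -
      have TC: "T \<subseteq> ?C" using T by (simp add: cutset_def)
      have c1: "?c {} = 1" using card_ccs_connected[OF c] by simp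
      have C1: "card ?C \<ge> 1" using c(1) fin by (simp add: Suc_le_eq card_gt_0_iff)
      have "?c T \<le> card (?C - T)" using fin by (intro card_ccs_le) auto
      also have "\<dots> \<le> card ?C" using fin by (intro card_mono) auto
      finally have cT: "?c T \<le> card ?C" .
      have "prime_height (poly_ring vars) (?P T) = prime_height (poly_ring vars) (?P {}) \<longleftrightarrow>
          card T + (card ?R - 1) * (card ?C - ?c T) = (card ?R - 1) * (card ?C - 1)"
        using height_conn_rep[OF F TC R, where 'k = 'k] height_conn_rep[OF F empty_subsetI R, where 'k = 'k] c1 by simp
      \<comment> \<open>Passing to integers is safe: m >= 2, \<open>G\<close> has a vertex, and c(T)
        is at most the number of vertices of \<open>G\<close>.\<close>
      also have "\<dots> \<longleftrightarrow> int (card T + (card ?R - 1) * (card ?C - ?c T)) = int ((card ?R - 1) * (card ?C - 1))"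
        by (simp only: of_nat_eq_iff)
      also have "\<dots> \<longleftrightarrow> (int (?c T) - 1) * (int (card ?R) - 1) = int (card T)"
        using m C1 cT by (simp add: of_nat_diff) (auto simp: algebra_simps)
      finally show ?thesis .
    qed
    then show ?thesis by blast
  qed
  finally show ?thesis .
qed

text \<open>The transposed matrix is used: rows are the vertices of \<open>G\<close>, and cut sets
  are taken in the first graph. The empty set and a separator \<open>T\<close> of two non-adjacent
  vertices both give associated primes; equating their heights yields the impossible size of
  \<open>T\<close>.\<close>

lemma unmixed_imp_complete:
  fixes G\<^sub>1 :: "'a::linorder pair_pre_digraph" and G :: "'b::linorder pair_pre_digraph"
  assumes G\<^sub>1: "pair_graph G\<^sub>1" "Digraph_Component.connected (with_proj G\<^sub>1)"
    and G: "pair_graph G" "\<And>j j'. j \<in> pverts G \<Longrightarrow> j' \<in> pverts G \<Longrightarrow> (j, j') \<in> conn (parcs G) (pverts G)"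
    and card: "2 \<le> card (pverts G\<^sub>1)" "card (pverts G\<^sub>1) \<le> card (pverts G)"
    and un: "J_unmixed TYPE('k::field) G\<^sub>1 G"
    and ii': "i \<in> pverts G\<^sub>1" "i' \<in> pverts G\<^sub>1" "i \<noteq> i'"
  shows "(i, i') \<in> parcs G\<^sub>1"
proof (rule ccontr)
  assume no: "(i, i') \<notin> parcs G\<^sub>1"
  let ?R = "pverts G" and ?C = "pverts G\<^sub>1" and ?F = "parcs G\<^sub>1"
  let ?J = "binomial_edge_ideal G\<^sub>1 G :: ('a \<times> 'b, 'k) mpoly set"
  note fin = pair_graphD(1)[OF G(1)] pair_graphD(1)[OF G\<^sub>1(1)]
  note F = pair_graphD(3)[OF G\<^sub>1(1)]
  note conn = connected_imp_conn[OF G\<^sub>1]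
  interpret variable_matrix "\<lambda>(j::'b) (i::'a). (i, j)" snd fst ?R ?C
    by (rule variable_matrix_transposed[OF fin])
  have ring: "pair_ring G\<^sub>1 G = (poly_ring vars :: ('a \<times> 'b, 'k) mpoly ring)"
    by (simp add: pair_ring_def vars_transposed[OF fin])
  have J: "generated_by_minors (parcs G) ?F ?J" by (rule generated_by_minors_transposed[OF G\<^sub>1(1) G(1)])
  have R: "card ?R \<ge> 2" using card by simp
  then have R': "?R \<noteq> {}" by auto
  let ?P = "\<lambda>T. block_prime T (conn_rep ?F (?C - T)) :: ('a \<times> 'b, 'k) mpoly set"
  let ?c = "\<lambda>T. card (ccs ?F (?C - T))"
  obtain T where T: "cutset ?F ?C T" "T \<noteq> {}" "2 \<le> ?c T"
    by (rule ex_cutset_of_nonadjacent[OF fin(2) F conn(2) ii' no])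
  have TC: "T \<subseteq> ?C" using T by (simp add: cutset_def)
  have ass: "?P T \<in> associated_primes (pair_ring G\<^sub>1 G) ?J" if "cutset ?F ?C T" for T
    unfolding ring by (rule associated_of_cutset[OF J F that G(2) R pair_graphD(4)[OF G(1)]])
  have "prime_height (poly_ring vars) (?P T) = prime_height (poly_ring vars) (?P {})"
    using un ass[OF T(1)] ass[OF cutset_empty] unfolding J_unmixed_def unmixed_ideal_def ring by blast
  moreover have "?c {} = 1" using card_ccs_connected[OF conn] by simp
  ultimately have eq: "card T + (card ?R - 1) * (card ?C - ?c T) = (card ?R - 1) * (card ?C - 1)"
    using height_conn_rep[OF F TC R', where 'k = 'k] height_conn_rep[OF F empty_subsetI R', where 'k = 'k] by simp
  have "?c T \<le> card (?C - T)" using fin by (intro card_ccs_le) auto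
  also have "\<dots> = card ?C - card T" using TC fin finite_subset by (intro card_Diff_subset) auto
  finally have le: "?c T + card T \<le> card ?C" using card_mono[OF fin(2) TC] by simp
  have "(card ?R - 1) * (card ?C - ?c T) + (card ?R - 1) * (?c T - 1) = (card ?R - 1) * (card ?C - 1)"
    using le T(3) by (simp add: distrib_left[symmetric])
  then have "card T = (card ?R - 1) * (?c T - 1)" using eq by simp
  moreover have "1 \<le> ?c T - 1" using T(3) by linarith
  then have "card ?R - 1 \<le> (card ?R - 1) * (?c T - 1)"
    using mult_le_mono2[of 1 "?c T - 1" "card ?R - 1"] by (simp only: mult_1_right)
  ultimately show False using le T(3) card by linarith
qed

section \<open>Cut sets of a join\<close>

locale graph_join_parts =
  fixes VH :: "'v set" and FH :: "('v \<times> 'v) set" and K :: "'i set" and V :: "'i \<Rightarrow> 'v set"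
    and E :: "'i \<Rightarrow> ('v \<times> 'v) set"
  assumes FH: "FH \<subseteq> VH \<times> VH" and E: "\<And>k. k \<in> K \<Longrightarrow> E k \<subseteq> V k \<times> V k"
    and disj: "\<And>k. k \<in> K \<Longrightarrow> VH \<inter> V k = {}" "\<And>k l. k \<in> K \<Longrightarrow> l \<in> K \<Longrightarrow> k \<noteq> l \<Longrightarrow> V k \<inter> V l = {}"
    and fin: "finite K" "finite VH" "\<And>k. k \<in> K \<Longrightarrow> finite (V k)"
    and ne: "VH \<noteq> {}" "\<And>k. k \<in> K \<Longrightarrow> V k \<noteq> {}"
    and conn_H: "\<And>a b. a \<in> VH \<Longrightarrow> b \<in> VH \<Longrightarrow> (a, b) \<in> conn FH VH"
    and card_K: "2 \<le> card K"
begin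

definition D :: "'v set" where
  "D = (\<Union>k\<in>K. V k)"

definition F :: "('v \<times> 'v) set" where
  "F = FH \<union> (\<Union>k\<in>K. E k) \<union> VH \<times> D \<union> D \<times> VH"

lemma VH_D: "VH \<inter> D = {}"
  using disj(1) by (auto simp: D_def)

lemma finite_D: "finite D"
  using fin by (simp add: D_def)

text \<open>Every vertex of \<open>VH\<close> is adjacent to every vertex of \<open>D\<close>, so
  \<open>x\<close> and \<open>y\<close> link any two vertices of \<open>W\<close>. Consequently a
  nonempty cut set contains all of \<open>VH\<close> or all of \<open>D\<close>.\<close>

lemma conn_both:
  assumes "W \<subseteq> VH \<union> D" "x \<in> W \<inter> VH" "y \<in> W \<inter> D" "a \<in> W" "b \<in> W"
  shows "(a, b) \<in> conn F W"
proof -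
  have HD: "(u, v) \<in> conn F W" "(v, u) \<in> conn F W" if "u \<in> W \<inter> VH" "v \<in> W \<inter> D" for u v
    using that by (auto intro!: conn_edge simp: F_def)
  have "(a, x) \<in> conn F W"
    using assms HD[of a y] HD[of x y] HD[of x a] conn_trans[of a y F W x] by blast
  moreover have "(x, b) \<in> conn F W"
    using assms HD[of b y] HD[of x y] HD[of x b] conn_trans[of x y F W b] by blast
  ultimately show ?thesis by (rule conn_trans)
qed

lemma conn_in_H:
  assumes "W \<subseteq> VH"
  shows "conn F W = conn FH W"
proof -
  have "(\<Union>k\<in>K. E k) \<subseteq> D \<times> D" unfolding D_def using E by blast
  then have "F \<inter> W \<times> W = FH \<inter> W \<times> W"
    using assms VH_D unfolding F_def by blast
  then show ?thesis by simp
qed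

lemma conn_in_D:
  assumes W: "W \<subseteq> D" and k: "k \<in> K" "a \<in> W \<inter> V k"
  shows "(a, b) \<in> conn F W \<longleftrightarrow> (a, b) \<in> conn (E k) (W \<inter> V k)"
proof
  assume "(a, b) \<in> conn (E k) (W \<inter> V k)"
  then show "(a, b) \<in> conn F W"
    by (rule conn_mono[rotated 2]) (use k in \<open>auto simp: F_def\<close>)
next
  assume "(a, b) \<in> conn F W"
  then show "(a, b) \<in> conn (E k) (W \<inter> V k)"
  proof (induction rule: rtrancl_induct)
    case base
    then show ?case by simp
  next
    case (step b c)
    have b: "b \<in> W \<inter> V k" using conn_closed[OF step.IH k(2)] .
    have bc: "(b, c) \<in> F" "b \<in> D" "c \<in> D" using step.hyps(2) W by auto
    then obtain l where l: "l \<in> K" "(b, c) \<in> E l" using VH_D FH by (auto simp: F_def)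
    then have "l = k" using E[OF l(1)] b disj(2)[OF l(1) k(1)] by blast
    then have "(b, c) \<in> E k \<inter> (W \<inter> V k) \<times> (W \<inter> V k)" using l E[OF k(1)] b step.hyps(2) by auto
    with step.IH show ?case by (rule rtrancl_into_rtrancl)
  qed
qed

lemma card_ccs_in_D:
  assumes "W \<subseteq> D"
  shows "card (ccs F W) = (\<Sum>k\<in>K. card (ccs (E k) (W \<inter> V k)))"
proof -
  have W: "W = (\<Union>k\<in>K. W \<inter> V k)" using assms by (auto simp: D_def)
  have "conn F W `` {a} = conn (E k) (W \<inter> V k) `` {a}" if "k \<in> K" "a \<in> W \<inter> V k" for k a
    using conn_in_D[OF assms that] by auto
  then have "ccs (E k) (W \<inter> V k) = (\<lambda>a. conn F W `` {a}) ` (W \<inter> V k)" if "k \<in> K" for k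
    unfolding ccs_def using that by (intro image_cong) auto
  then have "(\<Union>k\<in>K. ccs (E k) (W \<inter> V k)) = (\<lambda>a. conn F W `` {a}) ` (\<Union>k\<in>K. W \<inter> V k)"
    unfolding image_UN by simp
  then have "ccs F W = (\<Union>k\<in>K. ccs (E k) (W \<inter> V k))" unfolding ccs_def[of F W] using W by simp
  moreover have "card (\<Union>k\<in>K. ccs (E k) (W \<inter> V k)) = (\<Sum>k\<in>K. card (ccs (E k) (W \<inter> V k)))"
  proof (rule card_UN_disjoint)
    have sub: "S \<subseteq> V k" "S \<noteq> {}" if S: "S \<in> ccs (E k) (W \<inter> V k)" for k S
    proof -
      obtain a where a: "a \<in> W \<inter> V k" "S = conn (E k) (W \<inter> V k) `` {a}" using S by (auto simp: ccs_def)
      then show "S \<subseteq> V k" using conn_closed[of a _ "E k" "W \<inter> V k"] by blast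
      show "S \<noteq> {}" using a(2) by auto
    qed
    show "\<forall>k\<in>K. \<forall>l\<in>K. k \<noteq> l \<longrightarrow> ccs (E k) (W \<inter> V k) \<inter> ccs (E l) (W \<inter> V l) = {}"
    proof (intro ballI impI equals0I)
      fix k l S assume kl: "k \<in> K" "l \<in> K" "k \<noteq> l"
        and S: "S \<in> ccs (E k) (W \<inter> V k) \<inter> ccs (E l) (W \<inter> V l)"
      then have "S \<subseteq> V k \<inter> V l" "S \<noteq> {}" using sub by blast+
      then show False using disj(2)[OF kl] by blast
    qed
  qed (use fin in auto)
  ultimately show ?thesis by simp
qed

text \<open>By \<open>conn_both\<close> the remaining vertices lie on one side. If they lie in
  \<open>D\<close>, a removed vertex of \<open>V k\<close> sees only remaining vertices of
  \<open>V k\<close>, so the cut condition splits over the parts. If they lie in \<open>VH\<close>,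
  it restricts to \<open>H\<close>.\<close>

lemma cutset_join_cases:
  assumes T: "cutset F (VH \<union> D) T"
  obtains "T = {}"
    | T1 where "T = D \<union> T1" "cutset FH VH T1" "T1 \<noteq> {}"
    | Tk where "T = VH \<union> (\<Union>k\<in>K. Tk k)" "\<And>k. k \<in> K \<Longrightarrow> cutset (E k) (V k) (Tk k)"
proof -
  let ?W = "VH \<union> D - T"
  have TV: "T \<subseteq> VH \<union> D" and
    cut: "\<And>v. v \<in> T \<Longrightarrow> \<exists>a\<in>?W. \<exists>b\<in>?W. (v, a) \<in> F \<and> (v, b) \<in> F \<and> (a, b) \<notin> conn F ?W"
    using T by (auto simp: cutset_def)
  consider "T = {}" | "T \<noteq> {}" "VH \<subseteq> T" | "T \<noteq> {}" "D \<subseteq> T" | x y where "T \<noteq> {}" "x \<in> VH - T" "y \<in> D - T" by blast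
  then show thesis
  proof cases
    case 1
    then show ?thesis by (rule that(1))
  next
    case 2
    have W: "?W \<subseteq> D" "?W = D - T" using 2 by auto
    have "cutset (E k) (V k) (T \<inter> V k)" if k: "k \<in> K" for k
      unfolding cutset_def
    proof (intro conjI ballI)
      fix v assume v: "v \<in> T \<inter> V k"
      then obtain a b where ab: "a \<in> ?W" "b \<in> ?W" "(v, a) \<in> F" "(v, b) \<in> F" "(a, b) \<notin> conn F ?W"
        using cut by blast
      have vD: "v \<in> D" using v k by (auto simp: D_def)
      have Ek: "(v, c) \<in> E k" if c: "c \<in> ?W" "(v, c) \<in> F" for c
      proof -
        obtain l where l: "l \<in> K" "(v, c) \<in> E l" using c W VH_D FH vD by (auto simp: F_def)
        then show ?thesis using E[OF l(1)] v disj(2)[OF l(1) k] by blast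
      qed
      have abV: "(v, a) \<in> E k" "(v, b) \<in> E k" "a \<in> V k" "b \<in> V k" using Ek ab E[OF k] by auto
      have "?W \<inter> V k = V k - T \<inter> V k" using W k by (auto simp: D_def)
      then have "(a, b) \<notin> conn (E k) (V k - T \<inter> V k)"
        using ab abV conn_in_D[OF W(1) k, of a b] by auto
      then show "\<exists>a\<in>V k - T \<inter> V k. \<exists>b\<in>V k - T \<inter> V k. (v, a) \<in> E k \<and> (v, b) \<in> E k \<and>
          (a, b) \<notin> conn (E k) (V k - T \<inter> V k)"
        using ab abV by blast
    qed auto
    moreover have "T = VH \<union> (\<Union>k\<in>K. T \<inter> V k)" using 2 TV by (auto simp: D_def)
    ultimately show ?thesis by (rule that(3)[rotated])
  next
    case 3
    have W: "?W \<subseteq> VH" "?W = VH - T \<inter> VH" using 3 by auto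
    note conn_H' = conn_in_H[OF W(1)]
    have "cutset FH VH (T \<inter> VH)"
      unfolding cutset_def
    proof (intro conjI ballI)
      fix v assume v: "v \<in> T \<inter> VH"
      then obtain a b where ab: "a \<in> ?W" "b \<in> ?W" "(v, a) \<in> F" "(v, b) \<in> F" "(a, b) \<notin> conn FH ?W"
        using cut conn_H' by blast
      have "(v, c) \<in> FH" if "c \<in> ?W" "(v, c) \<in> F" for c
        using that W v VH_D E unfolding F_def D_def by blast
      then show "\<exists>a\<in>VH - T \<inter> VH. \<exists>b\<in>VH - T \<inter> VH. (v, a) \<in> FH \<and> (v, b) \<in> FH \<and> (a, b) \<notin> conn FH (VH - T \<inter> VH)"
        using ab unfolding W(2) by blast
    qed auto
    \<comment> \<open>Otherwise the whole connected graph \<open>H\<close> would remain, and no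
      removed vertex could separate anything.\<close>
    moreover have "T \<inter> VH \<noteq> {}"
    proof
      assume e: "T \<inter> VH = {}"
      obtain v where "v \<in> T" using 3 by blast
      then obtain a b where "a \<in> ?W" "b \<in> ?W" "(a, b) \<notin> conn FH ?W" using cut conn_H' by blast
      then show False using conn_H unfolding W(2) e by simp
    qed
    moreover have "T = D \<union> (T \<inter> VH)" using 3 TV by auto
    ultimately show ?thesis by (rule that(2)[rotated])
  next
    case 4
    then obtain v where "v \<in> T" by blast
    then obtain a b where "a \<in> ?W" "b \<in> ?W" "(a, b) \<notin> conn F ?W" using cut by blast
    then show ?thesis using conn_both[of ?W x y a b] 4 by blast
  qed
qed

text \<open>A vertex of \<open>D\<close> is adjacent to all of \<open>VH\<close>, so it inherits the
  two separated vertices belonging to any element of \<open>T\<close>.\<close>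

lemma cutset_join_H:
  assumes T: "cutset FH VH T" "T \<noteq> {}"
  shows "cutset F (VH \<union> D) (D \<union> T)"
  unfolding cutset_def
proof (intro conjI ballI)
  have TV: "T \<subseteq> VH" using T by (simp add: cutset_def)
  then show "D \<union> T \<subseteq> VH \<union> D" by blast
  have W: "VH \<union> D - (D \<union> T) = VH - T" using VH_D by blast
  note c = conn_in_H[of "VH - T", OF Diff_subset]
  fix v assume v: "v \<in> D \<union> T"
  have cut: "\<exists>a\<in>VH - T. \<exists>b\<in>VH - T. (v, a) \<in> FH \<and> (v, b) \<in> FH \<and> (a, b) \<notin> conn FH (VH - T)" if "v \<in> T" for v
    using T(1) that by (simp add: cutset_def)
  show "\<exists>a\<in>VH \<union> D - (D \<union> T). \<exists>b\<in>VH \<union> D - (D \<union> T). (v, a) \<in> F \<and> (v, b) \<in> F \<and>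
      (a, b) \<notin> conn F (VH \<union> D - (D \<union> T))"
    unfolding W c
  proof (cases "v \<in> T")
    case True
    show "\<exists>a\<in>VH - T. \<exists>b\<in>VH - T. (v, a) \<in> F \<and> (v, b) \<in> F \<and> (a, b) \<notin> conn FH (VH - T)"
      using cut[OF True] unfolding F_def by blast
  next
    case False
    then have "v \<in> D" using v by blast
    obtain w where "w \<in> T" using T(2) by blast
    then show "\<exists>a\<in>VH - T. \<exists>b\<in>VH - T. (v, a) \<in> F \<and> (v, b) \<in> F \<and> (a, b) \<notin> conn FH (VH - T)"
      using cut \<open>v \<in> D\<close> unfolding F_def by blast
  qed
qed

lemma cutset_proper:
  assumes "cutset G U T" "U \<noteq> {}"
  shows "U - T \<noteq> {}"
  using assms by (auto simp: cutset_def)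

text \<open>A vertex of \<open>VH\<close> sees the remaining vertices of at least two parts, and
  these lie in different components. No part is used up, since a cut set of a nonempty graph is
  proper.\<close>

lemma cutset_join_D:
  assumes T: "\<And>k. k \<in> K \<Longrightarrow> cutset (E k) (V k) (T k)"
  shows "cutset F (VH \<union> D) (VH \<union> (\<Union>k\<in>K. T k))"
  unfolding cutset_def
proof (intro conjI ballI)
  let ?T = "VH \<union> (\<Union>k\<in>K. T k)" and ?W = "VH \<union> D - (VH \<union> (\<Union>k\<in>K. T k))"
  have TV: "T k \<subseteq> V k" if "k \<in> K" for k using T[OF that] by (simp add: cutset_def)
  then show "?T \<subseteq> VH \<union> D" by (fastforce simp: D_def)
  have W: "?W \<subseteq> D" by blast
  have Wk: "?W \<inter> V k = V k - T k" if k: "k \<in> K" for k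
  proof -
    have "T l \<inter> V k = {}" if "l \<in> K" "l \<noteq> k" for l using TV[OF that(1)] disj(2)[OF that(1) k that(2)] by blast
    then show ?thesis using k disj(1)[OF k] by (auto simp: D_def)
  qed
  fix v assume v: "v \<in> ?T"
  show "\<exists>a\<in>?W. \<exists>b\<in>?W. (v, a) \<in> F \<and> (v, b) \<in> F \<and> (a, b) \<notin> conn F ?W"
  proof (cases "v \<in> VH")
    case True
    obtain k l where kl: "k \<in> K" "l \<in> K" "k \<noteq> l" using card_K card_le_Suc0_iff_eq[OF fin(1)] by fastforce
    obtain a where a: "a \<in> V k - T k" using cutset_proper[OF T[OF kl(1)] ne(2)[OF kl(1)]] by blast
    obtain b where b: "b \<in> V l - T l" using cutset_proper[OF T[OF kl(2)] ne(2)[OF kl(2)]] by blast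
    have aW: "a \<in> ?W \<inter> V k" "b \<in> ?W \<inter> V l" using a b Wk kl by blast+
    have "(a, b) \<notin> conn F ?W"
    proof
      assume "(a, b) \<in> conn F ?W"
      then have "(a, b) \<in> conn (E k) (?W \<inter> V k)" using conn_in_D[OF W kl(1) aW(1)] by blast
      then have "b \<in> V k" using conn_closed[OF _ aW(1)] by blast
      then show False using b disj(2)[OF kl] by blast
    qed
    moreover have "(v, a) \<in> F" "(v, b) \<in> F" using True aW W unfolding F_def by blast+
    ultimately show ?thesis using aW by blast
  next
    case False
    then obtain k where k: "k \<in> K" "v \<in> T k" using v by blast
    then obtain a b where ab: "a \<in> V k - T k" "b \<in> V k - T k" "(v, a) \<in> E k" "(v, b) \<in> E k"
      "(a, b) \<notin> conn (E k) (V k - T k)" using T[OF k(1)] unfolding cutset_def by blast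
    have aW: "a \<in> ?W \<inter> V k" "b \<in> ?W \<inter> V k" using ab Wk k by blast+
    have "(a, b) \<notin> conn F ?W" using conn_in_D[OF W k(1) aW(1)] Wk[OF k(1)] ab(5) by simp
    moreover have "(v, a) \<in> F" "(v, b) \<in> F" using ab k unfolding F_def by blast+
    ultimately show ?thesis using aW by blast
  qed
qed

text \<open>Let c_k be the number of components that T_k leaves in part k, and r the number of
  parts. Since (sum c_k - 1)(m - 1) = sum (c_k - 1)(m - 1) + (r - 1)(m - 1), the equation for
  \<open>VH\<close> together with all T_k is the sum of the equations for the T_k and the equation
  for |VH|. Taking every T_k empty isolates the latter, and changing a single T_k then isolates its
  own equation.\<close>

lemma cutset_condition_join:
  fixes m :: int
  defines "cond \<equiv> \<lambda>(G :: ('v \<times> 'v) set) U T. (int (card (ccs G (U - T))) - 1) * (m - 1) = int (card T)"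
  assumes conn_V: "\<And>k a b. k \<in> K \<Longrightarrow> a \<in> V k \<Longrightarrow> b \<in> V k \<Longrightarrow> (a, b) \<in> conn (E k) (V k)"
  shows "(\<forall>T. cutset F (VH \<union> D) T \<longrightarrow> cond F (VH \<union> D) T) \<longleftrightarrow>
    (\<forall>k\<in>K. \<forall>T. cutset (E k) (V k) T \<longrightarrow> cond (E k) (V k) T) \<and>
    int (card VH) = (int (card K) - 1) * (m - 1) \<and>
    (\<forall>T. cutset FH VH T \<longrightarrow> T \<noteq> {} \<longrightarrow>
      (int (card (ccs FH (VH - T))) - 1) * (m - 1) = int (card T + (\<Sum>k\<in>K. card (V k))))"
proof -
  have card_D: "card D = (\<Sum>k\<in>K. card (V k))"
    unfolding D_def using fin disj(2) by (intro card_UN_disjoint) auto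
  have cond_H: "cond F (VH \<union> D) (D \<union> T) \<longleftrightarrow>
      (int (card (ccs FH (VH - T))) - 1) * (m - 1) = int (card T + (\<Sum>k\<in>K. card (V k)))"
    if T: "cutset FH VH T" for T
  proof -
    have TV: "T \<subseteq> VH" using T by (simp add: cutset_def)
    have "VH \<union> D - (D \<union> T) = VH - T" using VH_D by blast
    moreover have "ccs F (VH - T) = ccs FH (VH - T)"
      unfolding ccs_def conn_in_H[OF Diff_subset] ..
    moreover have "card (D \<union> T) = card D + card T"
      using TV VH_D finite_D finite_subset[OF TV fin(2)] by (intro card_Un_disjoint) auto
    ultimately show ?thesis by (simp add: cond_def card_D add.commute)
  qed
  have cond_D: "cond F (VH \<union> D) (VH \<union> (\<Union>k\<in>K. T k)) \<longleftrightarrow>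
      ((\<Sum>k\<in>K. int (card (ccs (E k) (V k - T k)))) - 1) * (m - 1) = int (card VH) + (\<Sum>k\<in>K. int (card (T k)))"
    if T: "\<And>k. k \<in> K \<Longrightarrow> cutset (E k) (V k) (T k)" for T
  proof -
    let ?W = "VH \<union> D - (VH \<union> (\<Union>k\<in>K. T k))"
    have TV: "T k \<subseteq> V k" if "k \<in> K" for k using T[OF that] by (simp add: cutset_def)
    have Wk: "?W \<inter> V k = V k - T k" if k: "k \<in> K" for k
    proof -
      have "T l \<inter> V k = {}" if "l \<in> K" "l \<noteq> k" for l using TV[OF that(1)] disj(2)[OF that(1) k that(2)] by blast
      then show ?thesis using k disj(1)[OF k] by (auto simp: D_def)
    qed
    have "?W \<subseteq> D" by blast
    then have 1: "card (ccs F ?W) = (\<Sum>k\<in>K. card (ccs (E k) (V k - T k)))"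
      using card_ccs_in_D[of ?W] Wk by simp
    have fT: "finite (T k)" if "k \<in> K" for k using TV fin(3) that finite_subset by blast
    have "card (\<Union>k\<in>K. T k) = (\<Sum>k\<in>K. card (T k))"
      using fin(1) fT TV disj(2) by (intro card_UN_disjoint) blast+
    moreover have "card (VH \<union> (\<Union>k\<in>K. T k)) = card VH + card (\<Union>k\<in>K. T k)"
      using fin fT TV disj(1) by (intro card_Un_disjoint) blast+
    ultimately show ?thesis unfolding cond_def 1 by simp
  qed
  have c_empty: "card (ccs (E k) (V k)) = 1" if "k \<in> K" for k
    using card_ccs_connected[OF ne(2) conn_V] that by blast
  show ?thesis (is "?L \<longleftrightarrow> ?A \<and> ?B \<and> ?C")
  proof
    assume L: ?L
    have B: ?B
      using L cutset_join_D[of "\<lambda>_. {}", OF cutset_empty] cond_D[of "\<lambda>_. {}", OF cutset_empty]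
      by (simp add: c_empty)
    have "cond (E k) (V k) T" if k: "k \<in> K" and T: "cutset (E k) (V k) T" for k T
    proof -
      \<comment> \<open>Each part other than \<open>k\<close> contributes one component and no
        removed vertex.\<close>
      let ?T = "(\<lambda>_. {})(k := T)"
      have cut: "cutset (E l) (V l) (?T l)" if "l \<in> K" for l using T cutset_empty by auto
      have 1: "((\<Sum>l\<in>K. int (card (ccs (E l) (V l - ?T l)))) - 1) * (m - 1) = int (card VH) + (\<Sum>l\<in>K. int (card (?T l)))"
        using L cutset_join_D[OF cut] cond_D[OF cut] by blast
      have 2: "(\<Sum>l\<in>K. int (card (ccs (E l) (V l - ?T l)))) =
          int (card (ccs (E k) (V k - T))) + (int (card K) - 1)"
        using sum.remove[OF fin(1) k, of "\<lambda>l. int (card (ccs (E l) (V l - ?T l)))"] k fin(1) c_empty card_K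
        by (simp add: card_Diff_singleton of_nat_diff)
      have 3: "(\<Sum>l\<in>K. int (card (?T l))) = int (card T)"
        using sum.remove[OF fin(1) k, of "\<lambda>l. int (card (?T l))"] by simp
      show ?thesis using 1 unfolding 2 3 B cond_def by (simp add: algebra_simps)
    qed
    moreover have ?C using L cutset_join_H cond_H by blast
    ultimately show "?A \<and> ?B \<and> ?C" using B by blast
  next
    assume R: "?A \<and> ?B \<and> ?C"
    show ?L
    proof (intro allI impI)
      fix T assume "cutset F (VH \<union> D) T"
      then show "cond F (VH \<union> D) T"
      proof (cases rule: cutset_join_cases)
        \<comment> \<open>The join itself is connected, so both sides of the condition are
          0.\<close>
        case 1
        obtain k where k: "k \<in> K" using card_K by fastforce
        obtain x y where "x \<in> VH" "y \<in> D" using ne k by (fastforce simp: D_def)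
        then have "card (ccs F (VH \<union> D)) = 1" using conn_both[of "VH \<union> D" x y] by (intro card_ccs_connected) auto
        then show ?thesis using 1 by (simp add: cond_def)
      next
        case (2 T1)
        then show ?thesis using R cond_H by blast
      next
        case (3 Tk)
        have "(\<Sum>k\<in>K. (int (card (ccs (E k) (V k - Tk k))) - 1) * (m - 1)) = (\<Sum>k\<in>K. int (card (Tk k)))"
          using R 3(2) by (intro sum.cong refl) (auto simp: cond_def)
        then have "((\<Sum>k\<in>K. int (card (ccs (E k) (V k - Tk k)))) - int (card K)) * (m - 1) = (\<Sum>k\<in>K. int (card (Tk k)))"
          by (simp add: sum_distrib_right[symmetric] sum_subtractf)
        then have "((\<Sum>k\<in>K. int (card (ccs (E k) (V k - Tk k)))) - 1) * (m - 1) = int (card VH) + (\<Sum>k\<in>K. int (card (Tk k)))"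
          using R by (simp add: algebra_simps)
        then show ?thesis unfolding 3(1) using cond_D[of Tk] 3(2) by blast
      qed
    qed
  qed
qed

end

section \<open>Well-formedness of the join and the final equivalence\<close>

lemma pair_graph_join:
  assumes "pair_graph G" "pair_graph G'" "pverts G \<inter> pverts G' = {}"
  shows "pair_graph (graph_join G G')"
proof (rule pair_graphI)
  note g = pair_graphD[OF assms(1)] pair_graphD[OF assms(2)]
  show "finite (pverts (graph_join G G'))" using g by (simp add: graph_join_def)
  show "parcs (graph_join G G') \<subseteq> pverts (graph_join G G') \<times> pverts (graph_join G G')"
    using g(2,6) by (auto simp: graph_join_def)
  show "sym (parcs (graph_join G G'))"
    using g(3,7) unfolding sym_def graph_join_def by auto
  show "(v, v) \<notin> parcs (graph_join G G')" for v
    using g(4,8) assms(3) by (auto simp: graph_join_def)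
qed

lemma pair_graph_disjoint_union:
  assumes "finite I" "\<And>i. i \<in> I \<Longrightarrow> pair_graph (H i)"
  shows "pair_graph (graph_disjoint_union H I)"
proof (rule pair_graphI)
  note g = pair_graphD[OF assms(2)]
  show "finite (pverts (graph_disjoint_union H I))" using g assms(1) by (simp add: graph_disjoint_union_def)
  show "parcs (graph_disjoint_union H I) \<subseteq> pverts (graph_disjoint_union H I) \<times> pverts (graph_disjoint_union H I)"
    using g(2) by (fastforce simp: graph_disjoint_union_def)
  show "sym (parcs (graph_disjoint_union H I))"
    using g(3) unfolding sym_def graph_disjoint_union_def by auto
  show "(v, v) \<notin> parcs (graph_disjoint_union H I)" for v
    using g(4) by (auto simp: graph_disjoint_union_def)
qed

lemma complete_digraph_iff:
  assumes "pair_graph G" "card (pverts G) = m"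
  shows "complete_digraph m (with_proj G) \<longleftrightarrow> (\<forall>u\<in>pverts G. \<forall>v\<in>pverts G. u \<noteq> v \<longrightarrow> (u, v) \<in> parcs G)"
proof -
  interpret pair_graph G by fact
  have "graph (with_proj G)" by unfold_locales
  then show ?thesis
    using pair_graphD(2,4)[OF assms(1)] assms(2) by (auto simp: complete_digraph_def)
qed

theorem theorem4p7:
  fixes G\<^sub>1 :: "'a::linorder pair_pre_digraph"
    and H :: "'b::linorder pair_pre_digraph"
    and Hs :: "nat \<Rightarrow> 'b pair_pre_digraph"
    and G\<^sub>2 :: "'b pair_pre_digraph"
    and m t r :: nat and n :: "nat \<Rightarrow> nat"
  assumes "pair_graph G\<^sub>1" "Digraph_Component.connected (with_proj G\<^sub>1)" "card (pverts G\<^sub>1) = m"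
    and "pair_graph H" "Digraph_Component.connected (with_proj H)" "card (pverts H) = t"
    and "\<And>i. i \<in> {1..r} \<Longrightarrow> pair_graph (Hs i)"
    and "\<And>i. i \<in> {1..r} \<Longrightarrow> Digraph_Component.connected (with_proj (Hs i))"
    and "\<And>i. i \<in> {1..r} \<Longrightarrow> card (pverts (Hs i)) = n i"
    and "\<And>i. i \<in> {1..r} \<Longrightarrow> pverts H \<inter> pverts (Hs i) = {}"
    and "\<And>i j. i \<in> {1..r} \<Longrightarrow> j \<in> {1..r} \<Longrightarrow> i \<noteq> j \<Longrightarrow> pverts (Hs i) \<inter> pverts (Hs j) = {}"
    and "r \<ge> 2" and "2 \<le> m" and "m \<le> t + (\<Sum>i=1..r. n i)"
    and "G\<^sub>2 = graph_join H (graph_disjoint_union Hs {1..r})"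
    and "\<And>i. i \<in> {1..r} \<Longrightarrow> n i = 1 \<or> n i \<ge> m"
  shows "J_unmixed TYPE('k::field) G\<^sub>1 G\<^sub>2 \<longleftrightarrow>
    (\<forall>i\<in>{1..r}. J_unmixed TYPE('k) G\<^sub>1 (Hs i)) \<and>
    complete_digraph m (with_proj G\<^sub>1) \<and>
    t = (r - 1) * (m - 1) \<and>
    (\<forall>T\<in>cut_sets (with_proj H). T \<noteq> {} \<longrightarrow>
      (int (num_components_without (with_proj H) T) - 1) * (int m - 1)
        = int (card T + (\<Sum>i=1..r. n i)))"
proof -
  note G1 = assms(1-3) and H = assms(4-6) and Hs = assms(7-9) and disj = assms(10,11)
  have conn_Hs: "(a, b) \<in> conn (parcs (Hs i)) (pverts (Hs i))"
    if "i \<in> {1..r}" "a \<in> pverts (Hs i)" "b \<in> pverts (Hs i)" for i a b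
    using connected_imp_conn(2)[OF Hs(1,2)] that by blast
  interpret graph_join_parts "pverts H" "parcs H" "{1..r}" "\<lambda>i. pverts (Hs i)" "\<lambda>i. parcs (Hs i)"
  proof unfold_locales
    show "pverts (Hs i) \<noteq> {}" if "i \<in> {1..r}" for i using connected_imp_conn(1)[OF Hs(1,2)] that by blast
    show "parcs (Hs i) \<subseteq> pverts (Hs i) \<times> pverts (Hs i)" "finite (pverts (Hs i))" if "i \<in> {1..r}" for i
      using pair_graphD(1,2)[OF Hs(1)] that by blast+
  qed (use pair_graphD[OF H(1)] connected_imp_conn[OF H(1,2)] disj assms(12) in auto)
  have V2: "pverts G\<^sub>2 = pverts H \<union> D" and F2: "parcs G\<^sub>2 = F"
    unfolding assms(15) graph_join_def graph_disjoint_union_def D_def F_def by auto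
  have "pverts H \<inter> pverts (graph_disjoint_union Hs {1..r}) = {}"
    unfolding graph_disjoint_union_def pair_pre_digraph.simps using disj(1) by blast
  then have G2: "pair_graph G\<^sub>2"
    unfolding assms(15) by (intro pair_graph_join pair_graph_disjoint_union H(1) Hs(1)) simp_all
  have "1 \<in> {1..r}" using assms(12) by simp
  then have "D \<noteq> {}" unfolding D_def using ne(2) by blast
  then obtain x y where xy: "x \<in> pverts H" "y \<in> D" using ne(1) by blast
  have conn_G2: "(a, b) \<in> conn (parcs G\<^sub>2) (pverts G\<^sub>2)" if "a \<in> pverts G\<^sub>2" "b \<in> pverts G\<^sub>2" for a b
    using conn_both[of "pverts G\<^sub>2" x y a b] that xy unfolding V2 F2 by blast
  have ne_G2: "pverts G\<^sub>2 \<noteq> {}" using xy unfolding V2 by blast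
  have "card D = (\<Sum>i=1..r. n i)"
    unfolding D_def using fin disj(2) Hs(3) by (subst card_UN_disjoint) auto
  then have card_G2: "card (pverts G\<^sub>1) \<le> card (pverts G\<^sub>2)"
    unfolding V2 using assms(3,14) H(3) VH_D fin(2) finite_D by (simp add: card_Un_disjoint)
  have m: "2 \<le> card (pverts G\<^sub>1)" using assms(3,13) by simp
  have sum_n: "(\<Sum>i=1..r. card (pverts (Hs i))) = (\<Sum>i=1..r. n i)" using Hs(3) by (intro sum.cong) auto
  show ?thesis
  proof (cases "complete_digraph m (with_proj G\<^sub>1)")
    case True
    then have c: "(u, v) \<in> parcs G\<^sub>1" if "u \<in> pverts G\<^sub>1" "v \<in> pverts G\<^sub>1" "u \<noteq> v" for u v
      using complete_digraph_iff[OF assms(1,3)] that by blast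
    have un: "J_unmixed TYPE('k) G\<^sub>1 G \<longleftrightarrow> (\<forall>T. cutset (parcs G) (pverts G) T \<longrightarrow>
        (int (card (ccs (parcs G) (pverts G - T))) - 1) * (int m - 1) = int (card T))"
      if "pair_graph G" "pverts G \<noteq> {}"
        "\<And>a b. a \<in> pverts G \<Longrightarrow> b \<in> pverts G \<Longrightarrow> (a, b) \<in> conn (parcs G) (pverts G)"
      for G :: "'b pair_pre_digraph"
      unfolding assms(3)[symmetric] by (rule unmixed_complete_iff[OF assms(1) c m that])
    have Hs_un: "J_unmixed TYPE('k) G\<^sub>1 (Hs i) \<longleftrightarrow> (\<forall>T. cutset (parcs (Hs i)) (pverts (Hs i)) T \<longrightarrow>
        (int (card (ccs (parcs (Hs i)) (pverts (Hs i) - T))) - 1) * (int m - 1) = int (card T))" if "i \<in> {1..r}" for i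
      by (rule un[OF Hs(1)[OF that] ne(2)[OF that] conn_Hs[OF that]])
    have t: "t = (r - 1) * (m - 1) \<longleftrightarrow> int (card (pverts H)) = (int (card {1..r}) - 1) * (int m - 1)"
    proof -
      have "t = (r - 1) * (m - 1) \<longleftrightarrow> int t = int ((r - 1) * (m - 1))" by (simp only: of_nat_eq_iff)
      then show ?thesis using assms(12,13) H(3) by (simp add: of_nat_diff)
    qed
    have d: "(\<forall>T\<in>cut_sets (with_proj H). T \<noteq> {} \<longrightarrow>
        (int (num_components_without (with_proj H) T) - 1) * (int m - 1) = int (card T + (\<Sum>i=1..r. n i))) \<longleftrightarrow>
      (\<forall>T. cutset (parcs H) (pverts H) T \<longrightarrow> T \<noteq> {} \<longrightarrow>
        (int (card (ccs (parcs H) (pverts H - T))) - 1) * (int m - 1) = int (card T + (\<Sum>i=1..r. card (pverts (Hs i)))))"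
      unfolding sum_n by (simp add: cut_sets_iff[OF H(1)] num_components_without_eq[OF H(1)] Ball_def)
    have "J_unmixed TYPE('k) G\<^sub>1 G\<^sub>2 \<longleftrightarrow> (\<forall>T. cutset F (pverts H \<union> D) T \<longrightarrow>
        (int (card (ccs F (pverts H \<union> D - T))) - 1) * (int m - 1) = int (card T))"
      using un[OF G2 ne_G2 conn_G2] unfolding V2 F2 .
    also note cutset_condition_join[OF conn_Hs, of "int m"]
    finally show ?thesis unfolding t d using True Hs_un by blast
  next
    case False
    \<comment> \<open>Condition (b) fails, so the right side is false; unmixedness of the ideal for
      the join would force completeness, so the left side is false too.\<close>
    then have "\<not> J_unmixed TYPE('k) G\<^sub>1 G\<^sub>2"
      using unmixed_imp_complete[OF assms(1,2) G2 conn_G2 m card_G2, where 'k = 'k]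
        complete_digraph_iff[OF assms(1,3)] by blast
    then show ?thesis using False by blast
  qed
qed

end
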